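(* Let $(M^n,g,X,\lambda)$ be a compact oriented almost Ricci soliton, let $S$ be the scalar curvature of $g$, $Ric$ its Ricci tensor and $dV_g$ its Riemannian volume form. Let $X=\nabla h+Y$ be the Hodge-de Rham decomposition of $X$, where $h:M\to\mathbb{R}$ is a smooth function and $Y$ is a smooth vector field with $\operatorname{div}Y=0$. Then: (1) $\displaystyle\int_M\Big|Ric-\frac{S}{n}g\Big|^2dV_g=\frac{n-2}{2n}\int_M\langle\nabla S,X\rangle\,dV_g$; (2) $\displaystyle\int_M\Big|Ric-\frac{S}{n}g\Big|^2dV_g=\frac{n-2}{2n}\int_M\langle\nabla S,\nabla h\rangle\,dV_g$.
   Context: An almost Ricci soliton $(M^n,g,X,\lambda)$ is a Riemannian manifold $(M^n,g)$ of dimension $n$ together with a complete smooth vector field $X$ and a smooth function $\lambda:M\to\mathbb{R}$ such that $Ric+\frac12\mathcal{L}_Xg=\lambda g$, where $\mathcal{L}_Xg$ is the Lie derivative of the metric. Compact means compact without boundary. On a compact oriented Riemannian manifold every smooth vector field $X$ can be written as $X=\nabla h+Y$ with $h$ a smooth function and $\operatorname{div}Y=0$ (Hodge-de Rham decomposition; $h$ is called the Hodge-de Rham potential). Norms of tensors are those induced by $g$. *)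

theory Defs
  imports "HOL-Analysis.Analysis"
begin

section \<open>Smooth maps on open subsets of Euclidean space\<close>

definition pderiv_at :: "'n \<Rightarrow> (real ^ 'n \<Rightarrow> 'b::real_normed_vector) \<Rightarrow> real ^ 'n::finite \<Rightarrow> 'b"
  where "pderiv_at i f x = frechet_derivative f (at x) (axis i 1)"

text \<open>\<open>Ck_on k U f\<close> is the usual notion of a map of class $C^k$ only for open \<open>U\<close>; all uses below
  are of this kind.\<close>

primrec Ck_on :: "nat \<Rightarrow> (real ^ 'n::finite) set \<Rightarrow> (real ^ 'n \<Rightarrow> 'b::real_normed_vector) \<Rightarrow> bool"
where
  "Ck_on 0 U f \<longleftrightarrow> continuous_on U f"
| "Ck_on (Suc k) U f \<longleftrightarrow>
     (\<forall>x\<in>U. f differentiable (at x)) \<and> (\<forall>i. Ck_on k U (pderiv_at i f))"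

definition smooth_on :: "(real ^ 'n::finite) set \<Rightarrow> (real ^ 'n \<Rightarrow> 'b::real_normed_vector) \<Rightarrow> bool"
  where "smooth_on U f \<longleftrightarrow> (\<forall>k. Ck_on k U f)"


section \<open>Smooth and oriented manifolds\<close>

text \<open>The manifold is the whole type \<open>'m\<close>; its dimension is \<open>CARD('n)\<close>. A chart is a pair of a
  domain and a coordinate map, the values of the latter outside the domain being irrelevant.\<close>

type_synonym ('m, 'n) chart = "'m set \<times> ('m \<Rightarrow> real ^ 'n)"

abbreviation chart_dom :: "('m, 'n::finite) chart \<Rightarrow> 'm set"
  where "chart_dom c \<equiv> fst c"

abbreviation chart_map :: "('m, 'n::finite) chart \<Rightarrow> 'm \<Rightarrow> real ^ 'n"
  where "chart_map c \<equiv> snd c"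

definition chart_img :: "('m, 'n::finite) chart \<Rightarrow> (real ^ 'n) set"
  where "chart_img c = chart_map c ` chart_dom c"

definition chart_inv :: "('m, 'n::finite) chart \<Rightarrow> real ^ 'n \<Rightarrow> 'm"
  where "chart_inv c = inv_into (chart_dom c) (chart_map c)"

definition is_chart :: "('m::topological_space, 'n::finite) chart \<Rightarrow> bool"
  where "is_chart c \<longleftrightarrow> open (chart_dom c) \<and> open (chart_img c) \<and>
    homeomorphism (chart_dom c) (chart_img c) (chart_map c) (chart_inv c)"

definition transition :: "('m, 'n::finite) chart \<Rightarrow> ('m, 'n) chart \<Rightarrow> real ^ 'n \<Rightarrow> real ^ 'n"
  where "transition c d = chart_map d \<circ> chart_inv c"

definition transition_dom :: "('m, 'n::finite) chart \<Rightarrow> ('m, 'n) chart \<Rightarrow> (real ^ 'n) set"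
  where "transition_dom c d = chart_map c ` (chart_dom c \<inter> chart_dom d)"

definition smooth_atlas ::
  "('m::{t2_space, second_countable_topology}, 'n::finite) chart set \<Rightarrow> bool"
where
  "smooth_atlas A \<longleftrightarrow> (\<forall>c\<in>A. is_chart c) \<and> (\<Union>c\<in>A. chart_dom c) = UNIV \<and>
    (\<forall>c\<in>A. \<forall>d\<in>A. smooth_on (transition_dom c d) (transition c d))"

definition oriented_atlas ::
  "('m::{t2_space, second_countable_topology}, 'n::finite) chart set \<Rightarrow> bool"
where
  "oriented_atlas A \<longleftrightarrow> smooth_atlas A \<and>
    (\<forall>c\<in>A. \<forall>d\<in>A. \<forall>x\<in>transition_dom c d. det (jacobian (transition c d) (at x)) > 0)"


section \<open>Functions, vector fields and metrics\<close>

text \<open>A tensor field is given by the family of its components in the charts of the atlas, each a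
  function of the coordinates on the chart image (and irrelevant elsewhere), subject to the
  tensorial transformation law where a condition on it is imposed.\<close>

type_synonym ('m, 'n, 'b) components = "('m, 'n) chart \<Rightarrow> real ^ 'n \<Rightarrow> 'b"

definition in_coords :: "('m \<Rightarrow> real) \<Rightarrow> ('m, 'n::finite, real) components"
  where "in_coords f c = f \<circ> chart_inv c"

definition smooth_function :: "('m, 'n::finite) chart set \<Rightarrow> ('m \<Rightarrow> real) \<Rightarrow> bool"
  where "smooth_function A f \<longleftrightarrow> (\<forall>c\<in>A. smooth_on (chart_img c) (in_coords f c))"

definition smooth_vector_field ::
  "('m, 'n::finite) chart set \<Rightarrow> ('m, 'n, real ^ 'n) components \<Rightarrow> bool"
where
  "smooth_vector_field A X \<longleftrightarrow> (\<forall>c\<in>A. smooth_on (chart_img c) (X c)) \<and>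
    (\<forall>c\<in>A. \<forall>d\<in>A. \<forall>x\<in>transition_dom c d.
       X d (transition c d x) = jacobian (transition c d) (at x) *v X c x)"

definition riemannian_metric ::
  "('m, 'n::finite) chart set \<Rightarrow> ('m, 'n, real ^ 'n ^ 'n) components \<Rightarrow> bool"
where
  "riemannian_metric A g \<longleftrightarrow>
    (\<forall>c\<in>A. smooth_on (chart_img c) (g c)) \<and>
    (\<forall>c\<in>A. \<forall>x\<in>chart_img c. transpose (g c x) = g c x \<and> (\<forall>v. v \<noteq> 0 \<longrightarrow> v \<bullet> (g c x *v v) > 0)) \<and>
    (\<forall>c\<in>A. \<forall>d\<in>A. \<forall>x\<in>transition_dom c d.
       g c x = transpose (jacobian (transition c d) (at x)) ** g d (transition c d x)
                 ** jacobian (transition c d) (at x))"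

text \<open>Continuity of the curve ensures that it stays in a chart domain for a short time, so that its
  velocity can be computed in that chart.\<close>

definition integral_curve ::
  "('m::topological_space, 'n::finite) chart set \<Rightarrow> ('m, 'n, real ^ 'n) components
    \<Rightarrow> (real \<Rightarrow> 'm) \<Rightarrow> bool"
where
  "integral_curve A X \<gamma> \<longleftrightarrow> continuous_on UNIV \<gamma> \<and>
    (\<forall>c\<in>A. \<forall>t. \<gamma> t \<in> chart_dom c \<longrightarrow>
       ((chart_map c \<circ> \<gamma>) has_vector_derivative X c (chart_map c (\<gamma> t))) (at t))"

definition complete_vector_field ::
  "('m::topological_space, 'n::finite) chart set \<Rightarrow> ('m, 'n, real ^ 'n) components \<Rightarrow> bool"
where
  "complete_vector_field A X \<longleftrightarrow> (\<forall>p. \<exists>\<gamma>. \<gamma> 0 = p \<and> integral_curve A X \<gamma>)"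


section \<open>Riemannian geometry in a coordinate domain\<close>

text \<open>Here \<open>G\<close> is the matrix of metric components $g_{ij}$ as a function of the coordinates.\<close>

definition inv_metric :: "(real ^ 'n \<Rightarrow> real ^ 'n ^ 'n) \<Rightarrow> 'n \<Rightarrow> 'n \<Rightarrow> real ^ 'n::finite \<Rightarrow> real"
  where "inv_metric G i j x = matrix_inv (G x) $ i $ j"

text \<open>\<open>christoffel G k i j\<close> is $\Gamma^k_{ij}$.\<close>

definition christoffel ::
  "(real ^ 'n \<Rightarrow> real ^ 'n ^ 'n) \<Rightarrow> 'n \<Rightarrow> 'n \<Rightarrow> 'n \<Rightarrow> real ^ 'n::finite \<Rightarrow> real"
where
  "christoffel G k i j x = (\<Sum>l\<in>UNIV. inv_metric G k l x *
     (pderiv_at i (\<lambda>y. G y $ j $ l) x + pderiv_at j (\<lambda>y. G y $ i $ l) x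
        - pderiv_at l (\<lambda>y. G y $ i $ j) x)) / 2"

text \<open>\<open>riemann G i j k l\<close> is the \<open>l\<close>-th component of $R(\partial_i, \partial_j)\partial_k$, where
  $R(U,V)W = \nabla_U\nabla_V W - \nabla_V\nabla_U W - \nabla_{[U,V]}W$; then
  $Ric(V,W)$ is the trace of $U \mapsto R(U,V)W$.\<close>

definition riemann ::
  "(real ^ 'n \<Rightarrow> real ^ 'n ^ 'n) \<Rightarrow> 'n \<Rightarrow> 'n \<Rightarrow> 'n \<Rightarrow> 'n \<Rightarrow> real ^ 'n::finite \<Rightarrow> real"
where
  "riemann G i j k l x =
     pderiv_at i (christoffel G l j k) x - pderiv_at j (christoffel G l i k) x
     + (\<Sum>m\<in>UNIV. christoffel G m j k x * christoffel G l i m x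
                  - christoffel G m i k x * christoffel G l j m x)"

definition ricci :: "(real ^ 'n \<Rightarrow> real ^ 'n ^ 'n) \<Rightarrow> real ^ 'n::finite \<Rightarrow> real ^ 'n ^ 'n"
  where "ricci G x = (\<chi> j k. \<Sum>i\<in>UNIV. riemann G i j k i x)"

definition scalar_curvature :: "(real ^ 'n \<Rightarrow> real ^ 'n ^ 'n) \<Rightarrow> real ^ 'n::finite \<Rightarrow> real"
  where "scalar_curvature G x = (\<Sum>i\<in>UNIV. \<Sum>j\<in>UNIV. inv_metric G i j x * ricci G x $ i $ j)"

definition gradient ::
  "(real ^ 'n \<Rightarrow> real ^ 'n ^ 'n) \<Rightarrow> (real ^ 'n \<Rightarrow> real) \<Rightarrow> real ^ 'n::finite \<Rightarrow> real ^ 'n"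
  where "gradient G f x = (\<chi> i. \<Sum>j\<in>UNIV. inv_metric G i j x * pderiv_at j f x)"

text \<open>The trace of $\nabla Y$.\<close>

definition divergence ::
  "(real ^ 'n \<Rightarrow> real ^ 'n ^ 'n) \<Rightarrow> (real ^ 'n \<Rightarrow> real ^ 'n) \<Rightarrow> real ^ 'n::finite \<Rightarrow> real"
where
  "divergence G Y x = (\<Sum>i\<in>UNIV. pderiv_at i (\<lambda>y. Y y $ i) x
     + (\<Sum>j\<in>UNIV. christoffel G i i j x * Y x $ j))"

text \<open>$(\mathcal{L}_X g)_{ij} = X(g_{ij}) - g([X,\partial_i],\partial_j) - g(\partial_i,[X,\partial_j])$,
  written out in coordinates.\<close>

definition lie_derivative_metric ::
  "(real ^ 'n \<Rightarrow> real ^ 'n) \<Rightarrow> (real ^ 'n \<Rightarrow> real ^ 'n ^ 'n) \<Rightarrow> real ^ 'n::finite \<Rightarrow> real ^ 'n ^ 'n"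
where
  "lie_derivative_metric X G x = (\<chi> i j. \<Sum>k\<in>UNIV.
     X x $ k * pderiv_at k (\<lambda>y. G y $ i $ j) x
     + G x $ k $ j * pderiv_at i (\<lambda>y. X y $ k) x
     + G x $ i $ k * pderiv_at j (\<lambda>y. X y $ k) x)"

definition vector_inner :: "real ^ 'n ^ 'n \<Rightarrow> real ^ 'n \<Rightarrow> real ^ 'n::finite \<Rightarrow> real"
  where "vector_inner G\<^sub>x u v = (\<Sum>i\<in>UNIV. \<Sum>j\<in>UNIV. G\<^sub>x $ i $ j * u $ i * v $ j)"

text \<open>The inner product and norm induced by the metric on covariant 2-tensors.\<close>

definition tensor_inner :: "real ^ 'n ^ 'n \<Rightarrow> real ^ 'n ^ 'n \<Rightarrow> real ^ 'n ^ 'n::finite \<Rightarrow> real"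
  where "tensor_inner G\<^sub>x S T = (\<Sum>i\<in>UNIV. \<Sum>j\<in>UNIV. \<Sum>k\<in>UNIV. \<Sum>l\<in>UNIV.
     matrix_inv G\<^sub>x $ i $ k * matrix_inv G\<^sub>x $ j $ l * S $ i $ j * T $ k $ l)"

definition tensor_norm :: "real ^ 'n ^ 'n \<Rightarrow> real ^ 'n ^ 'n::finite \<Rightarrow> real"
  where "tensor_norm G\<^sub>x T = sqrt (tensor_inner G\<^sub>x T T)"


section \<open>Integration of top-degree forms on a compact oriented manifold\<close>

text \<open>A finite smooth partition of unity subordinate to the charts in \<open>F\<close>; on a compact manifold
  such partitions exist with \<open>F\<close> finite.\<close>

definition partition_of_unity ::
  "('m::topological_space, 'n::finite) chart set \<Rightarrow> ('m, 'n) chart set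
    \<Rightarrow> (('m, 'n) chart \<Rightarrow> 'm \<Rightarrow> real) \<Rightarrow> bool"
where
  "partition_of_unity A F \<rho> \<longleftrightarrow> finite F \<and> F \<subseteq> A \<and>
    (\<forall>c\<in>F. smooth_function A (\<rho> c) \<and> (\<forall>p. 0 \<le> \<rho> c p) \<and>
           closure {p. \<rho> c p \<noteq> 0} \<subseteq> chart_dom c) \<and>
    (\<forall>p. (\<Sum>c\<in>F. \<rho> c p) = 1)"

text \<open>\<open>\<omega> c\<close> is the coefficient of the form with respect to $dx^1\wedge\dots\wedge dx^n$ in the
  (positively oriented) chart \<open>c\<close>. The value does not depend on the partition of unity chosen.\<close>

definition integral_form ::
  "('m::topological_space, 'n::finite) chart set \<Rightarrow> ('m, 'n, real) components \<Rightarrow> real"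
where
  "integral_form A \<omega> = (case (SOME P. case P of (F, \<rho>) \<Rightarrow> partition_of_unity A F \<rho>) of
     (F, \<rho>) \<Rightarrow> (\<Sum>c\<in>F. LINT x:chart_img c|lborel. in_coords (\<rho> c) c x * \<omega> c x))"

definition volume_form ::
  "('m, 'n::finite, real ^ 'n ^ 'n) components \<Rightarrow> ('m, 'n, real) components"
  where "volume_form g c x = sqrt (det (g c x))"

definition integral_volume ::
  "('m::topological_space, 'n::finite) chart set \<Rightarrow> ('m, 'n, real ^ 'n ^ 'n) components
    \<Rightarrow> ('m, 'n, real) components \<Rightarrow> real"
  where "integral_volume A g f = integral_form A (\<lambda>c x. f c x * volume_form g c x)"


section \<open>Almost Ricci solitons\<close>

definition almost_ricci_soliton ::
  "('m::{t2_space, second_countable_topology}, 'n::finite) chart set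
    \<Rightarrow> ('m, 'n, real ^ 'n ^ 'n) components \<Rightarrow> ('m, 'n, real ^ 'n) components
    \<Rightarrow> ('m \<Rightarrow> real) \<Rightarrow> bool"
where
  "almost_ricci_soliton A g X lam \<longleftrightarrow>
     smooth_atlas A \<and> riemannian_metric A g \<and>
     smooth_vector_field A X \<and> complete_vector_field A X \<and> smooth_function A lam \<and>
     (\<forall>c\<in>A. \<forall>x\<in>chart_img c.
        ricci (g c) x + (1/2) *\<^sub>R lie_derivative_metric (X c) (g c) x
          = in_coords lam c x *\<^sub>R g c x)"

definition hodge_de_rham_decomposition ::
  "('m, 'n::finite) chart set \<Rightarrow> ('m, 'n, real ^ 'n ^ 'n) components
    \<Rightarrow> ('m, 'n, real ^ 'n) components \<Rightarrow> ('m \<Rightarrow> real) \<Rightarrow> ('m, 'n, real ^ 'n) components \<Rightarrow> bool"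
where
  "hodge_de_rham_decomposition A g X h Y \<longleftrightarrow>
     smooth_function A h \<and> smooth_vector_field A Y \<and>
     (\<forall>c\<in>A. \<forall>x\<in>chart_img c.
        X c x = gradient (g c) (in_coords h c) x + Y c x \<and> divergence (g c) (Y c) x = 0)"

definition traceless_ricci :: "(real ^ 'n \<Rightarrow> real ^ 'n ^ 'n) \<Rightarrow> real ^ 'n::finite \<Rightarrow> real ^ 'n ^ 'n"
  where "traceless_ricci G x = ricci G x - (scalar_curvature G x / real CARD('n)) *\<^sub>R G x"

end

theory Submission
  imports Defs
begin

text \<open>Let $E = Ric - \frac{S}{n} g$ and let $Z$ be the vector field dual to $E(X, \cdot)$. As $E$ is
  trace-free, the soliton equation gives $|E|^2 = -\frac12 \langle E, \mathcal{L}_X g\rangle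
  = (\operatorname{div} E)(X) - \operatorname{div} Z$, and the contracted second Bianchi identity
  $\operatorname{div} Ric = \frac12 dS$ turns $\operatorname{div} E$ into $\frac{n-2}{2n} dS$. The
  divergence theorem then yields (1), and (2) follows because
  $\langle\nabla S, Y\rangle = \operatorname{div}(S Y)$.

  The second Bianchi identity becomes matrix algebra for the matrices $(\Gamma_a)^l{}_k = \Gamma^l_{ak}$.
  That $Ric$ is a tensor is read off from the soliton equation, since only $\mathcal{L}_X g$ and $g$ have to be
  transformed. For the divergence theorem, integration by parts in each chart together with
  $\sum_d \rho_d = 1$ gives $-\sum_{c,d} \int \rho_d\, Z(\rho_c)\, dV$, where every summand may be
  computed in either chart; summing over $c$ first gives zero as $\sum_c Z(\rho_c) = Z(1)$.\<close>

section \<open>Calculus of smooth maps\<close>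

text \<open>The constant (n-2)/(2n) is 1/2 - 1/n: the contracted Bianchi identity contributes 1/2,
  and the trace part (S/n) g of the Ricci tensor contributes -1/n.

  Every tensor is a family of components, so a transformation law has to be proved before a field
  may enter the divergence theorem. Transforming Ric directly would mean transforming derivatives of
  Christoffel symbols, with third derivatives of the transition maps. The Lie derivative of the
  metric produces only second derivatives of them, and these cancel by symmetry.

  The integral is defined by a partition of unity picked by choice. The argument runs with that one
  partition throughout, so integrals for different partitions are never compared; but a partition
  has to be constructed, since otherwise nothing would be known about the chosen one. Charts are
  changed only for the products \<rho>_d Z(\<rho>_c), whose support is a compact subset of the
  overlap of two chart domains.\<close>

lemma pderiv_at_eq:
  assumes "(f has_derivative D) (at x)"
  shows "pderiv_at i f x = D (axis i 1)"
  using frechet_derivative_at[OF assms] by (simp add: pderiv_at_def)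

text \<open>Smoothness is formulated through partial derivatives alone; linearity recovers the whole
  derivative from its values on the axes, as the chain rule requires.\<close>

lemma has_derivative_pderiv:
  assumes "f differentiable (at x)"
  shows "(f has_derivative (\<lambda>v. \<Sum>i\<in>UNIV. v $ i *\<^sub>R pderiv_at i f x)) (at x)"
proof -
  obtain D where D: "(f has_derivative D) (at x)"
    using assms by (auto simp: differentiable_def)
  then have lin: "linear D" by (rule has_derivative_linear)
  have "D v = (\<Sum>i\<in>UNIV. v $ i *\<^sub>R pderiv_at i f x)" for v
  proof -
    have "D v = D (\<Sum>i\<in>UNIV. v $ i *\<^sub>R axis i 1)"
      using basis_expansion[of v] by (simp add: scalar_mult_eq_scaleR)
    also have "\<dots> = (\<Sum>i\<in>UNIV. v $ i *\<^sub>R D (axis i 1))"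
      by (simp add: linear_sum[OF lin] linear_cmul[OF lin])
    finally show ?thesis by (simp add: pderiv_at_eq[OF D])
  qed
  then have "D = (\<lambda>v. \<Sum>i\<in>UNIV. v $ i *\<^sub>R pderiv_at i f x)" by blast
  with D show ?thesis by simp
qed

text \<open>Components are meaningful only on the chart image. As differentiation is local, an
  identity on an open set may be differentiated there, whatever the functions do elsewhere.\<close>

lemma pderiv_at_cong:
  assumes "open U" "x \<in> U" "\<And>y. y \<in> U \<Longrightarrow> f y = g y"
  shows "pderiv_at i f x = pderiv_at i g x"
proof -
  have "(f has_derivative D) (at x) \<longleftrightarrow> (g has_derivative D) (at x)" for D
    using assms has_derivative_transform_within_open[of f D x UNIV U g]
      has_derivative_transform_within_open[of g D x UNIV U f] by auto
  then show ?thesis by (simp add: pderiv_at_def frechet_derivative_def)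
qed

lemma differentiable_cong_open:
  assumes "open U" "x \<in> U" "\<And>y. y \<in> U \<Longrightarrow> f y = g y" "f differentiable (at x)"
  shows "g differentiable (at x)"
  using assms has_derivative_transform_within_open[of f _ x UNIV U g]
  by (auto simp: differentiable_def)

lemma pderiv_at_const [simp]: "pderiv_at i (\<lambda>x. c) = (\<lambda>x. 0)"
  by (simp add: fun_eq_iff pderiv_at_def)

lemma pderiv_at_linear:
  assumes "bounded_linear L" "f differentiable (at x)"
  shows "pderiv_at i (\<lambda>y. L (f y)) x = L (pderiv_at i f x)"
proof -
  obtain D where D: "(f has_derivative D) (at x)"
    using assms by (auto simp: differentiable_def)
  show ?thesis
    using pderiv_at_eq[OF bounded_linear.has_derivative[OF assms(1) D]] pderiv_at_eq[OF D] by simp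
qed

lemma pderiv_at_nth:
  assumes "f differentiable (at x)"
  shows "pderiv_at i (\<lambda>y. f y $ k) x = pderiv_at i f x $ k"
  by (rule pderiv_at_linear[OF bounded_linear_vec_nth assms])

lemma pderiv_at_add:
  assumes "f differentiable (at x)" "g differentiable (at x)"
  shows "pderiv_at i (\<lambda>y. f y + g y) x = pderiv_at i f x + pderiv_at i g x"
proof -
  obtain D E where D: "(f has_derivative D) (at x)" and E: "(g has_derivative E) (at x)"
    using assms by (auto simp: differentiable_def)
  show ?thesis
    using pderiv_at_eq[OF has_derivative_add[OF D E]] pderiv_at_eq[OF D] pderiv_at_eq[OF E] by simp
qed

lemma pderiv_at_diff:
  assumes "f differentiable (at x)" "g differentiable (at x)"
  shows "pderiv_at i (\<lambda>y. f y - g y) x = pderiv_at i f x - pderiv_at i g x"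
proof -
  obtain D E where D: "(f has_derivative D) (at x)" and E: "(g has_derivative E) (at x)"
    using assms by (auto simp: differentiable_def)
  show ?thesis
    using pderiv_at_eq[OF has_derivative_diff[OF D E]] pderiv_at_eq[OF D] pderiv_at_eq[OF E] by simp
qed

lemma pderiv_at_sum:
  assumes "\<And>a. a \<in> I \<Longrightarrow> f a differentiable (at x)"
  shows "pderiv_at i (\<lambda>y. \<Sum>a\<in>I. f a y) x = (\<Sum>a\<in>I. pderiv_at i (f a) x)"
proof -
  have "((\<lambda>y. \<Sum>a\<in>I. f a y) has_derivative
      (\<lambda>v. \<Sum>a\<in>I. \<Sum>j\<in>UNIV. v $ j *\<^sub>R pderiv_at j (f a) x)) (at x)"
    by (intro has_derivative_sum has_derivative_pderiv assms)
  from pderiv_at_eq[OF this, of i] show ?thesis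
    by (simp add: axis_def if_distrib[of "\<lambda>c. c *\<^sub>R _"] cong: if_cong)
qed

lemma pderiv_at_bilinear:
  assumes "bounded_bilinear b" "f differentiable (at x)" "g differentiable (at x)"
  shows "pderiv_at i (\<lambda>y. b (f y) (g y)) x = b (f x) (pderiv_at i g x) + b (pderiv_at i f x) (g x)"
proof -
  obtain D E where D: "(f has_derivative D) (at x)" and E: "(g has_derivative E) (at x)"
    using assms by (auto simp: differentiable_def)
  show ?thesis
    using pderiv_at_eq[OF bounded_bilinear.FDERIV[OF assms(1) D E]]
      pderiv_at_eq[OF D] pderiv_at_eq[OF E] by simp
qed

lemmas pderiv_at_mult = pderiv_at_bilinear[OF bounded_bilinear_mult]

lemma differentiable_bilinear:
  assumes "bounded_bilinear b" "f differentiable (at x)" "g differentiable (at x)"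
  shows "(\<lambda>y. b (f y) (g y)) differentiable (at x)"
proof -
  obtain D E where D: "(f has_derivative D) (at x)" and E: "(g has_derivative E) (at x)"
    using assms by (auto simp: differentiable_def)
  show ?thesis
    using bounded_bilinear.FDERIV[OF assms(1) D E] by (rule differentiableI)
qed

lemma differentiable_linear:
  assumes "bounded_linear L" "f differentiable (at x)"
  shows "(\<lambda>y. L (f y)) differentiable (at x)"
  using assms bounded_linear.has_derivative unfolding differentiable_def by blast

lemma differentiable_nth: "f differentiable (at x) \<Longrightarrow> (\<lambda>y. f y $ k) differentiable (at x)"
  by (rule differentiable_linear[OF bounded_linear_vec_nth])

lemma pderiv_at_compose:
  fixes f :: "real ^ 'k::finite \<Rightarrow> 'b::real_normed_vector" and \<psi> :: "real ^ 'n::finite \<Rightarrow> real ^ 'k"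
  assumes "\<psi> differentiable (at x)" "f differentiable (at (\<psi> x))"
  shows "pderiv_at i (f \<circ> \<psi>) x = (\<Sum>j\<in>UNIV. pderiv_at i \<psi> x $ j *\<^sub>R pderiv_at j f (\<psi> x))"
proof -
  obtain D where D: "(\<psi> has_derivative D) (at x)"
    using assms by (auto simp: differentiable_def)
  show ?thesis
    using pderiv_at_eq[OF diff_chain_at[OF D has_derivative_pderiv[OF assms(2)]]] pderiv_at_eq[OF D]
    by simp
qed

lemma pderiv_at_real_compose:
  fixes f :: "real ^ 'n::finite \<Rightarrow> real"
  assumes "f differentiable (at x)" "(H has_real_derivative H') (at (f x))"
  shows "pderiv_at i (\<lambda>y. H (f y)) x = H' * pderiv_at i f x"
    and "(\<lambda>y. H (f y)) differentiable (at x)"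
proof -
  obtain D where D: "(f has_derivative D) (at x)"
    using assms by (auto simp: differentiable_def)
  have "((\<lambda>y. H (f y)) has_derivative (\<lambda>v. H' * D v)) (at x)"
    using has_derivative_compose[OF D assms(2)[unfolded has_field_derivative_def]]
    by (simp add: mult.commute)
  then show "pderiv_at i (\<lambda>y. H (f y)) x = H' * pderiv_at i f x"
    and "(\<lambda>y. H (f y)) differentiable (at x)"
    using pderiv_at_eq pderiv_at_eq[OF D] by (fastforce intro: differentiableI)+
qed

subsection \<open>Closure properties of the classes of differentiable maps\<close>

lemma Ck_on_cong:
  assumes "open U" "\<And>x. x \<in> U \<Longrightarrow> f x = g x" "Ck_on k U f"
  shows "Ck_on k U g"
  using assms(2,3)
proof (induction k arbitrary: f g)
  case 0
  then show ?case using continuous_on_cong[of U U f g] by simp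
next
  case (Suc k)
  have "Ck_on k U (pderiv_at i g)" for i
  proof (rule Suc.IH[of "pderiv_at i f"])
    show "pderiv_at i f x = pderiv_at i g x" if "x \<in> U" for x
      by (rule pderiv_at_cong[OF assms(1) that Suc.prems(1)])
  qed (use Suc.prems in simp)
  moreover have "g differentiable (at x)" if "x \<in> U" for x
    by (rule differentiable_cong_open[OF assms(1) that Suc.prems(1)]) (use Suc.prems that in simp_all)
  ultimately show ?case by simp
qed

lemma Ck_on_SucD: "Ck_on (Suc k) U f \<Longrightarrow> Ck_on k U f"
proof (induction k arbitrary: f)
  case 0
  then show ?case
    by (auto intro!: continuous_at_imp_continuous_on differentiable_imp_continuous_within)
qed auto

lemma Ck_on_subset: "Ck_on k U f \<Longrightarrow> V \<subseteq> U \<Longrightarrow> Ck_on k V f"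
  by (induction k arbitrary: f) (auto intro: continuous_on_subset)

lemma Ck_on_UN:
  assumes "\<And>a. a \<in> I \<Longrightarrow> open (U a)" "\<And>a. a \<in> I \<Longrightarrow> Ck_on k (U a) f"
  shows "Ck_on k (\<Union>a\<in>I. U a) f"
  using assms(2)
  by (induction k arbitrary: f) (use assms(1) in \<open>auto intro!: continuous_on_open_UN\<close>)

lemma Ck_on_const: "Ck_on k U (\<lambda>x. c)"
  by (induction k arbitrary: c) auto

lemma Ck_on_linear:
  assumes "open U" "bounded_linear L" "Ck_on k U f"
  shows "Ck_on k U (\<lambda>x. L (f x))"
  using assms(3)
proof (induction k arbitrary: f)
  case 0
  then show ?case using bounded_linear.continuous_on[OF assms(2)] by auto
next
  case (Suc k)
  have "Ck_on k U (pderiv_at i (\<lambda>x. L (f x)))" for i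
    by (rule Ck_on_cong[OF assms(1) _ Suc.IH[of "pderiv_at i f"]])
      (use Suc.prems in \<open>auto simp: pderiv_at_linear[OF assms(2)]\<close>)
  then show ?case using Suc.prems differentiable_linear[OF assms(2)] by auto
qed

lemma Ck_on_add:
  assumes "open U" "Ck_on k U f" "Ck_on k U g"
  shows "Ck_on k U (\<lambda>x. f x + g x)"
  using assms(2,3)
proof (induction k arbitrary: f g)
  case 0
  then show ?case by (auto intro: continuous_on_add)
next
  case (Suc k)
  have "Ck_on k U (pderiv_at i (\<lambda>x. f x + g x))" for i
    by (rule Ck_on_cong[OF assms(1) _ Suc.IH[of "pderiv_at i f" "pderiv_at i g"]])
      (use Suc.prems in \<open>auto simp: pderiv_at_add\<close>)
  then show ?case using Suc.prems by auto
qed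

lemma Ck_on_sum:
  assumes "open U" "\<And>a. a \<in> I \<Longrightarrow> Ck_on k U (f a)"
  shows "Ck_on k U (\<lambda>x. \<Sum>a\<in>I. f a x)"
  using assms(2)
  by (induction I rule: infinite_finite_induct) (auto simp: Ck_on_const Ck_on_add assms(1))

text \<open>Both terms of the product rule are again \<open>b\<close> applied to a pair of maps, so
  the induction runs over all pairs. A general \<open>b\<close> covers products of numbers, scalar
  multiples, inner products and matrix products at once.\<close>

lemma Ck_on_bilinear:
  assumes "open U" "bounded_bilinear b" "Ck_on k U f" "Ck_on k U g"
  shows "Ck_on k U (\<lambda>x. b (f x) (g x))"
  using assms(3,4)
proof (induction k arbitrary: f g)
  case 0
  then show ?case using bounded_bilinear.continuous_on[OF assms(2)] by auto
next
  case (Suc k)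
  have "Ck_on k U (\<lambda>x. b (f x) (pderiv_at i g x) + b (pderiv_at i f x) (g x))" for i
    using Suc.prems by (intro Ck_on_add[OF assms(1)] Suc.IH Ck_on_SucD[OF Suc.prems(1)]
        Ck_on_SucD[OF Suc.prems(2)]) auto
  then have "Ck_on k U (pderiv_at i (\<lambda>x. b (f x) (g x)))" for i
    by (rule Ck_on_cong[OF assms(1), rotated])
      (use Suc.prems in \<open>auto simp: pderiv_at_bilinear[OF assms(2)]\<close>)
  moreover have "(\<lambda>x. b (f x) (g x)) differentiable (at x)" if "x \<in> U" for x
    using Suc.prems that by (intro differentiable_bilinear[OF assms(2)]) auto
  ultimately show ?case by simp
qed

text \<open>The outer function comes with all its derivatives \<open>H 0\<close>,
  \<open>H 1\<close>, and so on: the chain rule turns \<open>H m\<close> into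
  \<open>H (Suc m)\<close>, so the induction on \<open>k\<close> has to be open in
  \<open>m\<close>.\<close>

lemma Ck_on_real_compose:
  fixes f :: "real ^ 'n::finite \<Rightarrow> real" and H :: "nat \<Rightarrow> real \<Rightarrow> real"
  assumes "open U" "f ` U \<subseteq> T" "\<And>m t. t \<in> T \<Longrightarrow> (H m has_real_derivative H (Suc m) t) (at t)"
    and "Ck_on k U f"
  shows "Ck_on k U (\<lambda>x. H m (f x))"
  using assms(4)
proof (induction k arbitrary: m)
  case 0
  have "continuous_on T (H m)"
    using assms(3) by (meson DERIV_isCont continuous_at_imp_continuous_on)
  then show ?case using continuous_on_compose2[of T "H m" U f] 0 assms(2) by auto
next
  case (Suc k)
  have "Ck_on k U (\<lambda>x. H (Suc m) (f x) * pderiv_at i f x)" for i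
    using Suc.prems Ck_on_SucD[OF Suc.prems]
    by (intro Ck_on_bilinear[OF assms(1) bounded_bilinear_mult] Suc.IH) auto
  moreover have H: "(H m has_real_derivative H (Suc m) (f x)) (at (f x))"
    and f: "f differentiable (at x)" if "x \<in> U" for x
    using assms(2,3) Suc.prems that by auto
  ultimately have "Ck_on k U (pderiv_at i (\<lambda>x. H m (f x)))" for i
    apply -
    apply (rule Ck_on_cong[OF assms(1), of "\<lambda>x. H (Suc m) (f x) * pderiv_at i f x"])
    by (auto simp: pderiv_at_real_compose(1)[OF f H])
  then show ?case
    using pderiv_at_real_compose(2)[OF f H] by simp
qed

lemma smooth_on_cong: "open U \<Longrightarrow> (\<And>x. x \<in> U \<Longrightarrow> f x = g x) \<Longrightarrow> smooth_on U f \<Longrightarrow> smooth_on U g"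
  using Ck_on_cong unfolding smooth_on_def by blast

lemma smooth_on_subset: "smooth_on U f \<Longrightarrow> V \<subseteq> U \<Longrightarrow> smooth_on V f"
  using Ck_on_subset unfolding smooth_on_def by blast

lemma smooth_on_Un: "open U \<Longrightarrow> open V \<Longrightarrow> smooth_on U f \<Longrightarrow> smooth_on V f \<Longrightarrow> smooth_on (U \<union> V) f"
  using Ck_on_UN[of "{U, V}" "\<lambda>u. u"] unfolding smooth_on_def by fastforce

lemma smooth_on_differentiable: "smooth_on U f \<Longrightarrow> x \<in> U \<Longrightarrow> f differentiable (at x)"
  unfolding smooth_on_def by (metis Ck_on.simps(2))

lemma smooth_on_continuous: "smooth_on U f \<Longrightarrow> continuous_on U f"
  unfolding smooth_on_def by (metis Ck_on.simps(1))

lemma smooth_on_pderiv: "smooth_on U f \<Longrightarrow> smooth_on U (pderiv_at i f)"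
  unfolding smooth_on_def by (metis Ck_on.simps(2))

lemma smooth_on_const: "smooth_on U (\<lambda>x. c)"
  by (simp add: smooth_on_def Ck_on_const)

lemma smooth_on_linear: "open U \<Longrightarrow> bounded_linear L \<Longrightarrow> smooth_on U f \<Longrightarrow> smooth_on U (\<lambda>x. L (f x))"
  by (simp add: smooth_on_def Ck_on_linear)

lemma smooth_on_add:
  "open U \<Longrightarrow> smooth_on U f \<Longrightarrow> smooth_on U g \<Longrightarrow> smooth_on U (\<lambda>x. f x + g x)"
  by (simp add: smooth_on_def Ck_on_add)

lemma smooth_on_sum:
  "open U \<Longrightarrow> (\<And>a. a \<in> I \<Longrightarrow> smooth_on U (f a)) \<Longrightarrow> smooth_on U (\<lambda>x. \<Sum>a\<in>I. f a x)"
  by (simp add: smooth_on_def Ck_on_sum)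

lemma smooth_on_bilinear:
  "open U \<Longrightarrow> bounded_bilinear b \<Longrightarrow> smooth_on U f \<Longrightarrow> smooth_on U g \<Longrightarrow>
    smooth_on U (\<lambda>x. b (f x) (g x))"
  by (simp add: smooth_on_def Ck_on_bilinear)

lemmas smooth_on_mult = smooth_on_bilinear[OF _ bounded_bilinear_mult]

lemma smooth_on_nth: "open U \<Longrightarrow> smooth_on U f \<Longrightarrow> smooth_on U (\<lambda>x. f x $ k)"
  by (rule smooth_on_linear[OF _ bounded_linear_vec_nth])

lemma smooth_on_diff:
  assumes "open U" "smooth_on U f" "smooth_on U g"
  shows "smooth_on U (\<lambda>x. f x - g x)"
  using smooth_on_add[OF assms(1,2) smooth_on_linear[OF assms(1) _ assms(3), of uminus]]
  by (simp add: bounded_linear_minus bounded_linear_ident)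

lemma smooth_on_prod:
  fixes f :: "'a \<Rightarrow> real ^ 'n::finite \<Rightarrow> real"
  assumes "open U" "\<And>a. a \<in> I \<Longrightarrow> smooth_on U (f a)"
  shows "smooth_on U (\<lambda>x. \<Prod>a\<in>I. f a x)"
  using assms(2)
  by (induction I rule: infinite_finite_induct) (auto simp: smooth_on_const smooth_on_mult assms(1))

lemma bounded_linear_axis: "bounded_linear (axis k :: 'b::real_normed_vector \<Rightarrow> 'b ^ 'n::finite)"
proof (rule bounded_linear_intro[of _ 1])
  show "norm (axis k x :: 'b ^ 'n) \<le> norm x * 1" for x :: 'b
  proof -
    have "(norm (axis k x :: 'b ^ 'n))\<^sup>2 = (\<Sum>i\<in>UNIV. if i = k then (norm x)\<^sup>2 else 0)"
      by (simp add: norm_vec_def L2_set_def axis_def real_sqrt_pow2 sum_nonneg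
          if_distrib[of "\<lambda>c. (norm c)\<^sup>2"] cong: if_cong)
    then show ?thesis by simp
  qed
qed (auto simp: vec_eq_iff axis_def)

lemma smooth_on_vec_lambda:
  assumes "open U" "\<And>k. smooth_on U (f k)"
  shows "smooth_on U (\<lambda>x. \<chi> k. f k x)"
proof -
  have eq: "(\<chi> k. f k x) = (\<Sum>k\<in>UNIV. axis k (f k x))" for x
    by (simp add: vec_eq_iff axis_def)
  show ?thesis
    unfolding eq by (intro smooth_on_sum smooth_on_linear[OF _ bounded_linear_axis] assms)
qed

lemma smooth_on_real_compose:
  fixes f :: "real ^ 'n::finite \<Rightarrow> real" and H :: "nat \<Rightarrow> real \<Rightarrow> real"
  assumes "open U" "f ` U \<subseteq> T" "\<And>m t. t \<in> T \<Longrightarrow> (H m has_real_derivative H (Suc m) t) (at t)"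
    and "smooth_on U f"
  shows "smooth_on U (\<lambda>x. H m (f x))"
  using assms by (simp add: smooth_on_def Ck_on_real_compose)

lemma smooth_on_powr:
  fixes f :: "real ^ 'n::finite \<Rightarrow> real"
  assumes "open U" "smooth_on U f" "\<And>x. x \<in> U \<Longrightarrow> f x > 0"
  shows "smooth_on U (\<lambda>x. f x powr a)"
proof -
  \<comment> \<open>The m-th derivative of the power with exponent \<open>a\<close>; the product is
    a falling factorial.\<close>
  define H where "H m t = (\<Prod>j<m. a - real j) * t powr (a - real m)" for m t
  have "(H m has_real_derivative H (Suc m) t) (at t)" if "t \<in> {0<..}" for m t
    using that unfolding H_def
    by (auto intro!: derivative_eq_intros simp: algebra_simps)
  from smooth_on_real_compose[of U f "{0<..}" H 0, OF assms(1) _ this assms(2)]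
  show ?thesis using assms(3) by (auto simp: H_def)
qed

lemma smooth_on_divide:
  fixes f g :: "real ^ 'n::finite \<Rightarrow> real"
  assumes "open U" "smooth_on U f" "smooth_on U g" "\<And>x. x \<in> U \<Longrightarrow> g x > 0"
  shows "smooth_on U (\<lambda>x. f x / g x)"
proof (rule smooth_on_cong[OF assms(1)])
  show "smooth_on U (\<lambda>x. f x * g x powr (-1))"
    by (intro smooth_on_mult smooth_on_powr assms)
  show "f x * g x powr (-1) = f x / g x" if "x \<in> U" for x
    using assms(4)[OF that] by (simp add: powr_minus divide_inverse)
qed

lemma smooth_on_sqrt:
  fixes f :: "real ^ 'n::finite \<Rightarrow> real"
  assumes "open U" "smooth_on U f" "\<And>x. x \<in> U \<Longrightarrow> f x > 0"
  shows "smooth_on U (\<lambda>x. sqrt (f x))"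
  using smooth_on_powr[OF assms, of "1/2"]
  by (rule smooth_on_cong[OF assms(1), rotated])
    (auto simp: powr_half_sqrt less_imp_le assms(3))

subsection \<open>Symmetry of second partial derivatives\<close>

lemma has_real_derivative_along_axis:
  fixes f :: "real ^ 'n::finite \<Rightarrow> real"
  assumes "f differentiable (at (y + s *\<^sub>R axis i 1))"
  shows "((\<lambda>s. f (y + s *\<^sub>R axis i 1)) has_real_derivative pderiv_at i f (y + s *\<^sub>R axis i 1)) (at s)"
proof -
  have "((\<lambda>s. y + s *\<^sub>R axis i 1) has_derivative (\<lambda>s. s *\<^sub>R axis i 1)) (at s)"
    by (auto intro!: derivative_eq_intros)
  from has_derivative_compose[OF this has_derivative_pderiv[OF assms]]
  show ?thesis
    by (simp add: has_field_derivative_def axis_def mult_commute_abs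
        if_distrib[of "\<lambda>c. _ * c"] if_distrib[of "\<lambda>c. c * _"] cong: if_cong)
qed

text \<open>The mean value theorem is applied twice, to \<open>u\<close> in direction
  \<open>i\<close> and then to \<open>w\<close> in direction \<open>j\<close>. The second difference
  is symmetric in \<open>i\<close> and \<open>j\<close> although the right-hand side is not, and
  this is the source of the symmetry of mixed derivatives. The bound on \<open>h\<close> keeps the
  whole parallelogram inside the ball.\<close>

lemma second_difference_mvt:
  fixes f :: "real ^ 'n::finite \<Rightarrow> real"
  assumes f: "\<And>y. y \<in> ball x r \<Longrightarrow> f differentiable (at y)"
    and f': "\<And>y. y \<in> ball x r \<Longrightarrow> pderiv_at i f differentiable (at y)"
    and h: "0 < h" "2 * h < r"
  obtains s t where "0 < s" "s < h" "0 < t" "t < h"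
    "f (x + h *\<^sub>R axis i 1 + h *\<^sub>R axis j 1) - f (x + h *\<^sub>R axis i 1) - f (x + h *\<^sub>R axis j 1) + f x
      = h\<^sup>2 * pderiv_at j (pderiv_at i f) (x + s *\<^sub>R axis i 1 + t *\<^sub>R axis j 1)"
proof -
  have inb: "x + s *\<^sub>R axis i 1 + t *\<^sub>R axis j 1 \<in> ball x r"
    if "0 \<le> s" "s \<le> h" "0 \<le> t" "t \<le> h" for s t
  proof -
    have "norm (s *\<^sub>R axis i 1 + t *\<^sub>R axis j 1 :: real ^ 'n) \<le> s + t"
      using norm_triangle_ineq[of "s *\<^sub>R axis i 1 :: real ^ 'n" "t *\<^sub>R axis j 1"] that
      by (simp add: norm_axis_1)
    then show ?thesis
      using that h by (simp only: mem_ball dist_norm norm_minus_commute[of x]) (simp add: add.assoc)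
  qed
  define u where "u = (\<lambda>s. f (x + h *\<^sub>R axis j 1 + s *\<^sub>R axis i 1) - f (x + s *\<^sub>R axis i 1))"
  have du: "(u has_real_derivative pderiv_at i f (x + h *\<^sub>R axis j 1 + s *\<^sub>R axis i 1)
      - pderiv_at i f (x + s *\<^sub>R axis i 1)) (at s)" if "0 \<le> s" "s \<le> h" for s
    unfolding u_def using inb[of s h] inb[of s 0] that h
    by (intro DERIV_diff has_real_derivative_along_axis f) (auto simp: algebra_simps)
  obtain s where s: "0 < s" "s < h" and us: "u h - u 0 = (h - 0) *
      (pderiv_at i f (x + h *\<^sub>R axis j 1 + s *\<^sub>R axis i 1) - pderiv_at i f (x + s *\<^sub>R axis i 1))"
    using MVT2[OF h(1) du] by blast
  define w where "w = (\<lambda>t. pderiv_at i f ((x + s *\<^sub>R axis i 1) + t *\<^sub>R axis j 1))"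
  have dw: "(w has_real_derivative pderiv_at j (pderiv_at i f) (x + s *\<^sub>R axis i 1 + t *\<^sub>R axis j 1)) (at t)"
    if "0 \<le> t" "t \<le> h" for t
    unfolding w_def using inb[of s t] s that
    by (intro has_real_derivative_along_axis f') auto
  obtain t where t: "0 < t" "t < h" and wt: "w h - w 0 = (h - 0) *
      pderiv_at j (pderiv_at i f) (x + s *\<^sub>R axis i 1 + t *\<^sub>R axis j 1)"
    using MVT2[OF h(1) dw] by blast
  have "u h - u 0 = h * (w h - w 0)"
    using us by (simp add: w_def add_ac)
  then show thesis
    using that[OF s t] wt by (simp add: u_def power2_eq_square add_ac)
qed

text \<open>Both mixed derivatives, each taken at some point near \<open>x\<close>, equal the same
  second difference divided by the square of \<open>h\<close>; continuity then identifies their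
  values at \<open>x\<close>.\<close>

lemma pderiv_at_commute:
  fixes f :: "real ^ 'n::finite \<Rightarrow> real"
  assumes "open U" "smooth_on U f" "x \<in> U"
  shows "pderiv_at i (pderiv_at j f) x = pderiv_at j (pderiv_at i f) x"
proof -
  obtain r where r: "r > 0" "ball x r \<subseteq> U"
    using assms by (meson open_contains_ball)
  have d: "f differentiable (at y)" "pderiv_at k f differentiable (at y)" if "y \<in> ball x r" for y k
    using that r smooth_on_differentiable[OF assms(2)]
      smooth_on_differentiable[OF smooth_on_pderiv[OF assms(2)]] by blast+
  have near: "\<bar>pderiv_at i (pderiv_at j f) x - pderiv_at j (pderiv_at i f) x\<bar> \<le> \<epsilon>" if eps: "\<epsilon> > 0" for \<epsilon>
  proof -
    have c: "continuous (at x) (pderiv_at k (pderiv_at l f))" for k l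
      using assms by (meson differentiable_imp_continuous_within smooth_on_differentiable smooth_on_pderiv)
    obtain d1 where d1: "d1 > 0" "\<And>y. dist y x < d1 \<Longrightarrow>
        \<bar>pderiv_at i (pderiv_at j f) y - pderiv_at i (pderiv_at j f) x\<bar> < \<epsilon> / 2"
      using c[of i j, unfolded continuous_at_eps_delta dist_real_def, rule_format, of "\<epsilon> / 2"] eps by auto
    obtain d2 where d2: "d2 > 0" "\<And>y. dist y x < d2 \<Longrightarrow>
        \<bar>pderiv_at j (pderiv_at i f) y - pderiv_at j (pderiv_at i f) x\<bar> < \<epsilon> / 2"
      using c[of j i, unfolded continuous_at_eps_delta dist_real_def, rule_format, of "\<epsilon> / 2"] eps by auto
    \<comment> \<open>A third of the minimum makes \<open>2 * h\<close> strictly smaller than each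
      of the three radii.\<close>
    define h where "h = min r (min d1 d2) / 3"
    have h: "0 < h" "2 * h < r" "2 * h < d1" "2 * h < d2"
      using r d1 d2 by (auto simp: h_def min_def)
    have close: "dist (x + s *\<^sub>R axis k 1 + t *\<^sub>R axis l 1) x < 2 * h"
      if "0 < s" "s < h" "0 < t" "t < h" for s t k l
      using norm_triangle_ineq[of "s *\<^sub>R axis k 1 :: real ^ 'n" "t *\<^sub>R axis l 1"] that
      by (simp add: norm_axis_1 dist_norm add.assoc)
    obtain s t where st: "0 < s" "s < h" "0 < t" "t < h" and e1:
      "f (x + h *\<^sub>R axis i 1 + h *\<^sub>R axis j 1) - f (x + h *\<^sub>R axis i 1) - f (x + h *\<^sub>R axis j 1) + f x
      = h\<^sup>2 * pderiv_at j (pderiv_at i f) (x + s *\<^sub>R axis i 1 + t *\<^sub>R axis j 1)"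
      using second_difference_mvt[OF d h(1,2), where i = i and j = j] by blast
    obtain s' t' where st': "0 < s'" "s' < h" "0 < t'" "t' < h" and e2:
      "f (x + h *\<^sub>R axis j 1 + h *\<^sub>R axis i 1) - f (x + h *\<^sub>R axis j 1) - f (x + h *\<^sub>R axis i 1) + f x
      = h\<^sup>2 * pderiv_at i (pderiv_at j f) (x + s' *\<^sub>R axis j 1 + t' *\<^sub>R axis i 1)"
      using second_difference_mvt[OF d h(1,2), where i = j and j = i] by blast
    have "h\<^sup>2 * pderiv_at j (pderiv_at i f) (x + s *\<^sub>R axis i 1 + t *\<^sub>R axis j 1) =
      h\<^sup>2 * pderiv_at i (pderiv_at j f) (x + s' *\<^sub>R axis j 1 + t' *\<^sub>R axis i 1)"
      unfolding e1[symmetric] e2[symmetric] by (simp add: add_ac)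
    then have "pderiv_at j (pderiv_at i f) (x + s *\<^sub>R axis i 1 + t *\<^sub>R axis j 1) =
      pderiv_at i (pderiv_at j f) (x + s' *\<^sub>R axis j 1 + t' *\<^sub>R axis i 1)"
      using h by simp
    then show ?thesis
      using d1(2)[OF less_trans[OF close[OF st'] h(3)], of j i]
        d2(2)[OF less_trans[OF close[OF st] h(4)], of i j] by linarith
  qed
  then show ?thesis
    by (metis abs_le_zero_iff eq_iff_diff_eq_0 field_le_epsilon add_0)
qed

section \<open>Positive definite matrices\<close>

text \<open>Cholesky factorisation by completing the square in one variable; \<open>b\<close> is the
  Schur complement of the pivot \<open>d\<close>. An index set in place of a matrix type lets the
  induction remove one index at a time.\<close>

lemma posdef_factor:
  fixes a :: "'a \<Rightarrow> 'a \<Rightarrow> real"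
  assumes "finite I"
    and "\<And>i j. i \<in> I \<Longrightarrow> j \<in> I \<Longrightarrow> a i j = a j i"
    and "\<And>u. \<exists>i\<in>I. u i \<noteq> 0 \<Longrightarrow> (\<Sum>i\<in>I. \<Sum>j\<in>I. a i j * u i * u j) > 0"
  shows "\<exists>w. \<forall>i\<in>I. \<forall>j\<in>I. a i j = (\<Sum>k\<in>I. w k i * w k j)"
  using assms
proof (induction I arbitrary: a rule: finite_induct)
  case empty
  then show ?case by simp
next
  case (insert p I)
  define d where "d = a p p"
  define b where "b i j = a i j - a p i * a p j / d" for i j
  have expand: "(\<Sum>i\<in>insert p I. \<Sum>j\<in>insert p I. a i j * u i * u j)
      = d * (u p)\<^sup>2 + 2 * u p * (\<Sum>j\<in>I. a p j * u j) + (\<Sum>i\<in>I. \<Sum>j\<in>I. a i j * u i * u j)" for u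
  proof -
    have "(\<Sum>i\<in>I. a i p * u i * u p) = u p * (\<Sum>j\<in>I. a p j * u j)"
      using insert.prems(1) by (auto simp: sum_distrib_left intro!: sum.cong)
    moreover have "(\<Sum>j\<in>I. a p j * u p * u j) = u p * (\<Sum>j\<in>I. a p j * u j)"
      by (auto simp: sum_distrib_left intro!: sum.cong)
    ultimately show ?thesis
      using insert.hyps by (simp add: sum.distrib d_def power2_eq_square)
  qed
  have d: "d > 0"
  proof -
    have "(\<Sum>j\<in>I. a p j * (if j = p then 1 else 0)) = 0"
      "(\<Sum>i\<in>I. \<Sum>j\<in>I. a i j * (if i = p then 1 else 0) * (if j = p then 1 else 0)) = 0"
      using insert.hyps by (auto intro!: sum.neutral)
    then show ?thesis
      using insert.prems(2)[of "\<lambda>i. if i = p then 1 else 0"]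
        expand[of "\<lambda>i. if i = p then 1 else 0"] by auto
  qed
  have "(\<Sum>i\<in>I. \<Sum>j\<in>I. b i j * u i * u j) > 0" if "\<exists>i\<in>I. u i \<noteq> 0" for u
  proof -
    define s where "s = (\<Sum>j\<in>I. a p j * u j)"
    \<comment> \<open>This value of coordinate \<open>p\<close> minimises the form when the others
      are fixed, and the minimum is the form of \<open>b\<close> at \<open>u\<close>.\<close>
    define v where "v = u(p := - s / d)"
    have v: "v i = u i" if "i \<in> I" for i
      using that insert.hyps by (auto simp: v_def)
    have "0 < d * (v p)\<^sup>2 + 2 * v p * (\<Sum>j\<in>I. a p j * v j) + (\<Sum>i\<in>I. \<Sum>j\<in>I. a i j * v i * v j)"
      unfolding expand[symmetric] using that v by (intro insert.prems(2)) auto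
    also have "\<dots> = d * (v p)\<^sup>2 + 2 * v p * s + (\<Sum>i\<in>I. \<Sum>j\<in>I. a i j * u i * u j)"
      by (simp add: v s_def)
    also have "\<dots> = (\<Sum>i\<in>I. \<Sum>j\<in>I. a i j * u i * u j) - s\<^sup>2 / d"
      using d by (simp add: v_def field_simps power2_eq_square)
    also have "s\<^sup>2 / d = (\<Sum>i\<in>I. \<Sum>j\<in>I. a p i * a p j / d * u i * u j)"
      by (simp add: s_def power2_eq_square sum_product sum_divide_distrib mult_ac)
    also have "(\<Sum>i\<in>I. \<Sum>j\<in>I. a i j * u i * u j) - \<dots> = (\<Sum>i\<in>I. \<Sum>j\<in>I. b i j * u i * u j)"
      by (simp add: b_def left_diff_distrib sum_subtractf)
    finally show ?thesis .
  qed
  then obtain w where w: "\<And>i j. i \<in> I \<Longrightarrow> j \<in> I \<Longrightarrow> b i j = (\<Sum>k\<in>I. w k i * w k j)"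
    using insert.IH[of b] insert.prems(1) by (auto simp: b_def)
  \<comment> \<open>Row \<open>p\<close> reproduces the square that was split off; the remaining
    rows vanish in column \<open>p\<close> and factor the Schur complement.\<close>
  define w' where "w' k i = (if k = p then a p i / sqrt d else if i = p then 0 else w k i)" for k i
  have "a i j = (\<Sum>k\<in>insert p I. w' k i * w' k j)" if ij: "i \<in> insert p I" "j \<in> insert p I" for i j
  proof -
    have "(\<Sum>k\<in>insert p I. w' k i * w' k j) = a p i * a p j / d + (\<Sum>k\<in>I. w' k i * w' k j)"
      using insert.hyps d by (simp add: w'_def)
    also have "\<dots> = a i j"
    proof (cases "i = p \<or> j = p")
      case True
      then have "(\<Sum>k\<in>I. w' k i * w' k j) = 0"
        using insert.hyps by (intro sum.neutral) (auto simp: w'_def)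
      then show ?thesis using True d insert.prems(1) ij by (auto simp: d_def)
    next
      case False
      then have "(\<Sum>k\<in>I. w' k i * w' k j) = (\<Sum>k\<in>I. w k i * w k j)"
        using insert.hyps by (intro sum.cong) (auto simp: w'_def)
      then show ?thesis using False ij w[of i j] by (simp add: b_def)
    qed
    finally show ?thesis by simp
  qed
  then show ?case by blast
qed

definition pos_def :: "real ^ 'n ^ 'n::finite \<Rightarrow> bool"
  where "pos_def M \<longleftrightarrow> transpose M = M \<and> (\<forall>v. v \<noteq> 0 \<longrightarrow> v \<bullet> (M *v v) > 0)"

lemma pos_def_transpose: "pos_def M \<Longrightarrow> transpose M = M"
  by (simp add: pos_def_def)

lemma pos_def_sym: "pos_def M \<Longrightarrow> M $ i $ j = M $ j $ i"
  using arg_cong[OF pos_def_transpose, of M "\<lambda>A. A $ j $ i"] by (simp add: transpose_def)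

text \<open>Serves to show that determinants of metrics are positive and that the norm of a tensor
  is a sum of squares.\<close>

lemma pos_def_factor:
  fixes M :: "real ^ 'n ^ 'n::finite"
  assumes "pos_def M"
  obtains W :: "real ^ 'n ^ 'n" where "M = transpose W ** W"
proof -
  have "\<exists>w. \<forall>i\<in>UNIV. \<forall>j\<in>UNIV. M $ i $ j = (\<Sum>k\<in>(UNIV :: 'n set). w k i * w k j)"
  proof (rule posdef_factor[of UNIV "\<lambda>i j. M $ i $ j"])
    fix u :: "'n \<Rightarrow> real" assume "\<exists>i\<in>UNIV. u i \<noteq> 0"
    then have "(\<chi> i. u i) \<noteq> 0" by (auto simp: vec_eq_iff)
    then have "(\<chi> i. u i) \<bullet> (M *v (\<chi> i. u i)) > 0" using assms by (auto simp: pos_def_def)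
    then show "(\<Sum>i\<in>UNIV. \<Sum>j\<in>UNIV. M $ i $ j * u i * u j) > 0"
      by (simp add: inner_vec_def matrix_vector_mult_def sum_distrib_left mult_ac)
  qed (use pos_def_sym[OF assms] in auto)
  then obtain w where "\<And>i j. M $ i $ j = (\<Sum>k\<in>(UNIV :: 'n set). w k i * w k j)" by auto
  then have "M = transpose (\<chi> k i. w k i) ** (\<chi> k i. w k i)"
    by (simp add: vec_eq_iff matrix_matrix_mult_def transpose_def)
  then show thesis by (rule that)
qed

lemma pos_def_invertible:
  assumes "pos_def M"
  shows "invertible M"
proof -
  have "v = 0" if "M *v v = 0" for v
    using assms that unfolding pos_def_def by (metis inner_zero_right less_irrefl)
  then show ?thesis
    unfolding invertible_left_inverse matrix_left_invertible_ker by blast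
qed

lemma pos_def_det:
  fixes M :: "real ^ 'n ^ 'n::finite"
  assumes "pos_def M"
  shows "det M > 0"
proof -
  obtain W :: "real ^ 'n ^ 'n" where "M = transpose W ** W" using pos_def_factor[OF assms] .
  then have "det M = (det W)\<^sup>2" by (simp add: det_mul power2_eq_square)
  moreover have "det M \<noteq> 0" using pos_def_invertible[OF assms] by (simp add: invertible_det_nz)
  ultimately show ?thesis by simp
qed

lemma matrix_inv_mult:
  assumes "invertible (M :: real ^ 'n ^ 'n::finite)"
  shows "M ** matrix_inv M = mat 1" "matrix_inv M ** M = mat 1"
  using someI_ex[OF assms[unfolded invertible_def]] by (simp_all add: matrix_inv_def)

text \<open>With w the image of v under the inverse, v = M w, so the form of the inverse at v is the
  form of M at w.\<close>

lemma pos_def_matrix_inv: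
  assumes "pos_def M"
  shows "pos_def (matrix_inv M)"
proof -
  let ?N = "matrix_inv M"
  note i = matrix_inv_mult[OF pos_def_invertible[OF assms]]
  have "transpose ?N = transpose ?N ** (M ** ?N)" by (simp add: i)
  also have "\<dots> = transpose (M ** ?N) ** ?N"
    by (simp add: matrix_transpose_mul pos_def_transpose[OF assms] matrix_mul_assoc)
  finally have sym: "transpose ?N = ?N" by (simp add: i)
  have "v \<bullet> (?N *v v) > 0" if "v \<noteq> 0" for v
  proof -
    have v: "v = M *v (?N *v v)" by (simp add: matrix_vector_mul_assoc i)
    then have "?N *v v \<noteq> 0" using that by auto
    then have "(?N *v v) \<bullet> (M *v (?N *v v)) > 0" using assms by (auto simp: pos_def_def)
    then show ?thesis using v by (simp add: inner_commute)
  qed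
  with sym show ?thesis by (simp add: pos_def_def)
qed

text \<open>As a trace, the fourfold index sum becomes accessible to matrix algebra and to cyclic
  permutation by \<open>trace_mul_sym\<close>. The chain of exchanged sums only brings the four
  indices into the order of the definition.\<close>

lemma tensor_inner_eq_trace:
  assumes "pos_def M"
  shows "tensor_inner M S T = trace (matrix_inv M ** transpose S ** matrix_inv M ** T)"
proof -
  let ?N = "matrix_inv M"
  note sym = pos_def_sym[OF pos_def_matrix_inv[OF assms]]
  have "trace (?N ** transpose S ** ?N ** T)
      = (\<Sum>l\<in>UNIV. \<Sum>k\<in>UNIV. \<Sum>i\<in>UNIV. \<Sum>j\<in>UNIV. ?N $ l $ j * S $ i $ j * ?N $ i $ k * T $ k $ l)"
    by (simp add: trace_def matrix_matrix_mult_def transpose_def sum_distrib_right)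
  also have "\<dots> = (\<Sum>k\<in>UNIV. \<Sum>l\<in>UNIV. \<Sum>i\<in>UNIV. \<Sum>j\<in>UNIV. ?N $ l $ j * S $ i $ j * ?N $ i $ k * T $ k $ l)"
    by (rule sum.swap)
  also have "\<dots> = (\<Sum>k\<in>UNIV. \<Sum>i\<in>UNIV. \<Sum>l\<in>UNIV. \<Sum>j\<in>UNIV. ?N $ l $ j * S $ i $ j * ?N $ i $ k * T $ k $ l)"
    by (intro sum.cong refl sum.swap)
  also have "\<dots> = (\<Sum>i\<in>UNIV. \<Sum>k\<in>UNIV. \<Sum>l\<in>UNIV. \<Sum>j\<in>UNIV. ?N $ l $ j * S $ i $ j * ?N $ i $ k * T $ k $ l)"
    by (rule sum.swap)
  also have "\<dots> = (\<Sum>i\<in>UNIV. \<Sum>k\<in>UNIV. \<Sum>j\<in>UNIV. \<Sum>l\<in>UNIV. ?N $ l $ j * S $ i $ j * ?N $ i $ k * T $ k $ l)"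
    by (intro sum.cong refl sum.swap)
  also have "\<dots> = (\<Sum>i\<in>UNIV. \<Sum>j\<in>UNIV. \<Sum>k\<in>UNIV. \<Sum>l\<in>UNIV. ?N $ l $ j * S $ i $ j * ?N $ i $ k * T $ k $ l)"
    by (intro sum.cong refl sum.swap)
  also have "\<dots> = tensor_inner M S T"
    unfolding tensor_inner_def by (intro sum.cong refl) (simp add: sym mult_ac)
  finally show ?thesis by simp
qed

text \<open>Factoring the inverse metric turns the inner square into the sum of the squared entries
  of \<open>N\<close>. Nonnegativity is what makes squaring undo the root in
  \<open>tensor_norm\<close>.\<close>

lemma tensor_inner_nonneg:
  fixes M :: "real ^ 'n ^ 'n::finite"
  assumes "pos_def M"
  shows "tensor_inner M T T \<ge> 0"
proof -
  obtain W :: "real ^ 'n ^ 'n" where W: "matrix_inv M = transpose W ** W"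
    using pos_def_factor[OF pos_def_matrix_inv[OF assms]] .
  define N where "N = W ** T ** transpose W"
  have "tensor_inner M T T = trace (transpose W ** (W ** transpose T ** transpose W ** W ** T))"
    by (simp add: tensor_inner_eq_trace[OF assms] W matrix_mul_assoc)
  also have "\<dots> = trace (transpose N ** N)"
    by (subst trace_mul_sym) (simp add: N_def matrix_transpose_mul matrix_mul_assoc)
  also have "\<dots> = (\<Sum>i\<in>UNIV. \<Sum>j\<in>UNIV. (N $ j $ i)\<^sup>2)"
    by (simp add: trace_def matrix_matrix_mult_def transpose_def power2_eq_square)
  also have "\<dots> \<ge> 0" by (intro sum_nonneg) simp
  finally show ?thesis .
qed

section \<open>Matrix-valued functions\<close>

lemma bounded_bilinear_matrix_mult:
  "bounded_bilinear ((**) :: real ^ 'n ^ 'n \<Rightarrow> real ^ 'n ^ 'n \<Rightarrow> real ^ 'n ^ 'n::finite)"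
  unfolding bilinear_conv_bounded_bilinear[symmetric] bilinear_def
  by (auto simp: linear_iff matrix_matrix_mult_def vec_eq_iff sum.distrib sum_distrib_left algebra_simps)

lemma bounded_linear_transpose:
  "bounded_linear (transpose :: real ^ 'n ^ 'n \<Rightarrow> real ^ 'n ^ 'n::finite)"
  unfolding linear_conv_bounded_linear[symmetric]
  by (auto simp: linear_iff transpose_def vec_eq_iff)

lemmas pderiv_at_matrix_mult = pderiv_at_bilinear[OF bounded_bilinear_matrix_mult]
lemmas pderiv_at_transpose = pderiv_at_linear[OF bounded_linear_transpose]
lemmas smooth_on_matrix_mult = smooth_on_bilinear[OF _ bounded_bilinear_matrix_mult]

lemma pderiv_at_entry:
  "A differentiable (at x) \<Longrightarrow> pderiv_at a (\<lambda>y. A y $ i $ j) x = pderiv_at a A x $ i $ j"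
  using pderiv_at_nth[OF differentiable_nth, of A x a i j] pderiv_at_nth[of A x a i] by simp

lemma smooth_on_entry: "open U \<Longrightarrow> smooth_on U A \<Longrightarrow> smooth_on U (\<lambda>y. A y $ i $ j)"
  by (intro smooth_on_nth)

section \<open>Determinants and inverses of matrix-valued functions\<close>

lemma smooth_on_det:
  fixes A :: "real ^ 'n::finite \<Rightarrow> real ^ 'm ^ 'm::finite"
  assumes "open U" "\<And>i j. smooth_on U (\<lambda>x. A x $ i $ j)"
  shows "smooth_on U (\<lambda>x. det (A x))"
  unfolding det_def
  by (intro smooth_on_sum smooth_on_mult smooth_on_const smooth_on_prod assms)

text \<open>Cramer's rule for column \<open>j\<close> of the inverse. It exhibits the entries as
  quotients of polynomials in the entries of \<open>A\<close>, from which smoothness of the inverse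
  metric follows.\<close>

lemma matrix_inv_entry_cramer:
  assumes "det (A :: real ^ 'n ^ 'n::finite) \<noteq> 0"
  shows "matrix_inv A $ i $ j = det (\<chi> a b. if b = i then axis j 1 $ a else A $ a $ b) / det A"
proof -
  have "A *v (matrix_inv A *v axis j 1) = axis j 1"
    using matrix_inv_mult(1)[of A] assms by (simp add: matrix_vector_mul_assoc invertible_det_nz)
  then have "matrix_inv A *v axis j 1
      = (\<chi> k. det (\<chi> a b. if b = k then axis j 1 $ a else A $ a $ b) / det A)"
    by (simp add: cramer[OF assms])
  then have "(matrix_inv A *v axis j 1) $ i = det (\<chi> a b. if b = i then axis j 1 $ a else A $ a $ b) / det A"
    by simp
  then show ?thesis
    by (simp add: matrix_vector_mult_basis column_def)
qed

lemma smooth_on_matrix_inv: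
  fixes A :: "real ^ 'n::finite \<Rightarrow> real ^ 'm ^ 'm::finite"
  assumes "open U" "\<And>x. x \<in> U \<Longrightarrow> det (A x) > 0" "smooth_on U A"
  shows "smooth_on U (\<lambda>x. matrix_inv (A x))"
proof -
  have "smooth_on U (\<lambda>x. matrix_inv (A x) $ i $ j)" for i j
  proof (rule smooth_on_cong[OF assms(1)])
    show "smooth_on U (\<lambda>x. det (\<chi> a b. if b = i then axis j 1 $ a else A x $ a $ b) / det (A x))"
    proof (intro smooth_on_divide smooth_on_det assms)
      show "smooth_on U (\<lambda>x. (\<chi> a b. if b = i then axis j 1 $ a else A x $ a $ b) $ k $ l)" for k l
        by (cases "l = i") (simp_all add: smooth_on_const smooth_on_entry assms)
    qed (use assms in \<open>simp_all add: smooth_on_entry\<close>)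
    show "det (\<chi> a b. if b = i then axis j 1 $ a else A x $ a $ b) / det (A x)
        = matrix_inv (A x) $ i $ j" if "x \<in> U" for x
      using matrix_inv_entry_cramer[of "A x" i j] assms(2)[OF that] by simp
  qed
  then have "smooth_on U (\<lambda>x. \<chi> i j. matrix_inv (A x) $ i $ j)"
    by (intro smooth_on_vec_lambda assms)
  then show ?thesis by simp
qed

text \<open>Jacobi's formula at the identity: in the derivative of the Leibniz expansion only the
  identity permutation survives. Any other permutation leaves an off-diagonal zero among the factors
  that are not differentiated.\<close>

lemma pderiv_at_det_mat_1:
  fixes A :: "real ^ 'n::finite \<Rightarrow> real ^ 'm ^ 'm::finite"
  assumes "A differentiable (at x)" "A x = mat 1"
  shows "pderiv_at a (\<lambda>y. det (A y)) x = trace (pderiv_at a A x)"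
    and "(\<lambda>y. det (A y)) differentiable (at x)"
proof -
  obtain D where D: "(A has_derivative D) (at x)"
    using assms by (auto simp: differentiable_def)
  have entry: "((\<lambda>y. A y $ i $ j) has_derivative (\<lambda>v. D v $ i $ j)) (at x)" for i j
    by (intro bounded_linear.has_derivative[OF bounded_linear_vec_nth] D)
  let ?P = "\<lambda>p v. \<Sum>i\<in>UNIV. D v $ i $ p i * (\<Prod>k\<in>UNIV - {i}. A x $ k $ p k)"
  have "((\<lambda>y. det (A y)) has_derivative
      (\<lambda>v. \<Sum>p\<in>{p. p permutes UNIV}. of_int (sign p) * ?P p v)) (at x)"
    unfolding det_def by (intro has_derivative_sum has_derivative_mult_right has_derivative_prod entry)
  moreover have "(\<Sum>p\<in>{p. p permutes UNIV}. of_int (sign p) * ?P p v) = trace (D v)" for v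
  proof -
    have zero: "?P p v = 0" if p: "p permutes UNIV" and "p \<noteq> id" for p
    proof (intro sum.neutral ballI)
      fix i
      obtain k where k: "p k \<noteq> k" using \<open>p \<noteq> id\<close> by (auto simp: fun_eq_iff)
      \<comment> \<open>A moved index \<open>k\<close> is accompanied by a second moved index
        \<open>p k\<close>, so one of the two differs from \<open>i\<close>.\<close>
      have "p (p k) \<noteq> p k" using k inj_eq[OF permutes_inj[OF p], of "p k" k] by simp
      then obtain l where l: "l \<noteq> i" "p l \<noteq> l" using that k by (cases "k = i") auto
      then have "(\<Prod>k\<in>UNIV - {i}. A x $ k $ p k) = 0"
        by (intro prod_zero bexI[of _ l]) (auto simp: assms(2) mat_def)
      then show "D v $ i $ p i * (\<Prod>k\<in>UNIV - {i}. A x $ k $ p k) = 0" by simp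
    qed
    have "(\<Sum>p\<in>{p. p permutes UNIV}. of_int (sign p) * ?P p v) = (\<Sum>p\<in>{id}. of_int (sign p) * ?P p v)"
      by (rule sum.mono_neutral_right) (auto simp: permutes_id zero finite_permutations)
    also have "\<dots> = trace (D v)"
      by (simp add: trace_def assms(2) mat_def)
    finally show ?thesis .
  qed
  ultimately have *: "((\<lambda>y. det (A y)) has_derivative (\<lambda>v. trace (D v))) (at x)" by simp
  show "pderiv_at a (\<lambda>y. det (A y)) x = trace (pderiv_at a A x)"
    by (simp add: pderiv_at_eq[OF *] pderiv_at_eq[OF D])
  show "(\<lambda>y. det (A y)) differentiable (at x)" by (rule differentiableI[OF *])
qed

text \<open>Multiplying by the inverse of the fixed matrix \<open>A x\<close> normalises the
  function to the identity at \<open>x\<close>, where the previous formula applies.\<close>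

lemma pderiv_at_det:
  fixes A :: "real ^ 'n::finite \<Rightarrow> real ^ 'm ^ 'm::finite"
  assumes "A differentiable (at x)" "invertible (A x)"
  shows "pderiv_at a (\<lambda>y. det (A y)) x = det (A x) * trace (matrix_inv (A x) ** pderiv_at a A x)"
proof -
  let ?B = "\<lambda>y. matrix_inv (A x) ** A y"
  have B: "bounded_linear (\<lambda>M :: real ^ 'm ^ 'm. matrix_inv (A x) ** M)"
    by (rule bounded_bilinear.bounded_linear_right[OF bounded_bilinear_matrix_mult])
  have d: "?B differentiable (at x)" by (rule differentiable_linear[OF B assms(1)])
  have B1: "?B x = mat 1" by (simp add: matrix_inv_mult[OF assms(2)])
  have one: "det (A x) * det (matrix_inv (A x)) = 1"
    unfolding det_mul[symmetric] matrix_inv_mult[OF assms(2)] by simp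
  have "det (A y) = det (A x) * det (?B y)" for y
    unfolding det_mul mult.assoc[symmetric] one by simp
  then have "(\<lambda>y. det (A y)) = (\<lambda>y. det (A x) * det (?B y))"
    by (rule ext)
  then have "pderiv_at a (\<lambda>y. det (A y)) x = pderiv_at a (\<lambda>y. det (A x) * det (?B y)) x"
    by (rule arg_cong[of _ _ "\<lambda>f. pderiv_at a f x"])
  also have "\<dots> = det (A x) * trace (pderiv_at a ?B x)"
    using pderiv_at_linear[OF bounded_linear_mult_right pderiv_at_det_mat_1(2)[of ?B, OF d B1]]
      pderiv_at_det_mat_1(1)[of ?B, OF d B1] by simp
  finally show ?thesis by (simp add: pderiv_at_linear[OF B assms(1)])
qed

lemmas matrix_mult_distribs =
  bounded_bilinear.add_left[OF bounded_bilinear_matrix_mult]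
  bounded_bilinear.add_right[OF bounded_bilinear_matrix_mult]
  bounded_bilinear.diff_left[OF bounded_bilinear_matrix_mult]
  bounded_bilinear.diff_right[OF bounded_bilinear_matrix_mult]
  bounded_bilinear.minus_left[OF bounded_bilinear_matrix_mult]
  bounded_bilinear.minus_right[OF bounded_bilinear_matrix_mult]
  bounded_bilinear.scaleR_left[OF bounded_bilinear_matrix_mult]
  bounded_bilinear.scaleR_right[OF bounded_bilinear_matrix_mult]

lemmas transpose_distribs =
  linear_add[OF bounded_linear.linear[OF bounded_linear_transpose]]
  linear_diff[OF bounded_linear.linear[OF bounded_linear_transpose]]
  linear_neg[OF bounded_linear.linear[OF bounded_linear_transpose]]

lemma pderiv_at_commute_matrix:
  fixes A :: "real ^ 'n::finite \<Rightarrow> real ^ 'm ^ 'm::finite"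
  assumes "open U" "smooth_on U A" "x \<in> U"
  shows "pderiv_at i (pderiv_at j A) x = pderiv_at j (pderiv_at i A) x"
proof -
  have d: "A differentiable (at y)" "pderiv_at k A differentiable (at y)" if "y \<in> U" for y k
    using assms that by (auto intro: smooth_on_differentiable[of U] smooth_on_pderiv)
  have "pderiv_at a (pderiv_at b A) x $ k $ l = pderiv_at a (pderiv_at b (\<lambda>y. A y $ k $ l)) x" for a b k l
  proof -
    have "pderiv_at a (pderiv_at b A) x $ k $ l = pderiv_at a (\<lambda>y. pderiv_at b A y $ k $ l) x"
      using d[OF assms(3)] by (simp add: pderiv_at_entry)
    also have "\<dots> = pderiv_at a (pderiv_at b (\<lambda>y. A y $ k $ l)) x"
      by (rule pderiv_at_cong[OF assms(1,3)]) (simp add: pderiv_at_entry d)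
    finally show ?thesis .
  qed
  then show ?thesis
    using pderiv_at_commute[OF assms(1) smooth_on_entry[OF assms(1,2)] assms(3), of i j]
    by (simp add: vec_eq_iff)
qed

section \<open>Riemannian geometry in a coordinate domain\<close>

text \<open>\<open>Ga l a p\<close> stands for $\Gamma^l_{ap}$, and \<open>N i j l m\<close> for the curvature
  $R_{ij}{}^{l}{}_{n} g^{nm}$, whose partial derivatives are \<open>dN a i j l m\<close>.\<close>

lemma contract_bianchi:
  fixes N :: "'n::finite \<Rightarrow> 'n \<Rightarrow> 'n \<Rightarrow> 'n \<Rightarrow> real"
    and dN :: "'n \<Rightarrow> 'n \<Rightarrow> 'n \<Rightarrow> 'n \<Rightarrow> 'n \<Rightarrow> real" and Ga :: "'n \<Rightarrow> 'n \<Rightarrow> 'n \<Rightarrow> real"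
  assumes N1: "\<And>i j l m. N j i l m = - N i j l m" and N2: "\<And>i j l m. N i j m l = - N i j l m"
    and dN1: "\<And>a i j l m. dN a j i l m = - dN a i j l m"
    and dN2: "\<And>a i j l m. dN a i j m l = - dN a i j l m"
    and Ga: "\<And>l a p. Ga l p a = Ga l a p"
    and bianchi: "\<And>i j k l m.
      (dN i j k l m + (\<Sum>p\<in>UNIV. Ga l i p * N j k p m) + (\<Sum>p\<in>UNIV. Ga m i p * N j k l p))
    + (dN j k i l m + (\<Sum>p\<in>UNIV. Ga l j p * N k i p m) + (\<Sum>p\<in>UNIV. Ga m j p * N k i l p))
    + (dN k i j l m + (\<Sum>p\<in>UNIV. Ga l k p * N i j p m) + (\<Sum>p\<in>UNIV. Ga m k p * N i j l p)) = 0"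
  defines "q \<equiv> \<lambda>k m. \<Sum>i\<in>UNIV. N i k i m" and "dq \<equiv> \<lambda>a k m. \<Sum>i\<in>UNIV. dN a i k i m"
  shows "2 * ((\<Sum>i\<in>UNIV. dq i k i) + (\<Sum>i\<in>UNIV. \<Sum>p\<in>UNIV. Ga i i p * q k p)
      - (\<Sum>i\<in>UNIV. \<Sum>p\<in>UNIV. Ga i k p * q i p)) = (\<Sum>j\<in>UNIV. dq k j j)"
proof -
  have N12: "N i j p j = N j i j p" for i j p
    using N1[of i j p j] N2[of j i j p] by simp
  \<comment> \<open>A Christoffel symbol is symmetric in its lower indices and \<open>N\<close> is
    antisymmetric in the last two, so the contraction vanishes.\<close>
  have antisym: "(\<Sum>i\<in>UNIV. \<Sum>p\<in>UNIV. Ga l i p * N j k i p) = 0" for l j k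
  proof -
    have "(\<Sum>i\<in>UNIV. \<Sum>p\<in>UNIV. Ga l i p * N j k i p) = (\<Sum>i\<in>UNIV. \<Sum>p\<in>UNIV. Ga l p i * N j k p i)"
      by (rule sum.swap)
    also have "\<dots> = (\<Sum>i\<in>UNIV. \<Sum>p\<in>UNIV. - (Ga l i p * N j k i p))"
      by (intro sum.cong refl) (subst Ga, subst N2, simp)
    finally show ?thesis by (simp add: sum_negf)
  qed
  \<comment> \<open>The contraction sets l = i and m = j. The numbers 1, 2, 3 refer to the cyclic
    summands with derivative along i, j, k; the letter a marks the derivative term, b and c the
    Christoffel terms for the upper indices l and m.\<close>
  have T1a: "(\<Sum>i\<in>UNIV. \<Sum>j\<in>UNIV. dN i j k i j) = - (\<Sum>i\<in>UNIV. dq i k i)"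
    by (subst dN2) (simp add: dq_def sum_negf)
  have T1b: "(\<Sum>i\<in>UNIV. \<Sum>j\<in>UNIV. \<Sum>p\<in>UNIV. Ga i i p * N j k p j) = - (\<Sum>i\<in>UNIV. \<Sum>p\<in>UNIV. Ga i i p * q k p)"
  proof -
    have "(\<Sum>j\<in>UNIV. \<Sum>p\<in>UNIV. Ga i i p * N j k p j) = - (\<Sum>p\<in>UNIV. Ga i i p * q k p)" for i
      by (subst sum.swap, subst N2) (simp add: q_def sum_negf sum_distrib_left)
    then show ?thesis by (simp add: sum_negf)
  qed
  have T1c: "(\<Sum>i\<in>UNIV. \<Sum>j\<in>UNIV. \<Sum>p\<in>UNIV. Ga j i p * N j k i p) = 0"
    by (subst sum.swap) (simp add: antisym)
  have T2a: "(\<Sum>i\<in>UNIV. \<Sum>j\<in>UNIV. dN j k i i j) = - (\<Sum>i\<in>UNIV. dq i k i)"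
    by (subst sum.swap, subst dN1) (simp add: dq_def sum_negf)
  have T2b: "(\<Sum>i\<in>UNIV. \<Sum>j\<in>UNIV. \<Sum>p\<in>UNIV. Ga i j p * N k i p j) = 0"
  proof -
    have "(\<Sum>j\<in>UNIV. \<Sum>p\<in>UNIV. Ga i j p * N k i p j) = (\<Sum>j\<in>UNIV. \<Sum>p\<in>UNIV. - (Ga i j p * N k i j p))" for i
      by (intro sum.cong refl) (subst N2, simp)
    then show ?thesis by (simp add: sum_negf antisym)
  qed
  have T2c: "(\<Sum>i\<in>UNIV. \<Sum>j\<in>UNIV. \<Sum>p\<in>UNIV. Ga j j p * N k i i p) = - (\<Sum>i\<in>UNIV. \<Sum>p\<in>UNIV. Ga i i p * q k p)"
  proof -
    have "(\<Sum>i\<in>UNIV. \<Sum>p\<in>UNIV. Ga j j p * N k i i p) = - (\<Sum>p\<in>UNIV. Ga j j p * q k p)" for j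
      by (subst sum.swap, subst N1) (simp add: q_def sum_negf sum_distrib_left)
    then show ?thesis by (subst sum.swap) (simp add: sum_negf)
  qed
  have T3a: "(\<Sum>i\<in>UNIV. \<Sum>j\<in>UNIV. dN k i j i j) = (\<Sum>j\<in>UNIV. dq k j j)"
    by (subst sum.swap) (simp add: dq_def)
  have T3b: "(\<Sum>i\<in>UNIV. \<Sum>j\<in>UNIV. \<Sum>p\<in>UNIV. Ga i k p * N i j p j) = (\<Sum>i\<in>UNIV. \<Sum>p\<in>UNIV. Ga i k p * q i p)"
  proof -
    have "(\<Sum>j\<in>UNIV. \<Sum>p\<in>UNIV. Ga i k p * N i j p j) = (\<Sum>p\<in>UNIV. Ga i k p * q i p)" for i
      by (simp only: N12, subst sum.swap) (simp add: q_def sum_distrib_left)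
    then show ?thesis by simp
  qed
  have T3c: "(\<Sum>i\<in>UNIV. \<Sum>j\<in>UNIV. \<Sum>p\<in>UNIV. Ga j k p * N i j i p) = (\<Sum>i\<in>UNIV. \<Sum>p\<in>UNIV. Ga i k p * q i p)"
  proof -
    have "(\<Sum>i\<in>UNIV. \<Sum>p\<in>UNIV. Ga j k p * N i j i p) = (\<Sum>p\<in>UNIV. Ga j k p * q j p)" for j
      by (subst sum.swap) (simp add: q_def sum_distrib_left)
    then show ?thesis by (subst sum.swap) simp
  qed
  have "0 = (\<Sum>i\<in>UNIV. \<Sum>j\<in>UNIV.
      (dN i j k i j + (\<Sum>p\<in>UNIV. Ga i i p * N j k p j) + (\<Sum>p\<in>UNIV. Ga j i p * N j k i p))
    + (dN j k i i j + (\<Sum>p\<in>UNIV. Ga i j p * N k i p j) + (\<Sum>p\<in>UNIV. Ga j j p * N k i i p))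
    + (dN k i j i j + (\<Sum>p\<in>UNIV. Ga i k p * N i j p j) + (\<Sum>p\<in>UNIV. Ga j k p * N i j i p)))"
    by (simp only: bianchi sum.neutral_const)
  then show ?thesis
    by (simp only: sum.distrib T1a T1b T1c T2a T2b T2c T3a T3b T3c) (simp add: algebra_simps)
qed

section \<open>The Levi-Civita connection in matrix form\<close>

locale metric_chart =
  fixes U :: "(real ^ 'n::finite) set" and G :: "real ^ 'n \<Rightarrow> real ^ 'n ^ 'n"
  assumes open_U: "open U" and smooth_G: "smooth_on U G" and pos_def_G: "x \<in> U \<Longrightarrow> pos_def (G x)"
begin

abbreviation Gi :: "real ^ 'n \<Rightarrow> real ^ 'n ^ 'n"
  where "Gi x \<equiv> matrix_inv (G x)"

definition conn :: "'n \<Rightarrow> real ^ 'n \<Rightarrow> real ^ 'n ^ 'n"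
  where "conn a x = (\<chi> l k. christoffel G l a k x)"

definition curv :: "'n \<Rightarrow> 'n \<Rightarrow> real ^ 'n \<Rightarrow> real ^ 'n ^ 'n"
  where "curv i j x = (\<chi> l k. riemann G i j k l x)"

lemma inverse_G: "x \<in> U \<Longrightarrow> G x ** Gi x = mat 1" "x \<in> U \<Longrightarrow> Gi x ** G x = mat 1"
  by (simp_all add: matrix_inv_mult pos_def_invertible pos_def_G)

lemma smooth_Gi: "smooth_on U Gi"
  using smooth_on_matrix_inv[OF open_U pos_def_det[OF pos_def_G] smooth_G] by simp

lemma smooth_christoffel: "smooth_on U (christoffel G k i j)"
proof -
  have "smooth_on U (\<lambda>x. christoffel G k i j x)"
    unfolding christoffel_def inv_metric_def
    by (intro smooth_on_linear[OF _ bounded_linear_divide] smooth_on_sum smooth_on_mult smooth_on_add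
        smooth_on_diff smooth_on_pderiv smooth_on_entry smooth_Gi smooth_G open_U)
  then show ?thesis by simp
qed

lemma smooth_conn: "smooth_on U (conn a)"
proof -
  have "smooth_on U (\<lambda>x. conn a x)"
    unfolding conn_def by (intro smooth_on_vec_lambda smooth_christoffel open_U)
  then show ?thesis by simp
qed

lemma smooth_riemann: "smooth_on U (riemann G i j k l)"
proof -
  have "smooth_on U (\<lambda>x. riemann G i j k l x)"
    unfolding riemann_def
    by (intro smooth_on_add smooth_on_diff smooth_on_sum smooth_on_mult smooth_on_pderiv
        smooth_christoffel open_U)
  then show ?thesis by simp
qed

lemma smooth_curv: "smooth_on U (curv i j)"
proof -
  have "smooth_on U (\<lambda>x. curv i j x)"
    unfolding curv_def by (intro smooth_on_vec_lambda smooth_riemann open_U)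
  then show ?thesis by simp
qed

lemma smooth_ricci: "smooth_on U (ricci G)"
proof -
  have "smooth_on U (\<lambda>x. ricci G x)"
    unfolding ricci_def by (intro smooth_on_vec_lambda smooth_on_sum smooth_riemann open_U)
  then show ?thesis by simp
qed

lemma smooth_scalar_curvature: "smooth_on U (scalar_curvature G)"
proof -
  have "smooth_on U (\<lambda>x. scalar_curvature G x)"
    unfolding scalar_curvature_def inv_metric_def
    by (intro smooth_on_sum smooth_on_mult smooth_on_entry smooth_ricci smooth_Gi open_U)
  then show ?thesis by simp
qed

lemmas differentiable =
  smooth_on_differentiable[OF smooth_G] smooth_on_differentiable[OF smooth_Gi]
  smooth_on_differentiable[OF smooth_conn] smooth_on_differentiable[OF smooth_curv]
  smooth_on_differentiable[OF smooth_ricci] smooth_on_differentiable[OF smooth_scalar_curvature]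
  smooth_on_differentiable[OF smooth_christoffel]
  smooth_on_differentiable[OF smooth_on_pderiv[OF smooth_G]]
  smooth_on_differentiable[OF smooth_on_pderiv[OF smooth_conn]]

lemma pderiv_G_sym: "x \<in> U \<Longrightarrow> pderiv_at a G x $ i $ j = pderiv_at a G x $ j $ i"
  using pderiv_at_cong[OF open_U, of x "\<lambda>y. G y $ i $ j" "\<lambda>y. G y $ j $ i" a]
    pos_def_sym[OF pos_def_G] by (simp add: pderiv_at_entry differentiable)

lemma christoffel_sym: "x \<in> U \<Longrightarrow> christoffel G k i j x = christoffel G k j i x"
  by (simp add: christoffel_def pderiv_at_entry differentiable pderiv_G_sym[of x _ i j] add.commute)

text \<open>Lowering the upper index cancels the inverse metric and leaves the Christoffel symbols
  of the first kind.\<close>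

lemma G_mult_conn:
  assumes "x \<in> U"
  shows "(G x ** conn a x) $ j $ k
    = (pderiv_at a G x $ k $ j + pderiv_at k G x $ a $ j - pderiv_at j G x $ a $ k) / 2"
proof -
  define t where "t = (\<chi> l. pderiv_at a G x $ k $ l + pderiv_at k G x $ a $ l - pderiv_at l G x $ a $ k)"
  have c: "conn a x $ l $ k = (Gi x *v t) $ l / 2" for l
    by (simp add: conn_def christoffel_def inv_metric_def matrix_vector_mult_def t_def
        pderiv_at_entry differentiable assms)
  have "(G x ** conn a x) $ j $ k = (G x *v (Gi x *v t)) $ j / 2"
    by (simp add: matrix_matrix_mult_def matrix_vector_mult_def[of "G x"] sum_divide_distrib c)
  also have "G x *v (Gi x *v t) = t"
    by (simp add: matrix_vector_mul_assoc inverse_G assms)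
  finally show ?thesis by (simp add: t_def)
qed

text \<open>Metric compatibility of the connection: in the sum of the two symbols of the first kind,
  the derivatives in the other two directions cancel.\<close>

lemma pderiv_G:
  assumes "x \<in> U"
  shows "pderiv_at a G x = transpose (conn a x) ** G x + G x ** conn a x"
proof -
  have "transpose (conn a x) ** G x = transpose (G x ** conn a x)"
    by (simp add: matrix_transpose_mul pos_def_transpose[OF pos_def_G[OF assms]])
  then have "(transpose (conn a x) ** G x) $ i $ j = (G x ** conn a x) $ j $ i" for i j
    by (simp add: transpose_def)
  then show ?thesis
    using assms by (simp add: vec_eq_iff G_mult_conn pderiv_G_sym[of x] field_simps)
qed

text \<open>The same compatibility for the inverse metric, by differentiating the constant
  \<open>G y ** Gi y\<close>.\<close>

lemma pderiv_Gi:
  assumes "x \<in> U"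
  shows "pderiv_at a Gi x = - (conn a x ** Gi x) - Gi x ** transpose (conn a x)"
proof -
  have "pderiv_at a (\<lambda>y. G y ** Gi y) x = pderiv_at a (\<lambda>y. mat 1) x"
    by (rule pderiv_at_cong[OF open_U assms]) (simp add: inverse_G)
  then have "G x ** pderiv_at a Gi x + pderiv_at a G x ** Gi x = 0"
    using assms by (simp add: pderiv_at_matrix_mult differentiable)
  then have "Gi x ** (G x ** pderiv_at a Gi x) = - (Gi x ** pderiv_at a G x ** Gi x)"
    by (metis add_eq_0_iff2 matrix_mul_assoc bounded_bilinear.minus_right[OF bounded_bilinear_matrix_mult])
  moreover have "Gi x ** (G x ** pderiv_at a Gi x) = pderiv_at a Gi x"
    by (simp add: matrix_mul_assoc inverse_G assms)
  moreover have "Gi x ** pderiv_at a G x ** Gi x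
      = Gi x ** transpose (conn a x) ** (G x ** Gi x) + (Gi x ** G x) ** (conn a x ** Gi x)"
    by (simp add: pderiv_G assms matrix_mult_distribs matrix_mul_assoc)
  ultimately show ?thesis by (simp add: inverse_G assms)
qed

section \<open>Curvature of a matrix-valued connection and the second Bianchi identity\<close>

lemma curv_eq:
  assumes "x \<in> U"
  shows "curv i j x = pderiv_at i (conn j) x - pderiv_at j (conn i) x
    + conn i x ** conn j x - conn j x ** conn i x"
proof -
  have "pderiv_at i (christoffel G l j k) x = pderiv_at i (conn j) x $ l $ k" for i j k l
    using pderiv_at_entry[OF differentiable(3)[OF assms], of i j l k] by (simp add: conn_def)
  then show ?thesis
    by (simp add: vec_eq_iff curv_def riemann_def matrix_matrix_mult_def conn_def sum_subtractf mult.commute)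
qed

lemma curv_antisym: "x \<in> U \<Longrightarrow> curv j i x = - curv i j x"
  by (simp add: curv_eq)

lemma pderiv_curv:
  assumes "x \<in> U"
  shows "pderiv_at a (curv i j) x = pderiv_at a (pderiv_at i (conn j)) x - pderiv_at a (pderiv_at j (conn i)) x
    + (conn i x ** pderiv_at a (conn j) x + pderiv_at a (conn i) x ** conn j x)
    - (conn j x ** pderiv_at a (conn i) x + pderiv_at a (conn j) x ** conn i x)"
proof -
  have "pderiv_at a (curv i j) x = pderiv_at a (\<lambda>x. pderiv_at i (conn j) x - pderiv_at j (conn i) x
    + conn i x ** conn j x - conn j x ** conn i x) x"
    by (rule pderiv_at_cong[OF open_U assms]) (rule curv_eq)
  then show ?thesis
    using assms by (simp add: pderiv_at_diff pderiv_at_add pderiv_at_matrix_mult differentiable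
        differentiable_bilinear[OF bounded_bilinear_matrix_mult])
qed

text \<open>\<open>D a i j\<close> is the covariant derivative of the curvature without the
  Christoffel terms for the indices \<open>i\<close> and \<open>j\<close>; those would cancel in the
  cyclic sum because the connection is torsion free. What remains is algebra: second derivatives of
  \<open>conn\<close> cancel by symmetry, and so do the products.\<close>

lemma bianchi:
  assumes "x \<in> U"
  defines "D \<equiv> \<lambda>a i j. pderiv_at a (curv i j) x + conn a x ** curv i j x - curv i j x ** conn a x"
  shows "D i j k + D j k i + D k i j = 0"
  unfolding D_def pderiv_curv[OF assms(1)] curv_eq[OF assms(1)]
    pderiv_at_commute_matrix[OF open_U smooth_conn assms(1), of j i]
    pderiv_at_commute_matrix[OF open_U smooth_conn assms(1), of k i]
    pderiv_at_commute_matrix[OF open_U smooth_conn assms(1), of k j]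
  by (simp add: matrix_mult_distribs matrix_mul_assoc)

text \<open>Second derivatives of the metric commute. Expressing both orders through
  \<open>pderiv_G\<close> and subtracting leaves exactly the curvature terms.\<close>

lemma curv_lower_antisym:
  assumes "x \<in> U"
  shows "transpose (curv b a x) ** G x + G x ** curv b a x = 0"
proof -
  have "pderiv_at b (pderiv_at a G) x =
      (transpose (conn a x) ** (transpose (conn b x) ** G x + G x ** conn b x)
        + transpose (pderiv_at b (conn a) x) ** G x)
      + (G x ** pderiv_at b (conn a) x + (transpose (conn b x) ** G x + G x ** conn b x) ** conn a x)" for a b
  proof -
    have "pderiv_at b (pderiv_at a G) x = pderiv_at b (\<lambda>x. transpose (conn a x) ** G x + G x ** conn a x) x"
      by (rule pderiv_at_cong[OF open_U assms]) (rule pderiv_G)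
    then show ?thesis
      using assms by (simp add: pderiv_at_add pderiv_at_matrix_mult differentiable pderiv_at_transpose
          differentiable_bilinear[OF bounded_bilinear_matrix_mult] pderiv_G
          differentiable_linear[OF bounded_linear_transpose])
  qed
  from this[of a b] this[of b a] show ?thesis
    unfolding curv_eq[OF assms] pderiv_at_commute_matrix[OF open_U smooth_G assms, of a b]
    by (simp add: matrix_mult_distribs transpose_distribs matrix_transpose_mul matrix_mul_assoc)
      (simp add: algebra_simps)
qed

text \<open>With both matrix indices in upper position, the antisymmetry of the curvature operator
  is that of a matrix, and the contraction to the Ricci tensor and its trace needs no further metric
  factor to be differentiated.\<close>

definition curv_up :: "'n \<Rightarrow> 'n \<Rightarrow> real ^ 'n \<Rightarrow> real ^ 'n ^ 'n"
  where "curv_up i j x = curv i j x ** Gi x"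

lemma smooth_curv_up: "smooth_on U (curv_up i j)"
proof -
  have "smooth_on U (\<lambda>x. curv_up i j x)"
    unfolding curv_up_def by (intro smooth_on_matrix_mult smooth_curv smooth_Gi open_U)
  then show ?thesis by simp
qed

lemma curv_up_antisym:
  assumes "x \<in> U"
  shows "curv_up j i x = - curv_up i j x"
  using curv_antisym[OF assms, of j i] by (simp add: curv_up_def matrix_mult_distribs)

text \<open>Multiply \<open>curv_lower_antisym\<close> by the inverse metric on both sides.\<close>

lemma curv_up_antisym':
  assumes "x \<in> U"
  shows "curv_up i j x $ m $ l = - curv_up i j x $ l $ m"
proof -
  have "0 = Gi x ** (transpose (curv i j x) ** G x + G x ** curv i j x) ** Gi x"
    by (simp add: curv_lower_antisym assms)
  also have "\<dots> = Gi x ** transpose (curv i j x) ** (G x ** Gi x) + (Gi x ** G x) ** (curv i j x ** Gi x)"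
    by (simp add: matrix_mult_distribs matrix_mul_assoc)
  also have "\<dots> = transpose (curv_up i j x) + curv_up i j x"
    by (simp add: inverse_G assms curv_up_def matrix_transpose_mul
        pos_def_transpose[OF pos_def_matrix_inv[OF pos_def_G]])
  finally have "(transpose (curv_up i j x) + curv_up i j x) $ l $ m = 0" by simp
  then show ?thesis by (simp add: transpose_def)
qed

lemma pderiv_curv_up_antisym:
  assumes "x \<in> U"
  shows "pderiv_at a (curv_up j i) x = - pderiv_at a (curv_up i j) x"
    and "pderiv_at a (curv_up i j) x $ m $ l = - pderiv_at a (curv_up i j) x $ l $ m"
proof -
  have d: "curv_up i j differentiable (at x)" for i j
    by (rule smooth_on_differentiable[OF smooth_curv_up assms])
  have "pderiv_at a (curv_up j i) x = pderiv_at a (\<lambda>x. - curv_up i j x) x"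
    by (rule pderiv_at_cong[OF open_U assms]) (rule curv_up_antisym)
  then show "pderiv_at a (curv_up j i) x = - pderiv_at a (curv_up i j) x"
    by (simp add: pderiv_at_linear[OF bounded_linear_minus[OF bounded_linear_ident]] d)
  have "pderiv_at a (\<lambda>x. curv_up i j x $ m $ l) x = pderiv_at a (\<lambda>x. - curv_up i j x $ l $ m) x"
    by (rule pderiv_at_cong[OF open_U assms]) (rule curv_up_antisym')
  then show "pderiv_at a (curv_up i j) x $ m $ l = - pderiv_at a (curv_up i j) x $ l $ m"
    by (simp add: pderiv_at_linear[OF bounded_linear_minus[OF bounded_linear_ident]] d
        pderiv_at_entry differentiable_nth)
qed

text \<open>The inverse metric is parallel: its derivative turns the factor \<open>conn a\<close> on
  the right of \<open>curv\<close> into its transpose on the right of \<open>curv_up\<close>, with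
  opposite sign.\<close>

lemma bianchi_up:
  assumes "x \<in> U"
  defines "D \<equiv> \<lambda>a i j. pderiv_at a (curv_up i j) x + conn a x ** curv_up i j x
    + curv_up i j x ** transpose (conn a x)"
  shows "D i j k + D j k i + D k i j = 0"
proof -
  have "D a i j = (pderiv_at a (curv i j) x + conn a x ** curv i j x - curv i j x ** conn a x) ** Gi x" for a i j
  proof -
    have "pderiv_at a (curv_up i j) x = pderiv_at a (\<lambda>x. curv i j x ** Gi x) x"
      by (rule arg_cong[of _ _ "\<lambda>f. pderiv_at a f x"]) (simp add: fun_eq_iff curv_up_def)
    then show ?thesis
      using assms(1) by (simp add: D_def pderiv_at_matrix_mult differentiable pderiv_Gi curv_up_def
          matrix_mult_distribs matrix_mul_assoc)
  qed
  then show ?thesis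
    using bianchi[OF assms(1), of i j k] by (simp flip: bounded_bilinear.add_left[OF bounded_bilinear_matrix_mult])
qed

text \<open>The mixed Ricci tensor, with lower row index and upper column index. The order of the
  factors matters, as symmetry of the Ricci matrix becomes available only through the soliton
  equation.\<close>

definition ricci_up :: "real ^ 'n \<Rightarrow> real ^ 'n ^ 'n"
  where "ricci_up x = ricci G x ** Gi x"

lemma smooth_ricci_up: "smooth_on U ricci_up"
proof -
  have "smooth_on U (\<lambda>x. ricci_up x)"
    unfolding ricci_up_def by (intro smooth_on_matrix_mult smooth_ricci smooth_Gi open_U)
  then show ?thesis by simp
qed

lemma ricci_up_eq: "ricci_up x $ k $ m = (\<Sum>i\<in>UNIV. curv_up i k x $ i $ m)"
  by (simp add: ricci_up_def ricci_def curv_up_def curv_def matrix_matrix_mult_def sum_distrib_right)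
    (rule sum.swap)

lemma scalar_curvature_eq: "x \<in> U \<Longrightarrow> scalar_curvature G x = trace (ricci_up x)"
  by (simp add: scalar_curvature_def inv_metric_def ricci_up_def trace_def matrix_matrix_mult_def
      pos_def_sym[OF pos_def_matrix_inv[OF pos_def_G]] mult.commute)

text \<open>The bracket is component k of div Ric, written as the divergence of the mixed tensor:
  one Christoffel sum belongs to the upper index, the other to the lower one.\<close>

lemma contracted_bianchi:
  assumes "x \<in> U"
  shows "2 * ((\<Sum>i\<in>UNIV. pderiv_at i ricci_up x $ k $ i)
      + (\<Sum>i\<in>UNIV. \<Sum>p\<in>UNIV. christoffel G i i p x * ricci_up x $ k $ p)
      - (\<Sum>i\<in>UNIV. \<Sum>p\<in>UNIV. christoffel G i k p x * ricci_up x $ i $ p))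
    = pderiv_at k (scalar_curvature G) x"
proof -
  have d: "curv_up i j differentiable (at x)" "ricci_up differentiable (at x)" for i j
    by (intro smooth_on_differentiable[OF _ assms] smooth_curv_up smooth_ricci_up)+
  have dq: "pderiv_at a ricci_up x $ k $ m = (\<Sum>i\<in>UNIV. pderiv_at a (curv_up i k) x $ i $ m)" for a k m
    using pderiv_at_entry[OF d(2), of a k m]
    by (simp add: ricci_up_eq pderiv_at_sum d differentiable_nth pderiv_at_entry)
  have dS: "pderiv_at k (scalar_curvature G) x = (\<Sum>j\<in>UNIV. pderiv_at k ricci_up x $ j $ j)"
  proof -
    have "pderiv_at k (scalar_curvature G) x = pderiv_at k (\<lambda>y. \<Sum>j\<in>UNIV. ricci_up y $ j $ j) x"
      by (rule pderiv_at_cong[OF open_U assms]) (simp add: scalar_curvature_eq trace_def)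
    then show ?thesis by (simp add: pderiv_at_sum d differentiable_nth pderiv_at_entry)
  qed
  show ?thesis
    unfolding dS dq ricci_up_eq
  proof (rule contract_bianchi[where N = "\<lambda>i j l m. curv_up i j x $ l $ m"
        and dN = "\<lambda>a i j l m. pderiv_at a (curv_up i j) x $ l $ m"
        and Ga = "\<lambda>l a p. christoffel G l a p x"])
    fix i j k l m
    have "((pderiv_at i (curv_up j k) x + conn i x ** curv_up j k x + curv_up j k x ** transpose (conn i x))
      + (pderiv_at j (curv_up k i) x + conn j x ** curv_up k i x + curv_up k i x ** transpose (conn j x))
      + (pderiv_at k (curv_up i j) x + conn k x ** curv_up i j x + curv_up i j x ** transpose (conn k x))) $ l $ m = 0"
      using bianchi_up[OF assms, of i j k] by simp
    then show "(pderiv_at i (curv_up j k) x $ l $ m + (\<Sum>p\<in>UNIV. christoffel G l i p x * curv_up j k x $ p $ m)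
         + (\<Sum>p\<in>UNIV. christoffel G m i p x * curv_up j k x $ l $ p))
      + (pderiv_at j (curv_up k i) x $ l $ m + (\<Sum>p\<in>UNIV. christoffel G l j p x * curv_up k i x $ p $ m)
         + (\<Sum>p\<in>UNIV. christoffel G m j p x * curv_up k i x $ l $ p))
      + (pderiv_at k (curv_up i j) x $ l $ m + (\<Sum>p\<in>UNIV. christoffel G l k p x * curv_up i j x $ p $ m)
         + (\<Sum>p\<in>UNIV. christoffel G m k p x * curv_up i j x $ l $ p)) = 0"
      by (simp add: matrix_matrix_mult_def transpose_def conn_def mult.commute)
  next
    fix a i j l m
    show "curv_up j i x $ l $ m = - curv_up i j x $ l $ m"
      unfolding curv_up_antisym[OF assms, of j i] by simp
    show "curv_up i j x $ m $ l = - curv_up i j x $ l $ m"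
      by (rule curv_up_antisym'[OF assms])
    show "pderiv_at a (curv_up j i) x $ l $ m = - pderiv_at a (curv_up i j) x $ l $ m"
      unfolding pderiv_curv_up_antisym(1)[OF assms, of a j i] by simp
    show "pderiv_at a (curv_up i j) x $ m $ l = - pderiv_at a (curv_up i j) x $ l $ m"
      by (rule pderiv_curv_up_antisym(2)[OF assms])
    show "christoffel G l m a x = christoffel G l a m x"
      by (rule christoffel_sym[OF assms])
  qed
qed

end

section \<open>Divergence, Lie derivative and the pointwise identity for solitons\<close>

lemma trace_transpose: "trace (transpose A) = trace A"
  by (simp add: trace_def transpose_def)

lemma trace_scaleR: "trace (c *\<^sub>R A :: real ^ 'n ^ 'n::finite) = c * trace A"
  by (simp add: trace_def sum_distrib_left)

lemma tensor_norm_square: "pos_def M \<Longrightarrow> (tensor_norm M T)\<^sup>2 = tensor_inner M T T"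
  by (simp add: tensor_norm_def tensor_inner_nonneg)

context metric_chart
begin

text \<open>Jacobi's formula together with metric compatibility, which makes the trace of
  \<open>Gi x ** pderiv_at j G x\<close> twice the trace of \<open>conn j x\<close>; the square root
  halves it.\<close>

lemma pderiv_sqrt_det:
  assumes "x \<in> U"
  shows "pderiv_at j (\<lambda>y. sqrt (det (G y))) x = sqrt (det (G x)) * (\<Sum>i\<in>UNIV. christoffel G i i j x)"
proof -
  have det: "det (G x) > 0" using pos_def_det[OF pos_def_G[OF assms]] .
  have "trace (Gi x ** transpose (conn j x) ** G x) = trace (G x ** (Gi x ** transpose (conn j x)))"
    by (rule trace_mul_sym)
  also have "\<dots> = trace (conn j x)"
    by (simp add: matrix_mul_assoc inverse_G assms trace_transpose)
  finally have "trace (Gi x ** pderiv_at j G x) = 2 * trace (conn j x)"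
    by (simp add: pderiv_G assms matrix_mult_distribs matrix_mul_assoc inverse_G trace_add)
  then have "pderiv_at j (\<lambda>y. det (G y)) x = det (G x) * (2 * trace (conn j x))"
    using pderiv_at_det[OF differentiable(1)[OF assms] pos_def_invertible[OF pos_def_G[OF assms]], of j]
    by simp
  moreover have "(\<lambda>y. det (G y)) differentiable (at x)"
    using smooth_on_det[OF open_U smooth_on_entry[OF open_U smooth_G]] assms
    by (rule smooth_on_differentiable)
  ultimately have "pderiv_at j (\<lambda>y. sqrt (det (G y))) x
      = inverse (sqrt (det (G x))) / 2 * (det (G x) * (2 * trace (conn j x)))"
    using pderiv_at_real_compose(1)[where f = "\<lambda>y. det (G y)" and H = sqrt, OF _ DERIV_real_sqrt[OF det], of j] by simp
  also have "\<dots> = sqrt (det (G x)) * trace (conn j x)"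
    using det by (simp add: field_simps flip: power2_eq_square)
  also have "trace (conn j x) = (\<Sum>i\<in>UNIV. christoffel G i i j x)"
    by (simp add: trace_def conn_def christoffel_sym[OF assms, of _ j])
  finally show ?thesis .
qed

lemma smooth_sqrt_det: "smooth_on U (\<lambda>y. sqrt (det (G y)))"
  by (intro smooth_on_sqrt smooth_on_det smooth_on_entry smooth_G open_U pos_def_det pos_def_G)

text \<open>Absorbing the Christoffel terms into the volume density leaves a sum of plain partial
  derivatives, the form that can be integrated by parts.\<close>

lemma divergence_density:
  assumes "x \<in> U" "Z differentiable (at x)"
  shows "(\<Sum>i\<in>UNIV. pderiv_at i (\<lambda>y. sqrt (det (G y)) * Z y $ i) x) = sqrt (det (G x)) * divergence G Z x"
proof -
  have "pderiv_at i (\<lambda>y. sqrt (det (G y)) * Z y $ i) x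
      = sqrt (det (G x)) * pderiv_at i (\<lambda>y. Z y $ i) x
        + sqrt (det (G x)) * (\<Sum>j\<in>UNIV. christoffel G j j i x * Z x $ i)" for i
    using smooth_on_differentiable[OF smooth_sqrt_det assms(1)] assms
    by (simp add: pderiv_at_mult differentiable_nth pderiv_sqrt_det sum_distrib_right sum_distrib_left mult_ac)
  then have "(\<Sum>i\<in>UNIV. pderiv_at i (\<lambda>y. sqrt (det (G y)) * Z y $ i) x)
      = sqrt (det (G x)) * ((\<Sum>i\<in>UNIV. pderiv_at i (\<lambda>y. Z y $ i) x)
        + (\<Sum>i\<in>UNIV. \<Sum>j\<in>UNIV. christoffel G j j i x * Z x $ i))"
    by (simp add: sum.distrib sum_distrib_left distrib_left)
  also have "(\<Sum>i\<in>UNIV. \<Sum>j\<in>UNIV. christoffel G j j i x * Z x $ i)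
      = (\<Sum>j\<in>UNIV. \<Sum>i\<in>UNIV. christoffel G j j i x * Z x $ i)"
    by (rule sum.swap)
  finally show ?thesis by (simp add: divergence_def sum.distrib)
qed

text \<open>Row k and column i hold component k of the covariant derivative in direction i, so the
  matrix represents the operator sending v to the derivative of X along v.\<close>

definition cov_deriv :: "(real ^ 'n \<Rightarrow> real ^ 'n) \<Rightarrow> real ^ 'n \<Rightarrow> real ^ 'n ^ 'n"
  where "cov_deriv X x = (\<chi> k i. pderiv_at i (\<lambda>y. X y $ k) x + (\<Sum>m\<in>UNIV. christoffel G k i m x * X x $ m))"

text \<open>Metric compatibility removes the derivatives of \<open>G\<close>, and symmetry of the
  Christoffel symbols then assembles the remaining terms into covariant derivatives of X.\<close>

lemma lie_derivative_eq:
  assumes "x \<in> U"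
  shows "lie_derivative_metric X G x = transpose (cov_deriv X x) ** G x + G x ** cov_deriv X x"
proof -
  have "lie_derivative_metric X G x $ i $ j
      = (transpose (cov_deriv X x) ** G x + G x ** cov_deriv X x) $ i $ j" for i j
  proof -
    have "pderiv_at k (\<lambda>y. G y $ i $ j) x
        = (\<Sum>l\<in>UNIV. christoffel G l k i x * G x $ l $ j) + (\<Sum>l\<in>UNIV. G x $ i $ l * christoffel G l k j x)" for k
      by (simp add: pderiv_at_entry differentiable assms pderiv_G)
        (simp add: matrix_matrix_mult_def transpose_def conn_def)
    then have "lie_derivative_metric X G x $ i $ j
        = (\<Sum>k\<in>UNIV. \<Sum>l\<in>UNIV. X x $ k * christoffel G l k i x * G x $ l $ j)
          + (\<Sum>k\<in>UNIV. \<Sum>l\<in>UNIV. X x $ k * G x $ i $ l * christoffel G l k j x)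
          + (\<Sum>k\<in>UNIV. G x $ k $ j * pderiv_at i (\<lambda>y. X y $ k) x)
          + (\<Sum>k\<in>UNIV. G x $ i $ k * pderiv_at j (\<lambda>y. X y $ k) x)"
      by (simp add: lie_derivative_metric_def sum.distrib distrib_left sum_distrib_left mult.assoc)
    also have "(\<Sum>k\<in>UNIV. \<Sum>l\<in>UNIV. X x $ k * christoffel G l k i x * G x $ l $ j)
        = (\<Sum>l\<in>UNIV. \<Sum>k\<in>UNIV. X x $ k * christoffel G l k i x * G x $ l $ j)"
      by (rule sum.swap)
    also have "(\<Sum>k\<in>UNIV. \<Sum>l\<in>UNIV. X x $ k * G x $ i $ l * christoffel G l k j x)
        = (\<Sum>l\<in>UNIV. \<Sum>k\<in>UNIV. X x $ k * G x $ i $ l * christoffel G l k j x)"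
      by (rule sum.swap)
    finally show ?thesis
      by (simp add: matrix_matrix_mult_def transpose_def cov_deriv_def sum.distrib distrib_left distrib_right
          sum_distrib_left sum_distrib_right christoffel_sym[OF assms, of _ _ i] christoffel_sym[OF assms, of _ _ j]
          mult_ac)
  qed
  then show ?thesis by (simp add: vec_eq_iff)
qed

lemma lie_derivative_sym: "x \<in> U \<Longrightarrow> transpose (lie_derivative_metric X G x) = lie_derivative_metric X G x"
  by (simp add: lie_derivative_eq transpose_distribs matrix_transpose_mul pos_def_transpose[OF pos_def_G] add.commute)

text \<open>The metric and its inverse cancel, so that only the derivative of \<open>f\<close> along
  \<open>v\<close> is left.\<close>

lemma inner_gradient:
  assumes "x \<in> U"
  shows "vector_inner (G x) (gradient G f x) v = (\<Sum>j\<in>UNIV. v $ j * pderiv_at j f x)"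
proof -
  define t where "t = (\<chi> j. pderiv_at j f x)"
  have "gradient G f x = Gi x *v t"
    by (simp add: gradient_def inv_metric_def matrix_vector_mult_def t_def)
  then have "vector_inner (G x) (gradient G f x) v = (\<Sum>i\<in>UNIV. \<Sum>j\<in>UNIV. v $ j * (G x $ j $ i * (Gi x *v t) $ i))"
    using pos_def_sym[OF pos_def_G[OF assms]] by (simp add: vector_inner_def mult_ac)
  also have "\<dots> = (\<Sum>j\<in>UNIV. \<Sum>i\<in>UNIV. v $ j * (G x $ j $ i * (Gi x *v t) $ i))"
    by (rule sum.swap)
  also have "\<dots> = (\<Sum>j\<in>UNIV. v $ j * (G x *v (Gi x *v t)) $ j)"
    by (simp add: matrix_vector_mult_def[of "G x"] sum_distrib_left)
  finally show ?thesis
    by (simp add: matrix_vector_mul_assoc inverse_G assms t_def)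
qed

text \<open>The field Z of the overview.\<close>

definition traceless_field :: "(real ^ 'n \<Rightarrow> real ^ 'n) \<Rightarrow> real ^ 'n \<Rightarrow> real ^ 'n"
  where "traceless_field X y = (Gi y ** traceless_ricci G y) *v X y"

lemma smooth_traceless_field:
  assumes "smooth_on U X"
  shows "smooth_on U (traceless_field X)"
proof -
  have "smooth_on U (\<lambda>y. \<chi> i. \<Sum>j\<in>UNIV. (Gi y ** traceless_ricci G y) $ i $ j * X y $ j)"
    unfolding traceless_ricci_def
    by (intro smooth_on_vec_lambda smooth_on_sum smooth_on_mult smooth_on_entry smooth_on_nth
        smooth_on_matrix_mult smooth_on_diff smooth_on_bilinear[OF _ bounded_bilinear_scaleR]
        smooth_on_linear[OF _ bounded_linear_divide] smooth_Gi smooth_ricci smooth_scalar_curvature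
        smooth_G assms open_U)
  then show ?thesis
    by (simp add: traceless_field_def[abs_def] matrix_vector_mult_def)
qed

text \<open>The product rule div (E X) = (div E)(X) + <E, \<nabla>X>, carried out in coordinates. In
  div E the Bianchi identity gives dS/2 and the trace part gives -dS/n.\<close>

lemma divergence_traceless_field:
  assumes x: "x \<in> U" and X: "smooth_on U X"
    and sym: "\<And>y. y \<in> U \<Longrightarrow> transpose (ricci G y) = ricci G y"
  shows "divergence G (traceless_field X) x
    = (real CARD('n) - 2) / (2 * real CARD('n)) * (\<Sum>k\<in>UNIV. X x $ k * pderiv_at k (scalar_curvature G) x)
      + trace (Gi x ** traceless_ricci G x ** cov_deriv X x)"
proof -
  let ?n = "real CARD('n)" and ?S = "scalar_curvature G" and ?q = "ricci_up x" and ?g = "\<lambda>k i j. christoffel G k i j x"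
  define dX where "dX k i = pderiv_at i (\<lambda>y. X y $ k) x" for k i
  define dq where "dq i k = pderiv_at i ricci_up x $ k $ i" for i k
  define dS where "dS k = pderiv_at k ?S x" for k
  have raised: "Gi y ** traceless_ricci G y = transpose (ricci_up y) - (?S y / ?n) *\<^sub>R mat 1" if "y \<in> U" for y
    using that sym[OF that] by (simp add: traceless_ricci_def matrix_mult_distribs inverse_G ricci_up_def
        matrix_transpose_mul pos_def_transpose[OF pos_def_matrix_inv[OF pos_def_G]])
  have Z: "traceless_field X y $ i = (\<Sum>k\<in>UNIV. ricci_up y $ k $ i * X y $ k) - ?S y * X y $ i / ?n"
    if "y \<in> U" for y i
    by (simp add: traceless_field_def raised[OF that] matrix_vector_mult_diff_rdistrib
        scaleR_matrix_vector_assoc[symmetric] vector_matrix_mult_def mult.commute)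
  have d: "X differentiable (at x)" "ricci_up differentiable (at x)" "?S differentiable (at x)"
    using smooth_on_differentiable[OF _ x] X smooth_ricci_up smooth_scalar_curvature by blast+
  have dZ: "pderiv_at i (\<lambda>y. traceless_field X y $ i) x
      = (\<Sum>k\<in>UNIV. ?q $ k $ i * dX k i + dq i k * X x $ k) - (?S x * dX i i + dS i * X x $ i) / ?n" for i
  proof -
    have "pderiv_at i (\<lambda>y. traceless_field X y $ i) x
        = pderiv_at i (\<lambda>y. (\<Sum>k\<in>UNIV. ricci_up y $ k $ i * X y $ k) - ?S y * X y $ i / ?n) x"
      by (rule pderiv_at_cong[OF open_U x]) (rule Z)
    also have "\<dots> = (\<Sum>k\<in>UNIV. ?q $ k $ i * dX k i + dq i k * X x $ k) - (?S x * dX i i + dS i * X x $ i) / ?n"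
      using d
      by (simp add: pderiv_at_diff pderiv_at_sum pderiv_at_linear[OF bounded_linear_divide] pderiv_at_mult
          differentiable_nth differentiable_bilinear[OF bounded_bilinear_mult] pderiv_at_entry
          differentiable_linear[OF bounded_linear_divide] dX_def dq_def dS_def)
    finally show ?thesis .
  qed
  have bianchi: "(\<Sum>i\<in>UNIV. dq i k) = dS k / 2 - (\<Sum>i\<in>UNIV. \<Sum>p\<in>UNIV. ?g i i p * ?q $ k $ p)
      + (\<Sum>i\<in>UNIV. \<Sum>p\<in>UNIV. ?g i k p * ?q $ i $ p)" for k
    using contracted_bianchi[OF x, of k] by (simp add: dq_def dS_def)
  \<comment> \<open>Of the two Christoffel sums, the negative one cancels against \<open>e2\<close>;
    the positive one is turned by \<open>e3\<close> into the Christoffel part of the covariant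
    derivative in \<open>e4\<close>.\<close>
  have e1: "(\<Sum>i\<in>UNIV. \<Sum>k\<in>UNIV. dq i k * X x $ k) = (\<Sum>k\<in>UNIV. X x $ k * dS k) / 2
      - (\<Sum>k\<in>UNIV. X x $ k * (\<Sum>i\<in>UNIV. \<Sum>p\<in>UNIV. ?g i i p * ?q $ k $ p))
      + (\<Sum>k\<in>UNIV. X x $ k * (\<Sum>i\<in>UNIV. \<Sum>p\<in>UNIV. ?g i k p * ?q $ i $ p))"
  proof -
    have "(\<Sum>i\<in>UNIV. \<Sum>k\<in>UNIV. dq i k * X x $ k) = (\<Sum>k\<in>UNIV. X x $ k * (\<Sum>i\<in>UNIV. dq i k))"
      by (subst sum.swap) (simp add: sum_distrib_left mult.commute)
    then show ?thesis
      by (simp add: bianchi distrib_left right_diff_distrib sum.distrib sum_subtractf sum_divide_distrib)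
  qed
  have e2: "(\<Sum>i\<in>UNIV. \<Sum>j\<in>UNIV. ?g i i j * traceless_field X x $ j)
      = (\<Sum>k\<in>UNIV. X x $ k * (\<Sum>i\<in>UNIV. \<Sum>p\<in>UNIV. ?g i i p * ?q $ k $ p))
        - ?S x / ?n * (\<Sum>i\<in>UNIV. \<Sum>j\<in>UNIV. ?g i i j * X x $ j)"
  proof -
    have "(\<Sum>i\<in>UNIV. \<Sum>j\<in>UNIV. ?g i i j * (\<Sum>k\<in>UNIV. ?q $ k $ j * X x $ k))
        = (\<Sum>i\<in>UNIV. \<Sum>k\<in>UNIV. \<Sum>j\<in>UNIV. X x $ k * (?g i i j * ?q $ k $ j))"
      by (subst (2) sum.swap) (simp add: sum_distrib_left mult_ac)
    also have "\<dots> = (\<Sum>k\<in>UNIV. \<Sum>i\<in>UNIV. \<Sum>j\<in>UNIV. X x $ k * (?g i i j * ?q $ k $ j))"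
      by (rule sum.swap)
    finally show ?thesis
      by (simp add: Z[OF x] right_diff_distrib sum_subtractf sum_distrib_left mult_ac)
  qed
  have e3: "(\<Sum>i\<in>UNIV. \<Sum>k\<in>UNIV. ?q $ k $ i * (\<Sum>m\<in>UNIV. ?g k i m * X x $ m))
      = (\<Sum>k\<in>UNIV. X x $ k * (\<Sum>i\<in>UNIV. \<Sum>p\<in>UNIV. ?g i k p * ?q $ i $ p))"
  proof -
    have "(\<Sum>i\<in>UNIV. \<Sum>k\<in>UNIV. ?q $ k $ i * (\<Sum>m\<in>UNIV. ?g k i m * X x $ m))
        = (\<Sum>i\<in>UNIV. \<Sum>m\<in>UNIV. \<Sum>k\<in>UNIV. X x $ m * (?g k m i * ?q $ k $ i))"
      by (subst (2) sum.swap) (simp add: sum_distrib_left mult_ac christoffel_sym[OF x])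
    also have "\<dots> = (\<Sum>m\<in>UNIV. \<Sum>i\<in>UNIV. \<Sum>k\<in>UNIV. X x $ m * (?g k m i * ?q $ k $ i))"
      by (rule sum.swap)
    also have "\<dots> = (\<Sum>m\<in>UNIV. \<Sum>k\<in>UNIV. \<Sum>i\<in>UNIV. X x $ m * (?g k m i * ?q $ k $ i))"
      by (intro sum.cong refl sum.swap)
    finally show ?thesis by (simp add: sum_distrib_left)
  qed
  have e4: "trace (Gi x ** traceless_ricci G x ** cov_deriv X x)
      = (\<Sum>i\<in>UNIV. \<Sum>k\<in>UNIV. ?q $ k $ i * (dX k i + (\<Sum>m\<in>UNIV. ?g k i m * X x $ m)))
        - ?S x / ?n * ((\<Sum>i\<in>UNIV. dX i i) + (\<Sum>i\<in>UNIV. \<Sum>j\<in>UNIV. ?g i i j * X x $ j))"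
    by (simp add: raised[OF x] matrix_mult_distribs trace_sub trace_scaleR)
      (simp add: trace_def matrix_matrix_mult_def transpose_def cov_deriv_def dX_def sum.distrib)
  have "divergence G (traceless_field X) x = (\<Sum>i\<in>UNIV. \<Sum>k\<in>UNIV. ?q $ k $ i * dX k i)
      + (\<Sum>i\<in>UNIV. \<Sum>k\<in>UNIV. dq i k * X x $ k) - ?S x / ?n * (\<Sum>i\<in>UNIV. dX i i)
      - (\<Sum>k\<in>UNIV. X x $ k * dS k) / ?n + (\<Sum>i\<in>UNIV. \<Sum>j\<in>UNIV. ?g i i j * traceless_field X x $ j)"
    by (simp add: divergence_def dZ sum.distrib sum_subtractf sum_divide_distrib add_divide_distrib
        sum_distrib_left mult.commute)
  also have "\<dots> = (1 / 2 - 1 / ?n) * (\<Sum>k\<in>UNIV. X x $ k * dS k)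
      + trace (Gi x ** traceless_ricci G x ** cov_deriv X x)"
    unfolding e1 e2 e4 distrib_left sum.distrib e3 by (simp add: algebra_simps)
  also have "1 / 2 - 1 / ?n = (?n - 2) / (2 * ?n)"
    by (simp add: field_simps)
  finally show ?thesis by (simp add: dS_def)
qed

text \<open>Both the metric and its Lie derivative are symmetric, which replaces an appeal to the
  first Bianchi identity.\<close>

lemma soliton_ricci_sym:
  assumes "x \<in> U" "ricci G x + (1/2) *\<^sub>R lie_derivative_metric X G x = l *\<^sub>R G x"
  shows "transpose (ricci G x) = ricci G x"
proof -
  have "ricci G x = l *\<^sub>R G x - (1/2) *\<^sub>R lie_derivative_metric X G x"
    using assms(2) by (simp add: eq_diff_eq)
  then show ?thesis
    by (simp add: transpose_distribs transpose_scalar lie_derivative_sym assms pos_def_transpose[OF pos_def_G])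
qed

lemma soliton_identity:
  assumes x: "x \<in> U" and X: "smooth_on U X"
    and soliton: "\<And>y. y \<in> U \<Longrightarrow> ricci G y + (1/2) *\<^sub>R lie_derivative_metric X G y = l y *\<^sub>R G y"
  shows "(tensor_norm (G x) (traceless_ricci G x))\<^sup>2
    = (real CARD('n) - 2) / (2 * real CARD('n)) *
        vector_inner (G x) (gradient G (scalar_curvature G) x) (X x)
      - divergence G (traceless_field X) x"
proof -
  let ?E = "traceless_ricci G x" and ?N = "cov_deriv X x" and ?n = "real CARD('n)"
  \<comment> \<open>The multiple of the metric that remains once Ric is eliminated from
    \<open>?E\<close>; it contributes nothing because \<open>?E\<close> is trace free.\<close>
  define c where "c = l x - scalar_curvature G x / ?n"
  have sym: "transpose (ricci G y) = ricci G y" if "y \<in> U" for y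
    using soliton_ricci_sym[OF that soliton[OF that]] .
  have Gsym: "transpose (G x) = G x" "transpose (Gi x) = Gi x"
    by (simp_all add: pos_def_transpose pos_def_matrix_inv pos_def_G x)
  have Esym: "transpose ?E = ?E"
    by (simp add: traceless_ricci_def transpose_distribs transpose_scalar sym x Gsym)
  have E: "?E = c *\<^sub>R G x - (1/2) *\<^sub>R lie_derivative_metric X G x"
  proof -
    have "ricci G x = l x *\<^sub>R G x - (1/2) *\<^sub>R lie_derivative_metric X G x"
      using soliton[OF x] by (simp add: eq_diff_eq)
    then show ?thesis by (simp add: traceless_ricci_def c_def scaleR_left_diff_distrib)
  qed
  have "trace (ricci_up x) = trace (Gi x ** ricci G x)"
    unfolding ricci_up_def by (rule trace_mul_sym)
  then have traceless: "trace (Gi x ** ?E) = 0"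
    by (simp add: traceless_ricci_def matrix_mult_distribs trace_sub trace_scaleR inverse_G x
        trace_I scalar_curvature_eq)
  \<comment> \<open>The two halves of the Lie derivative contribute equally to the inner product
    with the symmetric tensor \<open>?E\<close>; this is the source of the factor that cancels
    1/2.\<close>
  have "trace (Gi x ** ?E ** Gi x ** transpose ?N ** G x) = trace (G x ** (Gi x ** ?E ** Gi x ** transpose ?N))"
    by (rule trace_mul_sym)
  also have "\<dots> = trace (transpose (?E ** Gi x ** transpose ?N))"
    by (simp add: matrix_mul_assoc inverse_G x trace_transpose)
  also have "\<dots> = trace (?N ** (Gi x ** ?E))"
    by (simp add: matrix_transpose_mul Gsym Esym matrix_mul_assoc)
  also have "\<dots> = trace (Gi x ** ?E ** ?N)"
    by (rule trace_mul_sym)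
  finally have cyc: "trace (Gi x ** ?E ** Gi x ** transpose ?N ** G x) = trace (Gi x ** ?E ** ?N)" .
  have "(tensor_norm (G x) ?E)\<^sup>2 = trace (Gi x ** ?E ** Gi x ** ?E)"
    by (simp add: tensor_norm_square tensor_inner_eq_trace pos_def_G x Esym)
  also have "\<dots> = trace ((Gi x ** ?E) ** (Gi x ** (c *\<^sub>R G x - (1/2) *\<^sub>R lie_derivative_metric X G x)))"
    by (simp only: E[symmetric] matrix_mul_assoc)
  also have "\<dots> = c * trace (Gi x ** ?E)
      - (trace (Gi x ** ?E ** Gi x ** transpose ?N ** G x) + trace (Gi x ** ?E ** (Gi x ** G x) ** ?N)) / 2"
    unfolding lie_derivative_eq[OF x] by (simp add: matrix_mult_distribs trace_sub trace_add trace_scaleR inverse_G x)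
      (simp add: matrix_mul_assoc inverse_G x matrix_mult_distribs trace_add)
  also have "\<dots> = - trace (Gi x ** ?E ** ?N)"
    by (simp add: traceless cyc inverse_G x)
  finally show ?thesis
    by (simp add: divergence_traceless_field[OF x X sym] inner_gradient x)
qed

end

section \<open>Change of coordinates\<close>

lemma jacobian_entry: "jacobian \<phi> (at x) $ k $ i = pderiv_at i \<phi> x $ k"
  by (simp add: jacobian_def matrix_def pderiv_at_def)

text \<open>\<open>\<phi>\<close> pulls \<open>G'\<close> back to \<open>G\<close>. It stands for a
  transition map, with \<open>U\<close> the overlap of the charts in the first coordinates and
  \<open>U'\<close> the full image of the second chart.\<close>

locale metric_change = metric_chart U G + target: metric_chart U' G'
  for U :: "(real ^ 'n::finite) set" and G and U' :: "(real ^ 'n) set" and G' +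
  fixes \<phi> :: "real ^ 'n \<Rightarrow> real ^ 'n"
  assumes smooth_phi: "smooth_on U \<phi>" and phi_maps: "x \<in> U \<Longrightarrow> \<phi> x \<in> U'"
    and metric_change: "x \<in> U \<Longrightarrow>
      G x = transpose (jacobian \<phi> (at x)) ** G' (\<phi> x) ** jacobian \<phi> (at x)"
begin

abbreviation J :: "real ^ 'n \<Rightarrow> real ^ 'n ^ 'n"
  where "J x \<equiv> jacobian \<phi> (at x)"

lemma smooth_J: "smooth_on U J"
proof -
  have "smooth_on U (\<lambda>x. \<chi> k i. pderiv_at i \<phi> x $ k)"
    by (intro smooth_on_vec_lambda smooth_on_nth smooth_on_pderiv smooth_phi open_U)
  moreover have "(\<lambda>x. \<chi> k i. pderiv_at i \<phi> x $ k) = J"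
    by (simp add: fun_eq_iff vec_eq_iff jacobian_entry)
  ultimately show ?thesis by simp
qed

lemma det_G: "x \<in> U \<Longrightarrow> det (G x) = (det (J x))\<^sup>2 * det (G' (\<phi> x))"
  by (simp add: metric_change det_mul power2_eq_square)

lemma sqrt_det_G: "x \<in> U \<Longrightarrow> sqrt (det (G x)) = \<bar>det (J x)\<bar> * sqrt (det (G' (\<phi> x)))"
  by (simp add: det_G real_sqrt_mult)

text \<open>Positivity of the determinant of the pulled back metric forces the Jacobian determinant
  to be nonzero.\<close>

lemma invertible_J: "x \<in> U \<Longrightarrow> invertible (J x)"
  using pos_def_det[OF pos_def_G] by (fastforce simp: invertible_det_nz det_G)

lemma inverse_change:
  assumes "x \<in> U"
  shows "matrix_inv (G' (\<phi> x)) = J x ** Gi x ** transpose (J x)"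
proof -
  let ?K = "matrix_inv (J x)"
  note K = matrix_inv_mult[OF invertible_J[OF assms]]
  note i' = target.inverse_G[OF phi_maps[OF assms]]
  have "J x ** Gi x ** transpose (J x) ** G' (\<phi> x)
      = J x ** Gi x ** (transpose (J x) ** G' (\<phi> x) ** J x) ** ?K"
    unfolding matrix_mul_assoc[symmetric] K by simp
  also have "\<dots> = J x ** (Gi x ** G x) ** ?K"
    by (simp add: metric_change[OF assms] matrix_mul_assoc)
  finally have "J x ** Gi x ** transpose (J x) ** G' (\<phi> x) = mat 1"
    by (simp add: inverse_G assms K)
  then have "J x ** Gi x ** transpose (J x) ** (G' (\<phi> x) ** matrix_inv (G' (\<phi> x))) = matrix_inv (G' (\<phi> x))"
    by (simp add: matrix_mul_assoc)
  then show ?thesis by (simp add: i')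
qed

text \<open>Second derivatives of \<open>\<phi>\<close> occur only in \<open>K\<close>, the
  derivative of the Jacobian along X. They enter through the derivative of the pulled back metric
  and, with opposite sign, through the derivative of X.\<close>

lemma lie_derivative_change:
  assumes x: "x \<in> U" and X: "smooth_on U X" and X': "smooth_on U' X'"
    and field: "\<And>y. y \<in> U \<Longrightarrow> X' (\<phi> y) = J y *v X y"
  shows "lie_derivative_metric X G x = transpose (J x) ** lie_derivative_metric X' G' (\<phi> x) ** J x"
proof -
  let ?y = "\<phi> x"
  define DX where "DX = (\<chi> k i. pderiv_at i (\<lambda>y. X y $ k) x)"
  define DX' where "DX' = (\<chi> k i. pderiv_at i (\<lambda>y. X' y $ k) ?y)"
  define K where "K = (\<Sum>k\<in>UNIV. X x $ k *\<^sub>R pderiv_at k J x)"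
  define W where "W = (\<Sum>m\<in>UNIV. X' ?y $ m *\<^sub>R pderiv_at m G' ?y)"
  have y: "?y \<in> U'" by (rule phi_maps[OF x])
  have dphi: "\<phi> differentiable (at x)" "J differentiable (at x)" "G' differentiable (at ?y)"
      "X differentiable (at x)" "X' differentiable (at ?y)"
    using smooth_on_differentiable[OF _ x] smooth_on_differentiable[OF _ y] smooth_phi smooth_J
      target.smooth_G X X' by blast+
  have lie: "lie_derivative_metric X G x = (\<Sum>k\<in>UNIV. X x $ k *\<^sub>R pderiv_at k G x) + transpose DX ** G x + G x ** DX"
    using x by (simp add: vec_eq_iff lie_derivative_metric_def sum.distrib DX_def matrix_matrix_mult_def
        transpose_def sum_component pderiv_at_entry differentiable mult.commute)
  have lie': "lie_derivative_metric X' G' ?y = W + transpose DX' ** G' ?y + G' ?y ** DX'"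
    using y by (simp add: vec_eq_iff lie_derivative_metric_def sum.distrib DX'_def W_def matrix_matrix_mult_def
        transpose_def sum_component pderiv_at_entry target.differentiable mult.commute)
  have X'y: "X' ?y $ m = (\<Sum>k\<in>UNIV. J x $ m $ k * X x $ k)" for m
    by (simp add: field x matrix_vector_mult_def)
  have dG: "pderiv_at k G x = transpose (pderiv_at k J x) ** G' ?y ** J x
      + transpose (J x) ** (\<Sum>m\<in>UNIV. J x $ m $ k *\<^sub>R pderiv_at m G' ?y) ** J x
      + transpose (J x) ** G' ?y ** pderiv_at k J x" for k
  proof -
    have dG': "(G' \<circ> \<phi>) differentiable (at x)"
      using differentiable_chain_at dphi by blast
    have "pderiv_at k G x = pderiv_at k (\<lambda>x. transpose (J x) ** (G' \<circ> \<phi>) x ** J x) x"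
      by (rule pderiv_at_cong[OF open_U x]) (simp add: metric_change)
    also have "\<dots> = (transpose (J x) ** (G' \<circ> \<phi>) x) ** pderiv_at k J x
        + (transpose (J x) ** pderiv_at k (G' \<circ> \<phi>) x + transpose (pderiv_at k J x) ** (G' \<circ> \<phi>) x) ** J x"
      using dphi dG' by (simp only: pderiv_at_matrix_mult pderiv_at_transpose
          differentiable_bilinear[OF bounded_bilinear_matrix_mult] differentiable_linear[OF bounded_linear_transpose])
    also have "pderiv_at k (G' \<circ> \<phi>) x = (\<Sum>m\<in>UNIV. J x $ m $ k *\<^sub>R pderiv_at m G' ?y)"
      using dphi by (simp add: pderiv_at_compose jacobian_entry)
    finally show ?thesis by (simp add: matrix_mult_distribs)
  qed
  have W: "(\<Sum>k\<in>UNIV. X x $ k *\<^sub>R (\<Sum>m\<in>UNIV. J x $ m $ k *\<^sub>R pderiv_at m G' ?y)) = W"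
    by (simp add: W_def X'y scaleR_sum_right scaleR_sum_left mult.commute) (rule sum.swap)
  have sumG: "(\<Sum>k\<in>UNIV. X x $ k *\<^sub>R pderiv_at k G x)
      = transpose K ** G' ?y ** J x + transpose (J x) ** W ** J x + transpose (J x) ** G' ?y ** K"
    unfolding dG W[symmetric] K_def
    by (simp add: scaleR_add_right sum.distrib matrix_mult_distribs
        linear_sum[OF bounded_linear.linear[OF bounded_linear_transpose]] transpose_scalar
        bounded_bilinear.sum_left[OF bounded_bilinear_matrix_mult]
        bounded_bilinear.sum_right[OF bounded_bilinear_matrix_mult])
  have DX': "DX' ** J x = K + J x ** DX"
  proof -
    have "(DX' ** J x) $ l $ i = (K + J x ** DX) $ l $ i" for l i
    proof -
      have "(DX' ** J x) $ l $ i = pderiv_at i ((\<lambda>y. X' y $ l) \<circ> \<phi>) x"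
        using dphi by (simp add: matrix_matrix_mult_def DX'_def pderiv_at_compose differentiable_nth
            jacobian_entry mult.commute)
      also have "\<dots> = pderiv_at i (\<lambda>y. \<Sum>k\<in>UNIV. J y $ l $ k * X y $ k) x"
        by (rule pderiv_at_cong[OF open_U x]) (simp add: field matrix_vector_mult_def)
      also have "\<dots> = (\<Sum>k\<in>UNIV. J x $ l $ k * DX $ k $ i + pderiv_at i J x $ l $ k * X x $ k)"
        using dphi by (simp add: pderiv_at_sum pderiv_at_mult differentiable_nth
            differentiable_bilinear[OF bounded_bilinear_mult] pderiv_at_entry DX_def)
      \<comment> \<open>These entries are mixed second derivatives of component \<open>l\<close> of
        \<open>\<phi>\<close>, so \<open>i\<close> and \<open>k\<close> may be exchanged. This turns
        the sum into \<open>K\<close>.\<close>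
      also have "(\<lambda>k. pderiv_at i J x $ l $ k) = (\<lambda>k. pderiv_at k J x $ l $ i)"
      proof
        fix k
        have dd: "pderiv_at a \<phi> differentiable (at x)" for a
          by (rule smooth_on_differentiable[OF smooth_on_pderiv[OF smooth_phi] x])
        have "pderiv_at a J x $ l $ b = pderiv_at a (pderiv_at b (\<lambda>y. \<phi> y $ l)) x" for a b
        proof -
          have "pderiv_at a J x $ l $ b = pderiv_at a (\<lambda>y. pderiv_at b \<phi> y $ l) x"
            using pderiv_at_entry[OF dphi(2), of a l b] by (simp add: jacobian_entry)
          also have "\<dots> = pderiv_at a (pderiv_at b (\<lambda>y. \<phi> y $ l)) x"
            by (rule pderiv_at_cong[OF open_U x])
              (simp add: pderiv_at_nth smooth_on_differentiable[OF smooth_phi])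
          finally show ?thesis .
        qed
        then show "pderiv_at i J x $ l $ k = pderiv_at k J x $ l $ i"
          using pderiv_at_commute[OF open_U smooth_on_nth[OF open_U smooth_phi] x] by metis
      qed
      finally show ?thesis
        by (simp add: K_def sum_component matrix_matrix_mult_def sum.distrib mult.commute)
    qed
    then show ?thesis by (simp add: vec_eq_iff)
  qed
  have "transpose (J x) ** lie_derivative_metric X' G' ?y ** J x
      = transpose (J x) ** W ** J x + transpose (DX' ** J x) ** G' ?y ** J x
        + transpose (J x) ** G' ?y ** (DX' ** J x)"
    by (simp add: lie' matrix_mult_distribs matrix_transpose_mul matrix_mul_assoc)
  then show ?thesis
    unfolding DX' lie sumG metric_change[OF x]
    by (simp add: matrix_mult_distribs transpose_distribs matrix_transpose_mul matrix_mul_assoc)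
qed

text \<open>The same number \<open>l\<close> appears in both equations, as \<lambda> is a function
  on the manifold. Hence Ric is the same combination of two covariant tensors in both charts, and
  contractions follow.\<close>

lemma soliton_change:
  assumes x: "x \<in> U" and X: "smooth_on U X" and X': "smooth_on U' X'"
    and field: "\<And>y. y \<in> U \<Longrightarrow> X' (\<phi> y) = J y *v X y"
    and soliton: "ricci G x + (1/2) *\<^sub>R lie_derivative_metric X G x = l *\<^sub>R G x"
    and soliton': "ricci G' (\<phi> x) + (1/2) *\<^sub>R lie_derivative_metric X' G' (\<phi> x) = l *\<^sub>R G' (\<phi> x)"
  shows "scalar_curvature G' (\<phi> x) = scalar_curvature G x"
    and "target.traceless_field X' (\<phi> x) = J x *v traceless_field X x"
proof -
  have "ricci G x = l *\<^sub>R G x - (1/2) *\<^sub>R lie_derivative_metric X G x"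
    using soliton by (simp add: eq_diff_eq)
  moreover have "ricci G' (\<phi> x) = l *\<^sub>R G' (\<phi> x) - (1/2) *\<^sub>R lie_derivative_metric X' G' (\<phi> x)"
    using soliton' by (simp add: eq_diff_eq)
  ultimately have ric: "ricci G x = transpose (J x) ** ricci G' (\<phi> x) ** J x"
    using lie_derivative_change[OF x X X' field]
    by (simp add: metric_change[OF x] matrix_mult_distribs)
  have "scalar_curvature G' (\<phi> x) = trace (ricci G' (\<phi> x) ** J x ** Gi x ** transpose (J x))"
    by (simp add: target.scalar_curvature_eq phi_maps x target.ricci_up_def inverse_change matrix_mul_assoc)
  also have "\<dots> = trace (transpose (J x) ** (ricci G' (\<phi> x) ** J x ** Gi x))"
    by (rule trace_mul_sym)
  also have "\<dots> = scalar_curvature G x"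
    by (simp add: scalar_curvature_eq x ricci_up_def ric matrix_mul_assoc)
  finally show S: "scalar_curvature G' (\<phi> x) = scalar_curvature G x" .
  have E: "traceless_ricci G x = transpose (J x) ** traceless_ricci G' (\<phi> x) ** J x"
    unfolding traceless_ricci_def S ric metric_change[OF x] by (simp add: matrix_mult_distribs)
  show "target.traceless_field X' (\<phi> x) = J x *v traceless_field X x"
    by (simp add: target.traceless_field_def traceless_field_def inverse_change x field E
        matrix_vector_mul_assoc matrix_mul_assoc)
qed

end

section \<open>A smooth bump function\<close>

text \<open>The family is closed under differentiation up to linear combinations, so smoothness of
  all its members is proved together; the bump functions use k = 0.\<close>

definition flat :: "nat \<Rightarrow> real \<Rightarrow> real"
  where "flat k t = (if t > 0 then exp (- 1 / t) * (1 / t) ^ k else 0)"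

text \<open>With s = 1/t and m = k + 2, exp s is at least (1 + s/m)^m, hence at least (s/m)^m.
  Taking m two larger than k leaves a quadratic bound, so the difference quotient at 0 tends to
  0.\<close>

lemma flat_bound: "\<bar>flat k t\<bar> \<le> real (k + 2) ^ (k + 2) * t\<^sup>2"
proof (cases "t > 0")
  case True
  let ?m = "k + 2"
  have "(1 / (t * real ?m)) ^ ?m \<le> (1 + (1 / t) / real ?m) ^ ?m"
    using True by (intro power_mono) (auto simp: field_simps)
  also have "\<dots> \<le> exp (1 / t)"
    using True by (intro exp_ge_one_plus_x_over_n_power_n) (auto intro: order_trans[of _ 0])
  finally have "inverse (exp (1 / t)) \<le> inverse ((1 / (t * real ?m)) ^ ?m)"
    using True by (intro le_imp_inverse_le) auto
  moreover have "inverse (exp (1 / t)) = exp (- 1 / t)"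
    by (simp flip: exp_minus)
  moreover have "inverse ((1 / (t * real ?m)) ^ ?m) = (t * real ?m) ^ ?m"
    by (simp only: power_one_over inverse_eq_divide div_by_1 divide_divide_eq_right mult_1_left)
  ultimately have "exp (- 1 / t) \<le> (t * real ?m) ^ ?m"
    by simp
  then have "exp (- 1 / t) * (1 / t) ^ k \<le> (t * real ?m) ^ ?m * (1 / t) ^ k"
    using True by (intro mult_right_mono) auto
  also have "\<dots> = real ?m ^ ?m * t\<^sup>2 * (t * (1 / t)) ^ k"
    by (simp only: power_mult_distrib power_add mult_ac)
  also have "\<dots> = real ?m ^ ?m * t\<^sup>2"
    using True by simp
  finally show ?thesis using True by (simp add: flat_def)
qed (simp add: flat_def)

lemma flat_derivative: "(flat k has_real_derivative flat (k + 2) t - real k * flat (k + 1) t) (at t)"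
proof -
  consider "t > 0" | "t < 0" | "t = 0" by linarith
  then show ?thesis
  proof cases
    case 1
    define s where "s = 1 / t"
    have d: "((\<lambda>t. 1 / t) has_real_derivative - s\<^sup>2) (at t)"
      "((\<lambda>t. exp (- 1 / t)) has_real_derivative exp (- 1 / t) * s\<^sup>2) (at t)"
      using 1 by (auto intro!: derivative_eq_intros simp: s_def power2_eq_square)
    have "((\<lambda>t. exp (- 1 / t) * (1 / t) ^ k) has_real_derivative
        flat (k + 2) t - real k * flat (k + 1) t) (at t)"
      using DERIV_mult[OF d(2) DERIV_power[OF d(1), of k]] 1
      by (cases k) (simp_all add: flat_def power2_eq_square algebra_simps flip: s_def)
    then show ?thesis
      by (rule has_field_derivative_transform_within_open[of _ _ _ "{0<..}"]) (use 1 in \<open>auto simp: flat_def\<close>)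
  next
    case 2
    have "((\<lambda>t. 0) has_real_derivative flat (k + 2) t - real k * flat (k + 1) t) (at t)"
      using 2 by (simp add: flat_def)
    then show ?thesis
      by (rule has_field_derivative_transform_within_open[of _ _ _ "{..<0}"]) (use 2 in \<open>auto simp: flat_def\<close>)
  next
    case 3
    let ?C = "real (k + 2) ^ (k + 2)"
    have "((\<lambda>h. flat k h / h) \<longlongrightarrow> 0) (at 0)"
    proof (rule Lim_null_comparison)
      show "\<forall>\<^sub>F h in at 0. norm (flat k h / h) \<le> ?C * \<bar>h\<bar>"
      proof (rule eventually_at_filter[THEN iffD2], rule always_eventually, intro allI impI)
        fix h :: real assume "h \<noteq> 0"
        then show "norm (flat k h / h) \<le> ?C * \<bar>h\<bar>"
          using flat_bound[of k h] by (simp add: divide_le_eq power2_eq_square abs_mult_self_eq mult.assoc)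
      qed
      show "((\<lambda>h. ?C * \<bar>h\<bar>) \<longlongrightarrow> 0) (at 0)"
        by (auto intro!: tendsto_eq_intros)
    qed
    then show ?thesis using 3 by (simp add: DERIV_def flat_def)
  qed
qed

lemma smooth_on_flat:
  fixes f :: "real ^ 'n::finite \<Rightarrow> real"
  assumes "open U" "smooth_on U f"
  shows "smooth_on U (\<lambda>x. flat k (f x))"
proof -
  have "Ck_on m U (\<lambda>x. flat k (f x))" for m k
  proof (induction m arbitrary: k)
    case 0
    have "continuous_on UNIV (flat k)"
      using flat_derivative by (meson DERIV_isCont continuous_at_imp_continuous_on)
    then show ?case
      using continuous_on_compose2[OF _ smooth_on_continuous[OF assms(2)]] by fastforce
  next
    case (Suc m)
    have d: "f differentiable (at x)" if "x \<in> U" for x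
      using smooth_on_differentiable[OF assms(2) that] .
    have "Ck_on m U (pderiv_at i f)" for i
      using smooth_on_pderiv[OF assms(2)] by (simp add: smooth_on_def)
    then have 1: "Ck_on m U (\<lambda>x. (flat (k + 2) (f x) + (- real k) * flat (k + 1) (f x)) * pderiv_at i f x)" for i
      by (intro Ck_on_bilinear[OF assms(1) bounded_bilinear_mult] Ck_on_add[OF assms(1)] Ck_on_const Suc.IH)
    have 2: "(flat (k + 2) (f x) + (- real k) * flat (k + 1) (f x)) * pderiv_at i f x
        = pderiv_at i (\<lambda>x. flat k (f x)) x" if "x \<in> U" for x i
      using pderiv_at_real_compose(1)[OF d[OF that] flat_derivative[of k], of i] by simp
    have "Ck_on m U (pderiv_at i (\<lambda>x. flat k (f x)))" for i
      by (rule Ck_on_cong[OF assms(1) 2 1])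
    then show ?case
      using pderiv_at_real_compose(2)[OF d flat_derivative] by simp
  qed
  then show ?thesis by (simp add: smooth_on_def)
qed

section \<open>Integrals of compactly supported functions\<close>

text \<open>Smoothness is local, and the extension is smooth on each of the open sets
  \<open>U\<close> and \<open>- K\<close>, which cover the space.\<close>

lemma smooth_on_extend_zero:
  assumes "open U" "compact K" "K \<subseteq> U" "smooth_on U f" "\<And>x. x \<in> U - K \<Longrightarrow> f x = 0"
  shows "smooth_on UNIV (\<lambda>x. if x \<in> U then f x else 0)"
proof -
  have K: "open (- K)" using assms(2) compact_imp_closed by blast
  have "smooth_on U (\<lambda>x. if x \<in> U then f x else 0)"
    by (rule smooth_on_cong[OF assms(1) _ assms(4)]) simp
  moreover have "smooth_on (- K) (\<lambda>x. if x \<in> U then f x else 0)"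
    by (rule smooth_on_cong[OF K _ smooth_on_const[of _ 0]]) (use assms(5) in auto)
  ultimately have "smooth_on (U \<union> - K) (\<lambda>x. if x \<in> U then f x else 0)"
    by (rule smooth_on_Un[OF assms(1) K])
  moreover have "U \<union> - K = UNIV" using assms(3) by auto
  ultimately show ?thesis by simp
qed

lemma pderiv_at_zero_outside:
  assumes "open V" "x \<in> V" "\<And>y. y \<in> V \<Longrightarrow> f y = 0"
  shows "pderiv_at i f x = 0"
  using pderiv_at_cong[OF assms(1,2), of f "\<lambda>_. 0" i] assms(3) by simp

lemma extend_zero_compact_support:
  fixes f :: "real ^ 'n::finite \<Rightarrow> real"
  assumes "open U" "compact K" "K \<subseteq> U" "continuous_on U f" "\<And>x. x \<in> U - K \<Longrightarrow> f x = 0"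
  shows "continuous_on UNIV (\<lambda>x. if x \<in> U then f x else 0)"
    and "integrable lborel (\<lambda>x. if x \<in> U then f x else 0)"
proof -
  have K: "open (- K)" using assms(2) compact_imp_closed by blast
  have "continuous_on (U \<union> - K) (\<lambda>x. if x \<in> U then f x else 0)"
  proof (rule continuous_on_open_Un[OF assms(1) K])
    show "continuous_on U (\<lambda>x. if x \<in> U then f x else 0)"
      using assms(4) by (rule continuous_on_eq) simp
    show "continuous_on (- K) (\<lambda>x. if x \<in> U then f x else 0)"
      by (rule continuous_on_eq[OF continuous_on_const[of _ 0]]) (use assms(5) in auto)
  qed
  moreover have "U \<union> - K = UNIV" using assms(3) by auto
  ultimately show "continuous_on UNIV (\<lambda>x. if x \<in> U then f x else 0)" by simp
  have "integrable lborel (\<lambda>x. indicator K x *\<^sub>R f x)"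
    by (rule borel_integrable_compact[OF assms(2) continuous_on_subset[OF assms(4,3)]])
  also have "(\<lambda>x. indicator K x *\<^sub>R f x) = (\<lambda>x. if x \<in> U then f x else 0)"
    using assms(3,5) by (auto simp: fun_eq_iff indicator_def)
  finally show "integrable lborel (\<lambda>x. if x \<in> U then f x else 0)" .
qed

text \<open>Translation invariance makes the integral of every difference quotient vanish.\<close>

lemma integral_pderiv_compact_support:
  fixes f :: "real ^ 'n::finite \<Rightarrow> real"
  assumes f: "smooth_on UNIV f" and K: "compact K" "\<And>x. x \<notin> K \<Longrightarrow> f x = 0"
  shows "integral\<^sup>L lborel (pderiv_at i f) = 0"
proof -
  let ?e = "axis i 1 :: real ^ 'n"
  define h where "h n = 1 / real (Suc n)" for n
  have h: "0 < h n" "h n \<le> 1" for n by (auto simp: h_def)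
  have h0: "h \<longlonglongrightarrow> 0" unfolding h_def using LIMSEQ_inverse_real_of_nat by (simp add: inverse_eq_divide)
  define u where "u n x = (f (x + h n *\<^sub>R ?e) - f x) / h n" for n x
  have d: "f differentiable (at x)" for x by (rule smooth_on_differentiable[OF f]) simp
  have cont: "continuous_on UNIV f" "continuous_on UNIV (pderiv_at i f)"
    by (intro smooth_on_continuous smooth_on_pderiv f)+
  have meas: "f \<in> borel_measurable borel" "pderiv_at i f \<in> borel_measurable borel"
    using cont by (auto intro: borel_measurable_continuous_onI)
  have zero: "pderiv_at i f x = 0" if "x \<notin> K" for x
    by (rule pderiv_at_zero_outside[of "- K"]) (use K that compact_imp_closed in auto)
  have "compact (pderiv_at i f ` K)"
    by (rule compact_continuous_image[OF continuous_on_subset[OF cont(2)] K(1)]) simp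
  then obtain B where "\<forall>y\<in>pderiv_at i f ` K. norm y \<le> B"
    using compact_imp_bounded bounded_iff by blast
  then have B: "\<And>x. x \<in> K \<Longrightarrow> \<bar>pderiv_at i f x\<bar> \<le> B" by simp
  \<comment> \<open>The bound \<open>B\<close> could be negative if \<open>K\<close> is
    empty.\<close>
  define B' where "B' = max B 0"
  have B': "\<bar>pderiv_at i f x\<bar> \<le> B'" "B' \<ge> 0" for x
    using B[of x] zero[of x] by (cases "x \<in> K"; auto simp: B'_def)+
  obtain R where R: "\<And>x. x \<in> K \<Longrightarrow> norm x \<le> R"
    using compact_imp_bounded[OF K(1)] unfolding bounded_iff by blast
  \<comment> \<open>A dominating function for all difference quotients: steps are at most 1, so
    outside the ball of radius \<open>R + 1\<close> both points miss \<open>K\<close>, and inside it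
    the mean value theorem applies.\<close>
  have bound: "\<bar>u n x\<bar> \<le> B' * indicator (cball 0 (R + 1)) x" for n x
  proof (cases "x \<in> cball 0 (R + 1)")
    case True
    obtain z where "f (x + h n *\<^sub>R ?e) - f (x + 0 *\<^sub>R ?e) = (h n - 0) * pderiv_at i f (x + z *\<^sub>R ?e)"
      using MVT2[OF h(1)[of n] has_real_derivative_along_axis[OF d]] by metis
    then have "u n x = pderiv_at i f (x + z *\<^sub>R ?e)"
      using h(1)[of n] by (simp add: u_def)
    then show ?thesis using B' True by simp
  next
    case False
    have "norm x \<le> norm (x + h n *\<^sub>R ?e) + norm (h n *\<^sub>R ?e)"
      using norm_triangle_ineq4[of "x + h n *\<^sub>R ?e" "h n *\<^sub>R ?e"] by simp
    also have "norm (h n *\<^sub>R ?e) \<le> 1" using h[of n] by (simp add: norm_axis_1)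
    finally have "norm (x + h n *\<^sub>R ?e) > R" "norm x > R" using False by auto
    then have "x + h n *\<^sub>R ?e \<notin> K" "x \<notin> K" using R by force+
    then show ?thesis using K(2) False by (simp add: u_def)
  qed
  have int_f: "integrable lborel f"
  proof -
    have "integrable lborel (\<lambda>x. if x \<in> UNIV then f x else 0)"
      by (rule extend_zero_compact_support(2)[OF open_UNIV K(1) _ cont(1)]) (use K(2) in auto)
    then show ?thesis by simp
  qed
  have trans: "f \<in> borel_measurable borel \<Longrightarrow> (\<lambda>x. f (c + x)) \<in> borel_measurable borel" for c
  proof -
    assume f: "f \<in> borel_measurable borel"
    have "(\<lambda>x. c + x) \<in> borel \<rightarrow>\<^sub>M borel"
      by (intro borel_measurable_continuous_onI continuous_intros)
    then show ?thesis using f by (rule measurable_compose)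
  qed
  have "integral\<^sup>L lborel (u n) = 0" for n
  proof -
    let ?c = "h n *\<^sub>R ?e"
    have "integral\<^sup>L lborel f = integral\<^sup>L (distr lborel borel ((+) ?c)) f"
      by (simp add: lborel_distr_plus)
    also have "\<dots> = (LINT x|lborel. f (?c + x))"
      by (rule integral_distr) (use meas in simp_all)
    finally have eq: "(LINT x|lborel. f (?c + x)) = integral\<^sup>L lborel f" by simp
    have "integrable (distr lborel borel ((+) ?c)) f"
      using int_f by (simp add: lborel_distr_plus)
    then have "integrable lborel (\<lambda>x. f (?c + x))"
      by (subst (asm) integrable_distr_eq) (use meas in simp_all)
    then have "(LINT x|lborel. (f (?c + x) - f x) / h n) = 0"
      using int_f eq by simp
    then show ?thesis by (simp add: u_def[abs_def] add.commute)
  qed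
  moreover have "(\<lambda>n. integral\<^sup>L lborel (u n)) \<longlonglongrightarrow> integral\<^sup>L lborel (pderiv_at i f)"
  proof (rule integral_dominated_convergence)
    show "integrable lborel (\<lambda>x :: real ^ 'n. B' * indicator (cball 0 (R + 1)) x)"
      by (intro integrable_mult_right integrable_real_indicator) (use emeasure_lborel_cball_finite[of "0 :: real ^ 'n" "R + 1"] in auto)
    show "AE x in lborel. norm (u n x) \<le> B' * indicator (cball 0 (R + 1)) x" for n
      using bound by simp
    show "u n \<in> borel_measurable lborel" for n
      using trans[OF meas(1), of "h n *\<^sub>R ?e"] meas(1) by (simp add: u_def[abs_def] add.commute)
    show "pderiv_at i f \<in> borel_measurable lborel" using meas by simp
    have "(\<lambda>n. u n x) \<longlonglongrightarrow> pderiv_at i f x" for x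
    proof -
      have "((\<lambda>s. (f (x + s *\<^sub>R ?e) - f x) / s) \<longlongrightarrow> pderiv_at i f x) (at 0)"
        using has_real_derivative_along_axis[of f x 0 i] d by (simp add: DERIV_def)
      moreover have "filterlim h (at 0) sequentially"
        using h0 h(1) by (auto simp: filterlim_at intro!: always_eventually) (metis less_irrefl)
      ultimately show ?thesis unfolding u_def by (rule filterlim_compose)
    qed
    then show "AE x in lborel. (\<lambda>n. u n x) \<longlonglongrightarrow> pderiv_at i f x" by simp
  qed
  ultimately show ?thesis by (simp add: LIMSEQ_const_iff)
qed

section \<open>Change of variables\<close>

text \<open>A version of \<open>has_absolute_integral_change_of_variables\<close> for the
  Lebesgue-Borel integral. Values are embedded in \<open>real ^ 1\<close>, and integrals pass to the
  completed measure and back; \<open>meas\<close> permits the way back.\<close>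

lemma integral_change_of_variables_wellorder:
  fixes \<phi> :: "real ^ 'k::{finite, wellorder} \<Rightarrow> real ^ 'k::_" and f :: "real ^ 'k::_ \<Rightarrow> real"
  assumes S: "open S" and der: "\<And>x. x \<in> S \<Longrightarrow> (\<phi> has_derivative \<phi>' x) (at x)" and inj: "inj_on \<phi> S"
    and f: "integrable lborel f" "\<And>y. y \<notin> \<phi> ` S \<Longrightarrow> f y = 0"
    and meas: "(\<lambda>x. if x \<in> S then \<bar>det (matrix (\<phi>' x))\<bar> * f (\<phi> x) else 0) \<in> borel_measurable borel"
  shows "integral\<^sup>L lborel f = (LINT x|lborel. (if x \<in> S then \<bar>det (matrix (\<phi>' x))\<bar> * f (\<phi> x) else 0))"
proof -
  let ?g = "\<lambda>x. \<bar>det (matrix (\<phi>' x))\<bar> * f (\<phi> x)"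
  have f_eq: "(\<lambda>x. indicator (\<phi> ` S) x *\<^sub>R f x) = f"
    using f(2) by (auto simp: fun_eq_iff indicator_def)
  have g_eq: "(\<lambda>x. indicator S x *\<^sub>R ?g x) = (\<lambda>x. if x \<in> S then ?g x else 0)"
    by (auto simp: fun_eq_iff indicator_def)
  have abs_f: "f absolutely_integrable_on (\<phi> ` S)"
    unfolding set_integrable_def f_eq using f(1) by (subst integrable_completion) auto
  have "S \<in> sets lebesgue" using S by simp
  note * = has_absolute_integral_change_of_variables[OF this has_derivative_at_withinI[OF der] inj,
      where f = "\<lambda>x. vec (f x) :: real ^ 1" and b = "vec (integral (\<phi> ` S) f)"]
  have abs_g: "?g absolutely_integrable_on S" and int_g: "integral S ?g = integral (\<phi> ` S) f"
    using * abs_f by (simp_all add: absolutely_integrable_on_1_iff integral_on_1_eq)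
  have "integral\<^sup>L lborel f = integral\<^sup>L lebesgue f"
    using f(1) by (subst integral_completion) auto
  also have "\<dots> = integral (\<phi> ` S) f"
    using set_lebesgue_integral_eq_integral(2)[OF abs_f] by (simp only: set_lebesgue_integral_def f_eq)
  also have "\<dots> = integral\<^sup>L lebesgue (\<lambda>x. if x \<in> S then ?g x else 0)"
    using set_lebesgue_integral_eq_integral(2)[OF abs_g] int_g by (simp only: set_lebesgue_integral_def g_eq)
  also have "\<dots> = integral\<^sup>L lborel (\<lambda>x. if x \<in> S then ?g x else 0)"
    using meas by (subst integral_completion) auto
  finally show ?thesis .
qed

text \<open>The library states the change of variables formula only for coordinates indexed by a
  well-ordered type. An arbitrary finite index type is handled by relabelling the coordinates.\<close>

typedef 'a ordered = "UNIV :: 'a set" by simp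

instance ordered :: (finite) finite
proof
  have "(UNIV :: 'a ordered set) = range Abs_ordered"
    by (metis Rep_ordered_inverse surj_def)
  then show "finite (UNIV :: 'a ordered set)" by (metis finite finite_imageI)
qed

instantiation ordered :: (finite) wellorder
begin

text \<open>The order is pulled back along the injection \<open>to_nat\<close>; nothing depends on
  which order it is.\<close>

definition less_eq_ordered :: "'a ordered \<Rightarrow> 'a ordered \<Rightarrow> bool"
  where "less_eq_ordered x y \<longleftrightarrow> to_nat (Rep_ordered x) \<le> to_nat (Rep_ordered y)"

definition less_ordered :: "'a ordered \<Rightarrow> 'a ordered \<Rightarrow> bool"
  where "less_ordered x y \<longleftrightarrow> to_nat (Rep_ordered x) < to_nat (Rep_ordered y)"

instance
proof
  fix P :: "'a ordered \<Rightarrow> bool" and a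
  assume step: "\<And>x. (\<And>y. y < x \<Longrightarrow> P y) \<Longrightarrow> P x"
  show "P a"
    by (induction a rule: measure_induct_rule[of "\<lambda>x. to_nat (Rep_ordered x)"])
      (use step in \<open>auto simp: less_ordered_def\<close>)
qed (auto simp: less_eq_ordered_def less_ordered_def Rep_ordered_inject)

end

definition relabel :: "('k \<Rightarrow> 'n) \<Rightarrow> real ^ 'n::finite \<Rightarrow> real ^ 'k::finite"
  where "relabel \<sigma> x = (\<chi> k. x $ \<sigma> k)"

lemma bounded_linear_relabel: "bounded_linear (relabel \<sigma>)"
  unfolding linear_conv_bounded_linear[symmetric]
  by (auto simp: linear_iff relabel_def vec_eq_iff)

lemma prod_Basis_vec:
  fixes F :: "real ^ 'i::finite \<Rightarrow> real"
  shows "(\<Prod>b\<in>Basis. F b) = (\<Prod>i\<in>UNIV. F (axis i 1))"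
proof -
  have Basis: "(Basis :: (real ^ 'i) set) = range (\<lambda>i. axis i 1)"
    by (auto simp: Basis_vec_def)
  have inj: "inj (\<lambda>i. axis i 1 :: real ^ 'i)"
    by (auto simp: inj_def axis_eq_axis)
  show ?thesis
    unfolding Basis prod.reindex[OF inj] by simp
qed

text \<open>Lebesgue measure is determined by its values on boxes, and relabelling merely permutes
  the side lengths of a box.\<close>

lemma lborel_relabel:
  assumes "bij \<sigma>"
  shows "distr lborel borel (relabel \<sigma>) = (lborel :: (real ^ 'k::finite) measure)"
proof (rule lborel_eqI[symmetric])
  have meas: "relabel \<sigma> \<in> borel \<rightarrow>\<^sub>M borel"
    by (intro borel_measurable_continuous_onI linear_continuous_on bounded_linear_relabel)
  fix l u :: "real ^ 'k" assume le: "\<And>b. b \<in> Basis \<Longrightarrow> l \<bullet> b \<le> u \<bullet> b"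
  have le': "l $ k \<le> u $ k" for k
    using le[of "axis k 1"] by (simp add: inner_axis axis_in_Basis_iff)
  let ?r = "relabel (inv \<sigma>)"
  have "x \<in> relabel \<sigma> -` box l u \<longleftrightarrow> x \<in> box (?r l) (?r u)" for x
  proof -
    have "(\<forall>i. P i) \<longleftrightarrow> (\<forall>k. P (\<sigma> k))" for P
      using assms by (metis bij_pointE)
    from this[of "\<lambda>i. ?r l $ i < x $ i \<and> x $ i < ?r u $ i"] show ?thesis
      using assms by (simp add: mem_box_cart relabel_def bij_is_inj)
  qed
  then have "relabel \<sigma> -` box l u = box (?r l) (?r u)" by blast
  then have "emeasure (distr lborel borel (relabel \<sigma>)) (box l u) = emeasure lborel (box (?r l) (?r u))"
    using meas by (subst emeasure_distr) auto
  also have "\<dots> = (\<Prod>b\<in>Basis. (?r u - ?r l) \<bullet> b)"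
  proof (rule emeasure_lborel_box)
    fix b :: "real ^ 'a" assume "b \<in> Basis"
    then obtain i where "b = axis i 1" by (auto simp: Basis_vec_def)
    then show "?r l \<bullet> b \<le> ?r u \<bullet> b" using le' by (simp add: inner_axis relabel_def)
  qed
  also have "(\<Prod>b\<in>Basis. (?r u - ?r l) \<bullet> b) = (\<Prod>i\<in>UNIV. (u - l) $ inv \<sigma> i)"
    by (simp add: prod_Basis_vec inner_axis relabel_def)
  also have "\<dots> = (\<Prod>k\<in>UNIV. (u - l) $ k)"
    by (rule prod.reindex_bij_betw[OF bij_imp_bij_inv[OF assms]])
  also have "\<dots> = (\<Prod>b\<in>Basis. (u - l) \<bullet> b)"
    by (simp add: prod_Basis_vec inner_axis)
  finally show "emeasure (distr lborel borel (relabel \<sigma>)) (box l u) = ennreal (\<Prod>b\<in>Basis. (u - l) \<bullet> b)" .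
qed simp

text \<open>The Leibniz sum is reindexed by conjugating permutations with \<open>\<sigma>\<close>,
  which preserves signs.\<close>

lemma det_relabel:
  fixes M :: "real ^ 'n ^ 'n::finite" and \<sigma> :: "'k::finite \<Rightarrow> 'n"
  assumes "bij \<sigma>"
  shows "det (\<chi> a b. M $ \<sigma> a $ \<sigma> b) = det M"
proof -
  have s: "inj \<sigma>" "\<sigma> ` UNIV = UNIV" using assms by (auto simp: bij_def)
  have mp: "map_permutation UNIV \<sigma> p = \<sigma> \<circ> p \<circ> inv \<sigma>" for p
    by (simp add: map_permutation_def s restrict_id_def fun_eq_iff)
  have perm: "map_permutation UNIV \<sigma> p permutes UNIV" if "p permutes UNIV" for p
    using map_permutation_permutes[OF assms that] .
  have si: "bij (inv \<sigma>)" "inv (inv \<sigma>) = \<sigma>" using assms by (simp_all add: bij_imp_bij_inv inv_inv_eq)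
  have mpi: "map_permutation UNIV (inv \<sigma>) q = inv \<sigma> \<circ> q \<circ> \<sigma>" for q
    using si by (simp add: map_permutation_def restrict_id_def fun_eq_iff bij_is_surj)
  have mp_mpi: "map_permutation UNIV \<sigma> (map_permutation UNIV (inv \<sigma>) q) = q" for q
    using assms by (simp add: mp mpi fun_eq_iff bij_is_surj surj_f_inv_f)
  have "det M = (\<Sum>p\<in>{p. p permutes (UNIV :: 'k set)}. of_int (sign (map_permutation UNIV \<sigma> p))
      * (\<Prod>i\<in>UNIV. M $ i $ map_permutation UNIV \<sigma> p i))"
    unfolding det_def
  proof (rule sum.reindex_bij_witness[of _ "map_permutation UNIV \<sigma>" "map_permutation UNIV (inv \<sigma>)"])
    show "map_permutation UNIV \<sigma> (map_permutation UNIV (inv \<sigma>) q) = q" for q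
      by (rule mp_mpi)
    show "map_permutation UNIV (inv \<sigma>) (map_permutation UNIV \<sigma> p) = p" for p
      using s by (simp add: mp mpi fun_eq_iff)
    show "map_permutation UNIV (inv \<sigma>) q \<in> {p. p permutes UNIV}" if "q \<in> {p. p permutes UNIV}" for q
      using map_permutation_permutes[OF si(1), of q] that by simp
    show "map_permutation UNIV \<sigma> p \<in> {p. p permutes UNIV}" if "p \<in> {p. p permutes UNIV}" for p
      using perm that by simp
  qed (simp add: mp_mpi)
  also have "\<dots> = (\<Sum>p\<in>{p. p permutes (UNIV :: 'k set)}. of_int (sign p) * (\<Prod>a\<in>UNIV. M $ \<sigma> a $ \<sigma> (p a)))"
  proof (intro sum.cong refl)
    fix p :: "'k \<Rightarrow> 'k" assume p: "p \<in> {p. p permutes UNIV}"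
    have "(\<Prod>i\<in>UNIV. M $ i $ map_permutation UNIV \<sigma> p i) = (\<Prod>a\<in>UNIV. M $ \<sigma> a $ map_permutation UNIV \<sigma> p (\<sigma> a))"
      by (rule prod.reindex_bij_betw[OF assms, symmetric])
    moreover have "sign (map_permutation UNIV \<sigma> p) = sign p"
      using p by (intro sign_map_permutation s) auto
    ultimately show "of_int (sign (map_permutation UNIV \<sigma> p)) * (\<Prod>i\<in>UNIV. M $ i $ map_permutation UNIV \<sigma> p i)
        = of_int (sign p) * (\<Prod>a\<in>UNIV. M $ \<sigma> a $ \<sigma> (p a))"
      using s by (simp add: mp)
  qed
  finally show ?thesis by (simp add: det_def)
qed

theorem integral_change_of_variables_lborel:
  fixes \<phi> :: "real ^ 'n::finite \<Rightarrow> real ^ 'n" and f :: "real ^ 'n \<Rightarrow> real"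
  assumes S: "open S" and der: "\<And>x. x \<in> S \<Longrightarrow> (\<phi> has_derivative \<phi>' x) (at x)" and inj: "inj_on \<phi> S"
    and f: "integrable lborel f" "\<And>y. y \<notin> \<phi> ` S \<Longrightarrow> f y = 0"
    and meas: "(\<lambda>x. if x \<in> S then \<bar>det (matrix (\<phi>' x))\<bar> * f (\<phi> x) else 0) \<in> borel_measurable borel"
  shows "integral\<^sup>L lborel f = (LINT x|lborel. (if x \<in> S then \<bar>det (matrix (\<phi>' x))\<bar> * f (\<phi> x) else 0))"
proof -
  define \<sigma> :: "'n ordered \<Rightarrow> 'n" where "\<sigma> = Rep_ordered"
  have \<sigma>: "bij \<sigma>"
    unfolding \<sigma>_def by (rule bijI') (auto simp: Rep_ordered_inject intro: Abs_ordered_inverse[symmetric])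
  define r where "r = (relabel (inv \<sigma>) :: real ^ 'n ordered \<Rightarrow> real ^ 'n)"
  define s where "s = (relabel \<sigma> :: real ^ 'n \<Rightarrow> real ^ 'n ordered)"
  have rs: "r (s x) = x" "s (r y) = y" for x y
    using \<sigma> by (simp_all add: r_def s_def relabel_def vec_eq_iff bij_is_inj bij_is_surj surj_f_inv_f)
  have lin: "bounded_linear r" "bounded_linear s"
    unfolding r_def s_def by (rule bounded_linear_relabel)+
  have r_meas: "r \<in> borel \<rightarrow>\<^sub>M borel"
    by (intro borel_measurable_continuous_onI linear_continuous_on lin)
  have r_lborel: "distr lborel borel r = lborel"
    unfolding r_def by (rule lborel_relabel[OF bij_imp_bij_inv[OF \<sigma>]])
  have transfer: "integral\<^sup>L lborel F = (LINT y|lborel. F (r y))"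
    if "F \<in> borel_measurable borel" for F :: "real ^ 'n \<Rightarrow> real"
    using integral_distr[of r lborel borel F] r_meas that by (simp add: r_lborel)
  let ?g = "\<lambda>x. if x \<in> S then \<bar>det (matrix (\<phi>' x))\<bar> * f (\<phi> x) else 0"
  \<comment> \<open>The map in relabelled coordinates. \<open>r\<close> and \<open>s\<close> are
    mutually inverse, and passing to \<open>\<psi>\<close> changes neither the integrals nor the
    Jacobian determinant.\<close>
  define \<psi> where "\<psi> = s \<circ> \<phi> \<circ> r"
  define \<psi>' where "\<psi>' y = s \<circ> \<phi>' (r y) \<circ> r" for y
  have det: "det (matrix (\<psi>' y)) = det (matrix (\<phi>' (r y)))" for y
  proof -
    have "inv \<sigma> i = b \<longleftrightarrow> i = \<sigma> b" for i b
      using bij_inv_eq_iff[OF \<sigma>, of b i] by auto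
    then have "r (axis b 1) = axis (\<sigma> b) 1" for b
      by (simp add: r_def relabel_def axis_def vec_eq_iff)
    then have "matrix (\<psi>' y) = (\<chi> a b. matrix (\<phi>' (r y)) $ \<sigma> a $ \<sigma> b)"
      by (simp add: matrix_def \<psi>'_def s_def relabel_def)
    then show ?thesis by (simp add: det_relabel[OF \<sigma>])
  qed
  have g_eq: "?g (r y) = (if y \<in> r -` S then \<bar>det (matrix (\<psi>' y))\<bar> * f (r (\<psi> y)) else 0)" for y
    by (simp add: det \<psi>_def rs)
  have "integral\<^sup>L lborel f = (LINT y|lborel. f (r y))"
    using f(1) by (intro transfer) simp
  also have "\<dots> = (LINT y|lborel. (if y \<in> r -` S then \<bar>det (matrix (\<psi>' y))\<bar> * f (r (\<psi> y)) else 0))"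
  proof (rule integral_change_of_variables_wellorder)
    show "open (r -` S)"
      by (rule open_vimage[OF S]) (intro linear_continuous_on lin)
    show "(\<psi> has_derivative \<psi>' y) (at y)" if "y \<in> r -` S" for y
      unfolding \<psi>_def \<psi>'_def
      using that by (intro diff_chain_at bounded_linear_imp_has_derivative lin der) simp
    show "inj_on \<psi> (r -` S)"
    proof (rule inj_onI)
      fix a b assume ab: "a \<in> r -` S" "b \<in> r -` S" "\<psi> a = \<psi> b"
      then have "r (\<psi> a) = r (\<psi> b)" by simp
      then have "\<phi> (r a) = \<phi> (r b)" by (simp add: \<psi>_def rs)
      then have "r a = r b" using ab inj by (auto dest: inj_onD)
      then have "s (r a) = s (r b)" by simp
      then show "a = b" by (simp add: rs)
    qed
    show "integrable lborel (\<lambda>y. f (r y))"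
      using f(1) r_meas integrable_distr_eq[of r lborel borel f] by (simp add: r_lborel)
    show "f (r y) = 0" if "y \<notin> \<psi> ` (r -` S)" for y
    proof (rule f(2), rule notI)
      assume "r y \<in> \<phi> ` S"
      then obtain x where "x \<in> S" "r y = \<phi> x" by auto
      then have "s (r y) = s (\<phi> x)" by simp
      then have "y = \<psi> (s x)" "s x \<in> r -` S" using \<open>x \<in> S\<close> by (simp_all add: \<psi>_def rs)
      with that show False by blast
    qed
    show "(\<lambda>y. if y \<in> r -` S then \<bar>det (matrix (\<psi>' y))\<bar> * f (r (\<psi> y)) else 0) \<in> borel_measurable borel"
      using measurable_compose[OF r_meas meas] unfolding g_eq .
  qed
  also have "\<dots> = integral\<^sup>L lborel ?g"
    using transfer[OF meas] unfolding g_eq by simp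
  finally show ?thesis .
qed

section \<open>Charts of a smooth manifold\<close>

locale smooth_manifold =
  fixes A :: "('m::{t2_space, second_countable_topology}, 'n::finite) chart set"
  assumes atlas: "smooth_atlas A"
begin

lemma chart:
  assumes "c \<in> A"
  shows "open (chart_dom c)" "open (chart_img c)"
    "continuous_on (chart_dom c) (chart_map c)" "continuous_on (chart_img c) (chart_inv c)"
  using assms atlas by (auto simp: smooth_atlas_def is_chart_def homeomorphism_def)

lemma chart_map_inv:
  assumes "c \<in> A" "x \<in> chart_img c"
  shows "chart_inv c x \<in> chart_dom c" "chart_map c (chart_inv c x) = x"
  using assms atlas by (auto simp: smooth_atlas_def is_chart_def homeomorphism_def)

lemma chart_inv_map:
  assumes "c \<in> A" "p \<in> chart_dom c"
  shows "chart_map c p \<in> chart_img c" "chart_inv c (chart_map c p) = p"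
  using assms atlas by (auto simp: smooth_atlas_def is_chart_def homeomorphism_def chart_img_def)

lemma transition_dom_iff:
  assumes "c \<in> A"
  shows "x \<in> transition_dom c d \<longleftrightarrow> x \<in> chart_img c \<and> chart_inv c x \<in> chart_dom d"
proof
  assume "x \<in> transition_dom c d"
  then obtain p where "p \<in> chart_dom c" "p \<in> chart_dom d" "x = chart_map c p"
    by (auto simp: transition_dom_def)
  then show "x \<in> chart_img c \<and> chart_inv c x \<in> chart_dom d"
    using chart_inv_map[OF assms] by simp
next
  assume x: "x \<in> chart_img c \<and> chart_inv c x \<in> chart_dom d"
  then have "x = chart_map c (chart_inv c x)" "chart_inv c x \<in> chart_dom c \<inter> chart_dom d"
    using chart_map_inv[OF assms] by auto
  then show "x \<in> transition_dom c d" unfolding transition_dom_def by blast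
qed

lemma open_preimage:
  assumes "c \<in> A" "open V"
  shows "open {x \<in> chart_img c. chart_inv c x \<in> V}"
proof -
  have "{x \<in> chart_img c. chart_inv c x \<in> V} = chart_img c \<inter> chart_inv c -` V" by auto
  then show ?thesis using continuous_open_preimage[OF chart(4,2)[OF assms(1)] assms(2)] by simp
qed

lemma open_transition_dom:
  assumes "c \<in> A" "d \<in> A"
  shows "open (transition_dom c d)"
proof -
  have "transition_dom c d = {x \<in> chart_img c. chart_inv c x \<in> chart_dom d}"
    using transition_dom_iff[OF assms(1)] by blast
  then show ?thesis using open_preimage[OF assms(1) chart(1)[OF assms(2)]] by simp
qed

lemma transition_apply: "transition c d x = chart_map d (chart_inv c x)"
  by (simp add: transition_def)

lemma chart_inv_transition:
  assumes "c \<in> A" "d \<in> A" "x \<in> transition_dom c d"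
  shows "chart_inv d (transition c d x) = chart_inv c x"
  using assms by (simp add: transition_dom_iff transition_apply chart_inv_map)

lemma transition_in:
  assumes "c \<in> A" "d \<in> A" "x \<in> transition_dom c d"
  shows "transition c d x \<in> transition_dom d c"
  using assms chart_inv_transition[OF assms]
  by (simp add: transition_dom_iff chart_inv_map chart_map_inv transition_apply)

lemma transition_inverse:
  assumes "c \<in> A" "d \<in> A" "x \<in> transition_dom c d"
  shows "transition d c (transition c d x) = x"
  using assms chart_inv_transition[OF assms]
  by (simp add: transition_apply[of d] chart_map_inv transition_dom_iff)

lemma transition_image:
  assumes "c \<in> A" "d \<in> A"
  shows "transition c d ` transition_dom c d = transition_dom d c"
proof
  show "transition c d ` transition_dom c d \<subseteq> transition_dom d c"
    using transition_in assms by blast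
  show "transition_dom d c \<subseteq> transition c d ` transition_dom c d"
    using transition_in[OF assms(2,1)] transition_inverse[OF assms(2,1)] by (metis image_eqI subsetI)
qed

lemma inj_transition: "c \<in> A \<Longrightarrow> d \<in> A \<Longrightarrow> inj_on (transition c d) (transition_dom c d)"
  using transition_inverse by (metis inj_onI)

lemma smooth_transition: "c \<in> A \<Longrightarrow> d \<in> A \<Longrightarrow> smooth_on (transition_dom c d) (transition c d)"
  using atlas by (simp add: smooth_atlas_def)

lemma in_coords_transition:
  assumes "c \<in> A" "d \<in> A" "x \<in> transition_dom c d"
  shows "in_coords f d (transition c d x) = in_coords f c x"
  using chart_inv_transition[OF assms] by (simp add: in_coords_def)

lemma smooth_function_in_coords:
  "smooth_function A f \<Longrightarrow> c \<in> A \<Longrightarrow> smooth_on (chart_img c) (in_coords f c)"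
  by (simp add: smooth_function_def)

lemma chart_support:
  assumes "compact (UNIV :: 'm set)" "c \<in> A" "closure {p. f p \<noteq> 0} \<subseteq> chart_dom c"
  defines "K \<equiv> chart_map c ` closure {p. f p \<noteq> 0}"
  shows "compact K" "K \<subseteq> chart_img c" "x \<in> chart_img c - K \<Longrightarrow> in_coords f c x = 0"
proof -
  have "compact (closure {p. f p \<noteq> 0})"
    using compact_Int_closed[OF assms(1) closed_closure] by simp
  then show "compact K"
    unfolding K_def by (rule compact_continuous_image[OF continuous_on_subset[OF chart(3)[OF assms(2)] assms(3)]])
  show "K \<subseteq> chart_img c"
    using chart_inv_map(1)[OF assms(2)] assms(3) by (auto simp: K_def)
  assume x: "x \<in> chart_img c - K"
  then have "chart_inv c x \<notin> closure {p. f p \<noteq> 0}"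
    using chart_map_inv(2)[OF assms(2)] by (metis DiffD1 DiffD2 K_def image_eqI)
  then show "in_coords f c x = 0"
    using closure_subset[of "{p. f p \<noteq> 0}"] by (auto simp: in_coords_def)
qed

section \<open>Partitions of unity\<close>

text \<open>A bump on a ball in the chart is transported to the manifold. Its extension by zero is
  smooth because it vanishes off the compact set \<open>K\<close>, which is closed in the whole
  manifold by the Hausdorff property.\<close>

lemma bump_function:
  assumes c: "c \<in> A" and p: "p \<in> chart_dom c"
  obtains b K where "smooth_function A b" "\<And>q. 0 \<le> b q" "b p > 0" "open {q. b q > 0}"
    "closed K" "K \<subseteq> chart_dom c" "{q. b q \<noteq> 0} \<subseteq> K"
proof -
  define x0 where "x0 = chart_map c p"
  obtain r where r: "r > 0" "cball x0 r \<subseteq> chart_img c"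
    using chart(2)[OF c] chart_inv_map(1)[OF c p] open_contains_cball unfolding x0_def by blast
  \<comment> \<open>The squared distance keeps the argument of \<open>flat\<close> smooth at the
    centre; positivity holds exactly on the open ball of radius \<open>r\<close>.\<close>
  define \<beta> where "\<beta> x = flat 0 (r\<^sup>2 - (x - x0) \<bullet> (x - x0))" for x
  define b where "b q = (if q \<in> chart_dom c then \<beta> (chart_map c q) else 0)" for q
  define K where "K = chart_inv c ` cball x0 r"
  have \<beta>_pos: "\<beta> x > 0 \<longleftrightarrow> x \<in> ball x0 r" for x
  proof -
    have "(x - x0) \<bullet> (x - x0) = (dist x0 x)\<^sup>2"
      unfolding dist_commute[of x0 x] by (simp only: dist_norm power2_norm_eq_inner)
    moreover have "(dist x0 x)\<^sup>2 < r\<^sup>2 \<longleftrightarrow> dist x0 x < r"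
      using r(1) power2_less_imp_less[of "dist x0 x" r] power_strict_mono[of "dist x0 x" r 2] by auto
    ultimately show ?thesis
      by (simp add: \<beta>_def flat_def)
  qed
  have \<beta>_nonneg: "\<beta> x \<ge> 0" for x by (simp add: \<beta>_def flat_def)
  have K: "compact K"
    unfolding K_def by (rule compact_continuous_image[OF continuous_on_subset[OF chart(4)[OF c] r(2)]]) simp
  have K_dom: "K \<subseteq> chart_dom c" using r(2) chart_map_inv(1)[OF c] by (auto simp: K_def)
  have bK: "{q. b q \<noteq> 0} \<subseteq> K"
  proof
    fix q assume "q \<in> {q. b q \<noteq> 0}"
    then have q: "q \<in> chart_dom c" "\<beta> (chart_map c q) > 0"
      using \<beta>_nonneg[of "chart_map c q"] by (auto simp: b_def split: if_splits)
    then have "chart_map c q \<in> cball x0 r" using \<beta>_pos by auto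
    then show "q \<in> K" using chart_inv_map(2)[OF c q(1)] unfolding K_def by (metis image_eqI)
  qed
  have "open {q. b q > 0}"
  proof -
    have "{q. b q > 0} = chart_dom c \<inter> chart_map c -` ball x0 r"
    proof (rule set_eqI)
      show "q \<in> {q. b q > 0} \<longleftrightarrow> q \<in> chart_dom c \<inter> chart_map c -` ball x0 r" for q
        by (cases "q \<in> chart_dom c") (simp_all only: b_def mem_Collect_eq \<beta>_pos if_True if_False Int_iff vimage_eq less_irrefl simp_thms)
    qed
    then show ?thesis
      using continuous_open_preimage[OF chart(3,1)[OF c] open_ball] by simp
  qed
  moreover have "smooth_function A b"
    unfolding smooth_function_def
  proof
    fix d assume d: "d \<in> A"
    let ?W = "{x \<in> chart_img d. chart_inv d x \<in> - K}"
    have W: "open ?W" using K compact_imp_closed by (intro open_preimage[OF d]) auto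
    have "smooth_on (transition_dom d c) (in_coords b d)"
    proof (rule smooth_on_cong[OF open_transition_dom[OF d c]])
      show "smooth_on (transition_dom d c) (\<lambda>x. \<beta> (transition d c x))"
        unfolding \<beta>_def
        by (intro smooth_on_flat smooth_on_diff smooth_on_const smooth_on_bilinear[OF _ bounded_bilinear_inner]
            smooth_transition open_transition_dom d c)
      show "\<beta> (transition d c x) = in_coords b d x" if "x \<in> transition_dom d c" for x
        using that d by (simp add: in_coords_def b_def transition_dom_iff transition_apply)
    qed
    moreover have "smooth_on ?W (in_coords b d)"
      by (rule smooth_on_cong[OF W _ smooth_on_const[of _ 0]]) (use bK in \<open>auto simp: in_coords_def\<close>)
    moreover have "transition_dom d c \<union> ?W = chart_img d"
      using K_dom d by (auto simp: transition_dom_iff)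
    ultimately show "smooth_on (chart_img d) (in_coords b d)"
      using smooth_on_Un[OF open_transition_dom[OF d c] W, of "in_coords b d"] by simp
  qed
  moreover have "b p > 0" using p r(1) \<beta>_pos by (simp add: b_def x0_def)
  moreover have "0 \<le> b q" for q using \<beta>_nonneg by (simp add: b_def)
  ultimately show thesis
    using that[of b K] compact_imp_closed[OF K] K_dom bK by blast
qed

lemma partition_of_unity_exists:
  assumes compact: "compact (UNIV :: 'm set)"
  obtains F \<rho> where "partition_of_unity A F \<rho>"
proof -
  have "\<exists>c b K. c \<in> A \<and> smooth_function A b \<and> (\<forall>q. 0 \<le> b q) \<and> b p > 0 \<and> open {q. b q > 0} \<and>
      closed K \<and> K \<subseteq> chart_dom c \<and> {q. b q \<noteq> 0} \<subseteq> K" for p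
  proof -
    have "p \<in> (\<Union>c\<in>A. chart_dom c)" using atlas by (simp add: smooth_atlas_def)
    then obtain c where "c \<in> A" "p \<in> chart_dom c" by blast
    then show ?thesis using bump_function[of c p] by metis
  qed
  then obtain c b K where b: "\<And>p. c p \<in> A" "\<And>p. smooth_function A (b p)" "\<And>p q. 0 \<le> b p q" "\<And>p. b p p > 0"
      "\<And>p. open {q. b p q > 0}" "\<And>p. closed (K p)" "\<And>p. K p \<subseteq> chart_dom (c p)" "\<And>p. {q. b p q \<noteq> 0} \<subseteq> K p"
    by metis
  obtain P where P: "finite P" "UNIV \<subseteq> (\<Union>p\<in>P. {q. b p q > 0})"
  proof (rule compactE_image[OF compact, of UNIV "\<lambda>p. {q. b p q > 0}"])
    show "(UNIV :: 'm set) \<subseteq> (\<Union>p\<in>UNIV. {q. b p q > 0})" using b(4) by auto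
  qed (use b(5) in auto)
  define B where "B q = (\<Sum>p\<in>P. b p q)" for q
  have B: "B q > 0" for q
  proof -
    obtain p where "p \<in> P" "b p q > 0" using P(2) by blast
    then show ?thesis unfolding B_def using b(3) P(1) by (intro sum_pos2[of P p]) auto
  qed
  \<comment> \<open>Partitions are indexed by charts while bumps are indexed by points, so all bumps
    living in the same chart \<open>d\<close> are collected before normalisation.\<close>
  define \<rho> where "\<rho> d q = (\<Sum>p\<in>{p \<in> P. c p = d}. b p q) / B q" for d q
  have "partition_of_unity A (c ` P) \<rho>"
    unfolding partition_of_unity_def
  proof (intro conjI ballI allI)
    show "finite (c ` P)" "c ` P \<subseteq> A" using P(1) b(1) by auto
    fix d assume "d \<in> c ` P"
    show "smooth_function A (\<rho> d)"
      unfolding smooth_function_def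
    proof
      fix e assume e: "e \<in> A"
      have "smooth_on (chart_img e) (\<lambda>x. (\<Sum>p\<in>{p \<in> P. c p = d}. in_coords (b p) e x) / (\<Sum>p\<in>P. in_coords (b p) e x))"
        using B by (intro smooth_on_divide smooth_on_sum smooth_function_in_coords b e chart)
          (simp add: in_coords_def B_def)
      then show "smooth_on (chart_img e) (in_coords (\<rho> d) e)"
        by (simp add: \<rho>_def B_def in_coords_def comp_def)
    qed
    show "0 \<le> \<rho> d q" for q
      using B[of q] b(3) by (simp add: \<rho>_def sum_nonneg)
    have "closure {q. \<rho> d q \<noteq> 0} \<subseteq> (\<Union>p\<in>{p \<in> P. c p = d}. K p)"
    proof (rule closure_minimal)
      show "{q. \<rho> d q \<noteq> 0} \<subseteq> (\<Union>p\<in>{p \<in> P. c p = d}. K p)"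
      proof
        fix q assume "q \<in> {q. \<rho> d q \<noteq> 0}"
        then have "(\<Sum>p\<in>{p \<in> P. c p = d}. b p q) \<noteq> 0" by (auto simp: \<rho>_def)
        then obtain p where "p \<in> {p \<in> P. c p = d}" "b p q \<noteq> 0"
          by (rule sum.not_neutral_contains_not_neutral)
        then show "q \<in> (\<Union>p\<in>{p \<in> P. c p = d}. K p)" using b(8) by blast
      qed
      show "closed (\<Union>p\<in>{p \<in> P. c p = d}. K p)" using P(1) b(6) by (intro closed_UN) auto
    qed
    then show "closure {q. \<rho> d q \<noteq> 0} \<subseteq> chart_dom d" using b(7) by fastforce
  next
    fix q
    have "(\<Sum>d\<in>c ` P. \<rho> d q) = (\<Sum>d\<in>c ` P. \<Sum>p\<in>{p \<in> P. c p = d}. b p q) / B q"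
      by (simp add: \<rho>_def sum_divide_distrib)
    also have "(\<Sum>d\<in>c ` P. \<Sum>p\<in>{p \<in> P. c p = d}. b p q) = B q"
      unfolding B_def by (rule sum.image_gen[OF P(1), symmetric])
    finally show "(\<Sum>d\<in>c ` P. \<rho> d q) = 1" using B[of q] by simp
  qed
  then show thesis by (rule that)
qed

end

section \<open>The divergence theorem\<close>

locale riemannian_manifold = smooth_manifold A
  for A :: "('m::{t2_space, second_countable_topology}, 'n::finite) chart set" +
  fixes g :: "('m, 'n, real ^ 'n ^ 'n) components"
  assumes metric: "riemannian_metric A g"
begin

lemma metric_chart: "c \<in> A \<Longrightarrow> metric_chart (chart_img c) (g c)"
  using metric chart(2) by unfold_locales (auto simp: riemannian_metric_def pos_def_def)

lemma metric_change:
  assumes "c \<in> A" "d \<in> A"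
  shows "metric_change (transition_dom c d) (g c) (chart_img d) (g d) (transition c d)"
proof -
  have sub: "transition_dom c d \<subseteq> chart_img c" using assms by (auto simp: transition_dom_iff)
  interpret C: metric_chart "chart_img c" "g c" by (rule metric_chart[OF assms(1)])
  interpret D: metric_chart "chart_img d" "g d" by (rule metric_chart[OF assms(2)])
  show ?thesis
  proof
    show "smooth_on (transition_dom c d) (g c)" by (rule smooth_on_subset[OF C.smooth_G sub])
    show "pos_def (g c x)" if "x \<in> transition_dom c d" for x using C.pos_def_G sub that by blast
    show "transition c d x \<in> chart_img d" if "x \<in> transition_dom c d" for x
      using transition_in[OF assms that] assms by (simp add: transition_dom_iff)
    show "g c x = transpose (jacobian (transition c d) (at x)) ** g d (transition c d x) ** jacobian (transition c d) (at x)"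
      if "x \<in> transition_dom c d" for x
      using metric assms that by (simp add: riemannian_metric_def)
  qed (use assms open_transition_dom smooth_transition in auto)
qed

definition dir_deriv :: "('m, 'n, real ^ 'n) components \<Rightarrow> ('m \<Rightarrow> real) \<Rightarrow> ('m, 'n, real) components"
  where "dir_deriv Z f c x = (\<Sum>i\<in>UNIV. Z c x $ i * pderiv_at i (in_coords f c) x)"

lemma dir_deriv_transition:
  assumes "c \<in> A" "d \<in> A" "x \<in> transition_dom c d" "smooth_vector_field A Z" "smooth_function A f"
  shows "dir_deriv Z f d (transition c d x) = dir_deriv Z f c x"
proof -
  let ?\<phi> = "transition c d"
  have y: "?\<phi> x \<in> chart_img d" using transition_in[OF assms(1-3)] assms by (simp add: transition_dom_iff)
  have d: "?\<phi> differentiable (at x)" "in_coords f d differentiable (at (?\<phi> x))"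
    using smooth_on_differentiable[OF smooth_transition] smooth_on_differentiable[OF smooth_function_in_coords]
      assms y by auto
  have "pderiv_at i (in_coords f c) x = pderiv_at i (in_coords f d \<circ> ?\<phi>) x" for i
    by (rule pderiv_at_cong[OF open_transition_dom[OF assms(1,2)] assms(3)])
      (simp add: in_coords_transition assms)
  then have "dir_deriv Z f c x = (\<Sum>i\<in>UNIV. \<Sum>j\<in>UNIV. jacobian ?\<phi> (at x) $ j $ i * Z c x $ i * pderiv_at j (in_coords f d) (?\<phi> x))"
    by (simp add: dir_deriv_def pderiv_at_compose[OF d] jacobian_entry sum_distrib_left mult_ac)
  also have "\<dots> = (\<Sum>j\<in>UNIV. \<Sum>i\<in>UNIV. jacobian ?\<phi> (at x) $ j $ i * Z c x $ i * pderiv_at j (in_coords f d) (?\<phi> x))"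
    by (rule sum.swap)
  also have "\<dots> = (\<Sum>j\<in>UNIV. (jacobian ?\<phi> (at x) *v Z c x) $ j * pderiv_at j (in_coords f d) (?\<phi> x))"
    by (simp add: matrix_vector_mult_def sum_distrib_right)
  also have "jacobian ?\<phi> (at x) *v Z c x = Z d (?\<phi> x)"
    using assms by (simp add: smooth_vector_field_def)
  finally show ?thesis by (simp add: dir_deriv_def)
qed

lemma smooth_volume: "c \<in> A \<Longrightarrow> smooth_on (chart_img c) (volume_form g c)"
  using metric_chart.smooth_sqrt_det[OF metric_chart, of c] by (simp add: volume_form_def[abs_def])

lemma smooth_dir_deriv:
  assumes "c \<in> A" "smooth_vector_field A Z" "smooth_function A f"
  shows "smooth_on (chart_img c) (dir_deriv Z f c)"
proof -
  have "smooth_on (chart_img c) (\<lambda>x. dir_deriv Z f c x)"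
    unfolding dir_deriv_def using assms
    by (intro smooth_on_sum smooth_on_mult smooth_on_nth smooth_on_pderiv smooth_function_in_coords chart)
      (auto simp: smooth_vector_field_def)
  then show ?thesis by simp
qed

end

section \<open>Integration with a fixed partition of unity\<close>

locale partitioned_manifold = riemannian_manifold A g
  for A :: "('m::{t2_space, second_countable_topology}, 'n::finite) chart set" and g +
  fixes F :: "('m, 'n) chart set" and \<rho> :: "('m, 'n) chart \<Rightarrow> 'm \<Rightarrow> real"
  assumes compact: "compact (UNIV :: 'm set)" and partition: "partition_of_unity A F \<rho>"
begin

lemma F: "finite F" "c \<in> F \<Longrightarrow> c \<in> A"
  using partition by (auto simp: partition_of_unity_def)

lemma rho: "c \<in> F \<Longrightarrow> smooth_function A (\<rho> c)" "c \<in> F \<Longrightarrow> closure {p. \<rho> c p \<noteq> 0} \<subseteq> chart_dom c"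
  "(\<Sum>c\<in>F. \<rho> c p) = 1"
  using partition by (auto simp: partition_of_unity_def)

abbreviation supp :: "('m, 'n) chart \<Rightarrow> (real ^ 'n) set"
  where "supp c \<equiv> chart_map c ` closure {p. \<rho> c p \<noteq> 0}"

lemma supp:
  assumes "c \<in> F"
  shows "compact (supp c)" "supp c \<subseteq> chart_img c" "x \<in> chart_img c - supp c \<Longrightarrow> in_coords (\<rho> c) c x = 0"
  using chart_support[OF compact F(2)[OF assms] rho(2)[OF assms]] by blast+

lemma rho_zero: "c \<in> F \<Longrightarrow> p \<notin> chart_dom c \<Longrightarrow> \<rho> c p = 0"
  using rho(2)[of c] closure_subset[of "{p. \<rho> c p \<noteq> 0}"] by blast

lemma dir_deriv_rho_zero:
  assumes "c \<in> F" "d \<in> A" "x \<in> chart_img d" "chart_inv d x \<notin> closure {p. \<rho> c p \<noteq> 0}"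
  shows "dir_deriv Z (\<rho> c) d x = 0"
proof -
  let ?V = "{x \<in> chart_img d. chart_inv d x \<in> - closure {p. \<rho> c p \<noteq> 0}}"
  have "open ?V" by (intro open_preimage[OF assms(2)]) auto
  moreover have "x \<in> ?V" using assms by simp
  moreover have "in_coords (\<rho> c) d y = 0" if "y \<in> ?V" for y
    using that closure_subset[of "{p. \<rho> c p \<noteq> 0}"] by (auto simp: in_coords_def)
  ultimately have "pderiv_at i (in_coords (\<rho> c) d) x = 0" for i
    by (rule pderiv_at_zero_outside)
  then show ?thesis by (simp add: dir_deriv_def)
qed

lemma dir_deriv_rho_supp:
  assumes "c \<in> F" "x \<in> chart_img c - supp c"
  shows "dir_deriv Z (\<rho> c) c x = 0"
proof (rule dir_deriv_rho_zero)
  show "chart_inv c x \<notin> closure {p. \<rho> c p \<noteq> 0}"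
    using assms chart_map_inv(2)[OF F(2)] by (metis DiffD1 DiffD2 image_eqI)
qed (use assms F in auto)

lemma sum_dir_deriv_rho:
  assumes "d \<in> A" "x \<in> chart_img d"
  shows "(\<Sum>c\<in>F. dir_deriv Z (\<rho> c) d x) = 0"
proof -
  have "(\<Sum>c\<in>F. dir_deriv Z (\<rho> c) d x) = (\<Sum>i\<in>UNIV. Z d x $ i * (\<Sum>c\<in>F. pderiv_at i (in_coords (\<rho> c) d) x))"
    unfolding dir_deriv_def by (subst sum.swap) (simp add: sum_distrib_left)
  also have "\<dots> = (\<Sum>i\<in>UNIV. Z d x $ i * pderiv_at i (\<lambda>y. \<Sum>c\<in>F. in_coords (\<rho> c) d y) x)"
    using assms by (subst pderiv_at_sum)
      (auto intro: smooth_on_differentiable smooth_function_in_coords rho)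
  also have "\<dots> = 0"
    by (simp add: in_coords_def rho)
  finally show ?thesis .
qed

text \<open>Extension by zero makes an integrand supported in a compact part of the chart image
  continuous on the whole space.\<close>

definition local_integral :: "('m, 'n, real) components \<Rightarrow> ('m, 'n) chart \<Rightarrow> real"
  where "local_integral w c = (LINT x|lborel. (if x \<in> chart_img c then w c x else 0))"

lemma integrable_supp:
  fixes f :: "real ^ 'n \<Rightarrow> real"
  assumes "c \<in> F" "continuous_on (chart_img c) f" "\<And>x. x \<in> chart_img c - supp c \<Longrightarrow> f x = 0"
  shows "integrable lborel (\<lambda>x. if x \<in> chart_img c then f x else 0)"
  by (rule extend_zero_compact_support(2)[OF chart(2)[OF F(2)[OF assms(1)]] supp(1,2)[OF assms(1)] assms(2,3)])

lemma local_integral_add: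
  assumes "c \<in> F" "continuous_on (chart_img c) (v c)" "continuous_on (chart_img c) (w c)"
    "\<And>x. x \<in> chart_img c - supp c \<Longrightarrow> v c x = 0" "\<And>x. x \<in> chart_img c - supp c \<Longrightarrow> w c x = 0"
  shows "local_integral (\<lambda>c x. v c x + w c x) c = local_integral v c + local_integral w c"
proof -
  have "(\<lambda>x. if x \<in> chart_img c then v c x + w c x else 0)
      = (\<lambda>x. (if x \<in> chart_img c then v c x else 0) + (if x \<in> chart_img c then w c x else 0))"
    by auto
  then show ?thesis
    unfolding local_integral_def
    using integrable_supp[OF assms(1,2,4)] integrable_supp[OF assms(1,3,5)] by simp
qed

lemma local_integral_sum:
  assumes "c \<in> F" "\<And>a. a \<in> I \<Longrightarrow> continuous_on (chart_img c) (w a c)"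
    "\<And>a x. a \<in> I \<Longrightarrow> x \<in> chart_img c - supp c \<Longrightarrow> w a c x = 0"
  shows "local_integral (\<lambda>c x. \<Sum>a\<in>I. w a c x) c = (\<Sum>a\<in>I. local_integral (w a) c)"
proof -
  have "(\<lambda>x. if x \<in> chart_img c then \<Sum>a\<in>I. w a c x else 0)
      = (\<lambda>x. \<Sum>a\<in>I. if x \<in> chart_img c then w a c x else 0)"
    by auto
  then show ?thesis
    unfolding local_integral_def using integrable_supp[OF assms] by (simp add: Bochner_Integration.integral_sum)
qed

lemma local_integral_cong:
  "(\<And>x. x \<in> chart_img c \<Longrightarrow> v c x = w c x) \<Longrightarrow> local_integral v c = local_integral w c"
  unfolding local_integral_def by (intro Bochner_Integration.integral_cong) auto

text \<open>The sum in \<open>integral_form\<close> with the chosen partition replaced by the fixed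
  one.\<close>

definition partition_integral :: "('m, 'n, real) components \<Rightarrow> real"
  where "partition_integral w = (\<Sum>c\<in>F. local_integral (\<lambda>c x. in_coords (\<rho> c) c x * w c x) c)"

lemma partition_integral_add:
  assumes "\<And>c. c \<in> A \<Longrightarrow> continuous_on (chart_img c) (v c)" "\<And>c. c \<in> A \<Longrightarrow> continuous_on (chart_img c) (w c)"
  shows "partition_integral (\<lambda>c x. v c x + w c x) = partition_integral v + partition_integral w"
proof -
  have "local_integral (\<lambda>c x. in_coords (\<rho> c) c x * (v c x + w c x)) c
      = local_integral (\<lambda>c x. in_coords (\<rho> c) c x * v c x) c + local_integral (\<lambda>c x. in_coords (\<rho> c) c x * w c x) c"
    if c: "c \<in> F" for c
  proof -
    have "continuous_on (chart_img c) (in_coords (\<rho> c) c)"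
      using smooth_on_continuous[OF smooth_function_in_coords[OF rho(1)]] c F by blast
    then show ?thesis
      unfolding distrib_left using c F assms supp(3)
      by (intro local_integral_add continuous_on_mult) auto
  qed
  then show ?thesis by (simp add: partition_integral_def sum.distrib)
qed

lemma partition_integral_cmult: "partition_integral (\<lambda>c x. k * w c x) = k * partition_integral w"
proof -
  have "local_integral (\<lambda>c x. in_coords (\<rho> c) c x * (k * w c x)) c = k * local_integral (\<lambda>c x. in_coords (\<rho> c) c x * w c x) c" for c
  proof -
    have "(\<lambda>x. if x \<in> chart_img c then in_coords (\<rho> c) c x * (k * w c x) else 0)
        = (\<lambda>x. k * (if x \<in> chart_img c then in_coords (\<rho> c) c x * w c x else 0))"
      by auto
    then show ?thesis by (simp add: local_integral_def)
  qed
  then show ?thesis by (simp add: partition_integral_def sum_distrib_left)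
qed

lemma partition_integral_cong:
  "(\<And>c x. c \<in> A \<Longrightarrow> x \<in> chart_img c \<Longrightarrow> v c x = w c x) \<Longrightarrow> partition_integral v = partition_integral w"
  unfolding partition_integral_def by (intro sum.cong local_integral_cong refl) (simp add: F)

text \<open>The integrand vanishes outside the overlap of the two charts, so that the two integrals are
  related by the change of variables formula.\<close>

lemma local_integral_change_chart:
  assumes c: "c \<in> F" and d: "d \<in> F" and Z: "smooth_vector_field A Z"
  defines "w \<equiv> \<lambda>e x. in_coords (\<rho> d) e x * (volume_form g e x * dir_deriv Z (\<rho> c) e x)"
  shows "local_integral w c = local_integral w d"
proof -
  note cA = F(2)[OF c] and dA = F(2)[OF d]
  let ?S = "transition_dom c d" and ?\<phi> = "transition c d"
  interpret metric_change ?S "g c" "chart_img d" "g d" ?\<phi> by (rule metric_change[OF cA dA])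
  define f where "f x = (if x \<in> chart_img d then w d x else 0)" for x
  have cont: "continuous_on (chart_img e) (w e)" if "e \<in> A" for e
    unfolding w_def
    by (intro continuous_on_mult smooth_on_continuous smooth_function_in_coords smooth_volume
        smooth_dir_deriv rho c d that Z)
  have f_int: "integrable lborel f"
    unfolding f_def by (rule integrable_supp[OF d cont[OF dA]]) (use supp(3)[OF d] in \<open>simp add: w_def\<close>)
  have f_zero: "f y = 0" if "y \<notin> ?\<phi> ` ?S" for y
  proof (cases "y \<in> chart_img d")
    case True
    then have "chart_inv d y \<notin> chart_dom c"
      using that by (simp add: transition_image[OF cA dA] transition_dom_iff[OF dA])
    then have "chart_inv d y \<notin> closure {p. \<rho> c p \<noteq> 0}" using rho(2)[OF c] by blast
    then show ?thesis using dir_deriv_rho_zero[OF c dA True] by (simp add: f_def w_def)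
  qed (simp add: f_def)
  \<comment> \<open>On the overlap the Jacobian factor converts one volume density into the other.
    In the rest of the chart image of \<open>c\<close> the factor \<open>\<rho> d\<close>
    vanishes.\<close>
  have g_eq: "(if x \<in> ?S then \<bar>det (matrix (frechet_derivative ?\<phi> (at x)))\<bar> * f (?\<phi> x) else 0)
      = (if x \<in> chart_img c then w c x else 0)" for x
  proof (cases "x \<in> ?S")
    case True
    then have "?\<phi> x \<in> chart_img d" "x \<in> chart_img c" using phi_maps cA by (auto simp: transition_dom_iff)
    then show ?thesis
      using True dir_deriv_transition[OF cA dA True Z rho(1)[OF c]] in_coords_transition[OF cA dA True, of "\<rho> d"]
        sqrt_det_G[OF True]
      by (simp add: f_def w_def volume_form_def jacobian_def)
  next
    case False
    then show ?thesis
      using rho_zero[OF d, of "chart_inv c x"] cA by (simp add: transition_dom_iff w_def in_coords_def)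
  qed
  have "continuous_on UNIV (\<lambda>x. if x \<in> chart_img c then w c x else 0)"
    by (rule extend_zero_compact_support(1)[OF chart(2)[OF cA] supp(1)[OF c] supp(2)[OF c] cont[OF cA]])
      (use dir_deriv_rho_supp[OF c] in \<open>simp add: w_def\<close>)
  then have meas: "(\<lambda>x. if x \<in> ?S then \<bar>det (matrix (frechet_derivative ?\<phi> (at x)))\<bar> * f (?\<phi> x) else 0)
      \<in> borel_measurable borel"
    unfolding g_eq by (rule borel_measurable_continuous_onI)
  have der: "(?\<phi> has_derivative frechet_derivative ?\<phi> (at x)) (at x)" if "x \<in> ?S" for x
    using smooth_on_differentiable[OF smooth_phi that] by (simp add: frechet_derivative_works)
  have "local_integral w d = integral\<^sup>L lborel f" by (simp add: local_integral_def f_def[abs_def])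
  also have "\<dots> = (LINT x|lborel. (if x \<in> ?S then \<bar>det (matrix (frechet_derivative ?\<phi> (at x)))\<bar> * f (?\<phi> x) else 0))"
    by (rule integral_change_of_variables_lborel[OF open_U der inj_transition[OF cA dA] f_int f_zero meas])
  also have "\<dots> = local_integral w c"
    unfolding local_integral_def by (rule Bochner_Integration.integral_cong[OF refl g_eq])
  finally show ?thesis by simp
qed

text \<open>Multiplied by the cutoff and extended by zero, the density times a component of Z has
  compact support, so the integral of its partial derivative vanishes. The product rule splits the
  sum of these derivatives into the two integrands.\<close>

lemma local_integral_by_parts:
  assumes c: "c \<in> F" and Z: "smooth_vector_field A Z"
  shows "local_integral (\<lambda>c x. in_coords (\<rho> c) c x * (divergence (g c) (Z c) x * volume_form g c x)) c
    = - local_integral (\<lambda>c x. volume_form g c x * dir_deriv Z (\<rho> c) c x) c"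
proof -
  note cA = F(2)[OF c]
  interpret metric_chart "chart_img c" "g c" by (rule metric_chart[OF cA])
  let ?r = "in_coords (\<rho> c) c" and ?v = "volume_form g c"
  have vol: "?v = (\<lambda>y. sqrt (det (g c y)))" by (simp add: volume_form_def fun_eq_iff)
  have sm: "smooth_on (chart_img c) ?r" "smooth_on (chart_img c) ?v" "smooth_on (chart_img c) (Z c)"
    using smooth_function_in_coords[OF rho(1)[OF c] cA] smooth_volume[OF cA] Z cA
    by (auto simp: smooth_vector_field_def)
  define f where "f i x = ?r x * (?v x * Z c x $ i)" for i x
  define u where "u i x = (if x \<in> chart_img c then f i x else 0)" for i x
  have smf: "smooth_on (chart_img c) (f i)" for i
  proof -
    have "smooth_on (chart_img c) (\<lambda>x. f i x)"
      unfolding f_def by (intro smooth_on_mult smooth_on_nth sm open_U)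
    then show ?thesis by simp
  qed
  have smu: "smooth_on UNIV (u i)" for i
  proof -
    have "smooth_on UNIV (\<lambda>x. u i x)"
      unfolding u_def by (rule smooth_on_extend_zero[OF open_U supp(1)[OF c] supp(2)[OF c] smf])
        (use supp(3)[OF c] in \<open>simp add: f_def\<close>)
    then show ?thesis by simp
  qed
  have u0: "u i x = 0" if "x \<notin> supp c" for i x
    using that supp(3)[OF c, of x] by (simp add: u_def f_def)
  have int0: "integral\<^sup>L lborel (pderiv_at i (u i)) = 0" for i
    by (rule integral_pderiv_compact_support[OF smu supp(1)[OF c] u0])
  have out: "pderiv_at i (u i) x = 0" if "x \<notin> supp c" for i x
    by (rule pderiv_at_zero_outside[of "- supp c"])
      (use that u0 compact_imp_closed[OF supp(1)[OF c]] in auto)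
  have integrable: "integrable lborel (pderiv_at i (u i))" for i
  proof -
    have "integrable lborel (\<lambda>x. if x \<in> UNIV then pderiv_at i (u i) x else 0)"
      by (rule extend_zero_compact_support(2)[OF open_UNIV supp(1)[OF c]])
        (use smooth_on_continuous[OF smooth_on_pderiv[OF smu]] out in auto)
    then show ?thesis by simp
  qed
  have inside: "(\<Sum>i\<in>UNIV. pderiv_at i (u i) x)
      = ?r x * (divergence (g c) (Z c) x * ?v x) + ?v x * dir_deriv Z (\<rho> c) c x" if x: "x \<in> chart_img c" for x
  proof -
    have d: "?r differentiable (at x)" "?v differentiable (at x)" "Z c differentiable (at x)"
      using smooth_on_differentiable[OF _ x] sm by blast+
    have "pderiv_at i (u i) x = ?r x * pderiv_at i (\<lambda>y. ?v y * Z c y $ i) x + pderiv_at i ?r x * (?v x * Z c x $ i)" for i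
    proof -
      have "pderiv_at i (u i) x = pderiv_at i (\<lambda>y. ?r y * (?v y * Z c y $ i)) x"
        by (rule pderiv_at_cong[OF open_U x]) (simp add: u_def f_def)
      then show ?thesis
        using d by (simp add: pderiv_at_mult differentiable_nth differentiable_bilinear[OF bounded_bilinear_mult])
    qed
    then have "(\<Sum>i\<in>UNIV. pderiv_at i (u i) x)
        = ?r x * (\<Sum>i\<in>UNIV. pderiv_at i (\<lambda>y. ?v y * Z c y $ i) x) + ?v x * dir_deriv Z (\<rho> c) c x"
      by (simp add: sum.distrib sum_distrib_left dir_deriv_def mult_ac)
    also have "(\<Sum>i\<in>UNIV. pderiv_at i (\<lambda>y. ?v y * Z c y $ i) x) = divergence (g c) (Z c) x * ?v x"
      unfolding vol using divergence_density[OF x d(3)] by simp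
    finally show ?thesis .
  qed
  have smdiv: "smooth_on (chart_img c) (\<lambda>x. divergence (g c) (Z c) x)"
    unfolding divergence_def
    by (intro smooth_on_sum smooth_on_add smooth_on_mult smooth_on_pderiv smooth_on_nth smooth_christoffel sm open_U)
  let ?a = "\<lambda>c x. in_coords (\<rho> c) c x * (divergence (g c) (Z c) x * volume_form g c x)"
  let ?b = "\<lambda>c x. volume_form g c x * dir_deriv Z (\<rho> c) c x"
  have "local_integral ?a c + local_integral ?b c = local_integral (\<lambda>c x. ?a c x + ?b c x) c"
  proof (rule local_integral_add[symmetric, OF c])
    show "continuous_on (chart_img c) (?a c)" "continuous_on (chart_img c) (?b c)"
      by (intro continuous_on_mult smooth_on_continuous sm smdiv smooth_dir_deriv cA Z rho c)+
  qed (use supp(3)[OF c] dir_deriv_rho_supp[OF c] in auto)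
  also have "\<dots> = (LINT x|lborel. (\<Sum>i\<in>UNIV. pderiv_at i (u i) x))"
    unfolding local_integral_def
  proof (rule Bochner_Integration.integral_cong[OF refl])
    fix x
    show "(if x \<in> chart_img c then ?a c x + ?b c x else 0) = (\<Sum>i\<in>UNIV. pderiv_at i (u i) x)"
    proof (cases "x \<in> chart_img c")
      case True
      then show ?thesis by (simp add: inside)
    next
      case False
      then have "x \<notin> supp c" using supp(2)[OF c] by blast
      then show ?thesis using False by (simp add: out)
    qed
  qed
  also have "\<dots> = 0"
    using integrable int0 by (simp add: Bochner_Integration.integral_sum)
  finally show ?thesis by simp
qed

theorem divergence_theorem:
  assumes Z: "smooth_vector_field A Z"
  shows "partition_integral (\<lambda>c x. divergence (g c) (Z c) x * volume_form g c x) = 0"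
proof -
  \<comment> \<open>The chart \<open>e\<close> in which the integrand is expressed is kept separate
    from the indices \<open>c\<close> and \<open>d\<close>, so that one integrand can be evaluated
    in either chart.\<close>
  define w where "w c d = (\<lambda>e x. in_coords (\<rho> d) e x * (volume_form g e x * dir_deriv Z (\<rho> c) e x))" for c d
  have cont: "continuous_on (chart_img e) (w c d e)" if "c \<in> F" "d \<in> F" "e \<in> A" for c d e
    unfolding w_def
    by (intro continuous_on_mult smooth_on_continuous smooth_function_in_coords smooth_volume
        smooth_dir_deriv rho that Z)
  have "local_integral (\<lambda>c x. volume_form g c x * dir_deriv Z (\<rho> c) c x) c = (\<Sum>d\<in>F. local_integral (w c d) d)"
    if c: "c \<in> F" for c
  proof -
    have "local_integral (\<lambda>c x. volume_form g c x * dir_deriv Z (\<rho> c) c x) c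
        = local_integral (\<lambda>e x. \<Sum>d\<in>F. w c d e x) c"
    proof (rule local_integral_cong)
      fix x
      have "(\<Sum>d\<in>F. w c d c x) = (\<Sum>d\<in>F. \<rho> d (chart_inv c x)) * (volume_form g c x * dir_deriv Z (\<rho> c) c x)"
        by (simp add: w_def in_coords_def sum_distrib_right)
      then show "volume_form g c x * dir_deriv Z (\<rho> c) c x = (\<Sum>d\<in>F. w c d c x)"
        by (simp add: rho(3))
    qed
    also have "\<dots> = (\<Sum>d\<in>F. local_integral (w c d) c)"
      by (rule local_integral_sum[OF c]) (use cont c F dir_deriv_rho_supp[OF c] in \<open>auto simp: w_def\<close>)
    \<comment> \<open>Moving each summand to chart \<open>d\<close> makes the domain of integration
      independent of \<open>c\<close>, so the sum over \<open>c\<close> can be taken under the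
      integral.\<close>
    also have "\<dots> = (\<Sum>d\<in>F. local_integral (w c d) d)"
      unfolding w_def by (intro sum.cong refl local_integral_change_chart c Z)
    finally show ?thesis .
  qed
  then have "partition_integral (\<lambda>c x. divergence (g c) (Z c) x * volume_form g c x)
      = - (\<Sum>c\<in>F. \<Sum>d\<in>F. local_integral (w c d) d)"
    by (simp add: partition_integral_def local_integral_by_parts Z sum_negf)
  also have "(\<Sum>c\<in>F. \<Sum>d\<in>F. local_integral (w c d) d) = (\<Sum>d\<in>F. \<Sum>c\<in>F. local_integral (w c d) d)"
    by (rule sum.swap)
  also have "\<dots> = (\<Sum>d\<in>F. 0)"
  proof (rule sum.cong[OF refl])
    fix d assume d: "d \<in> F"
    have "(\<Sum>c\<in>F. local_integral (w c d) d) = local_integral (\<lambda>e x. \<Sum>c\<in>F. w c d e x) d"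
      by (rule local_integral_sum[OF d, symmetric]) (use cont d F supp(3)[OF d] in \<open>auto simp: w_def\<close>)
    also have "\<dots> = local_integral (\<lambda>e x. 0) d"
    proof (rule local_integral_cong)
      fix x assume "x \<in> chart_img d"
      then have "in_coords (\<rho> d) d x * (volume_form g d x * (\<Sum>c\<in>F. dir_deriv Z (\<rho> c) d x)) = 0"
        using sum_dir_deriv_rho[OF F(2)[OF d]] by simp
      then show "(\<Sum>c\<in>F. w c d d x) = 0"
        by (simp add: w_def sum_distrib_left)
    qed
    finally show "(\<Sum>c\<in>F. local_integral (w c d) d) = 0" by (simp add: local_integral_def)
  qed
  finally show ?thesis by simp
qed

end

section \<open>Integral identities for almost Ricci solitons\<close>

lemma divergence_scaleR:
  assumes "f differentiable (at x)" "Y differentiable (at x)"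
  shows "divergence G (\<lambda>y. f y *\<^sub>R Y y) x = f x * divergence G Y x + (\<Sum>i\<in>UNIV. Y x $ i * pderiv_at i f x)"
  using assms
  by (simp add: divergence_def pderiv_at_mult differentiable_nth sum.distrib sum_distrib_left algebra_simps)

context metric_chart
begin

lemma smooth_divergence:
  assumes "smooth_on U Z"
  shows "smooth_on U (divergence G Z)"
proof -
  have "smooth_on U (\<lambda>x. divergence G Z x)"
    unfolding divergence_def
    by (intro smooth_on_sum smooth_on_add smooth_on_mult smooth_on_pderiv smooth_on_nth smooth_christoffel
        assms open_U)
  then show ?thesis by simp
qed

lemma smooth_inner_gradient:
  assumes "smooth_on U f" "smooth_on U X"
  shows "smooth_on U (\<lambda>x. vector_inner (G x) (gradient G f x) (X x))"
proof (rule smooth_on_cong[OF open_U])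
  show "smooth_on U (\<lambda>x. \<Sum>j\<in>UNIV. X x $ j * pderiv_at j f x)"
    by (intro smooth_on_sum smooth_on_mult smooth_on_nth smooth_on_pderiv assms open_U)
qed (simp add: inner_gradient)

lemma smooth_gradient:
  assumes "smooth_on U f"
  shows "smooth_on U (gradient G f)"
proof -
  have "smooth_on U (\<lambda>x. gradient G f x)"
    unfolding gradient_def inv_metric_def
    by (intro smooth_on_vec_lambda smooth_on_sum smooth_on_mult smooth_on_entry smooth_Gi smooth_on_pderiv
        assms open_U)
  then show ?thesis by simp
qed

end

locale soliton_manifold = partitioned_manifold A g F \<rho>
  for A :: "('m::{t2_space, second_countable_topology}, 'n::finite) chart set" and g F \<rho> +
  fixes X :: "('m, 'n, real ^ 'n) components" and lam :: "'m \<Rightarrow> real"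
  assumes soliton: "almost_ricci_soliton A g X lam"
begin

lemma X_field: "smooth_vector_field A X"
  using soliton by (simp add: almost_ricci_soliton_def)

lemma smooth_field: "smooth_vector_field A Z \<Longrightarrow> c \<in> A \<Longrightarrow> smooth_on (chart_img c) (Z c)"
  by (simp add: smooth_vector_field_def)

lemma soliton_equation:
  "c \<in> A \<Longrightarrow> x \<in> chart_img c \<Longrightarrow>
    ricci (g c) x + (1/2) *\<^sub>R lie_derivative_metric (X c) (g c) x = in_coords lam c x *\<^sub>R g c x"
  using soliton by (simp add: almost_ricci_soliton_def)

lemma tensoriality:
  assumes c: "c \<in> A" and d: "d \<in> A" and x: "x \<in> transition_dom c d"
  shows "scalar_curvature (g d) (transition c d x) = scalar_curvature (g c) x"
    and "metric_chart.traceless_field (g d) (X d) (transition c d x)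
      = jacobian (transition c d) (at x) *v metric_chart.traceless_field (g c) (X c) x"
proof -
  interpret metric_change "transition_dom c d" "g c" "chart_img d" "g d" "transition c d"
    by (rule metric_change[OF c d])
  have sub: "transition_dom c d \<subseteq> chart_img c" using c by (auto simp: transition_dom_iff)
  have eq: "ricci (g d) (transition c d x) + (1/2) *\<^sub>R lie_derivative_metric (X d) (g d) (transition c d x)
      = in_coords lam c x *\<^sub>R g d (transition c d x)"
    using soliton_equation[OF d phi_maps[OF x]] by (simp add: in_coords_transition[OF c d x])
  have field: "X d (transition c d y) = J y *v X c y" if "y \<in> transition_dom c d" for y
    using X_field c d that by (simp add: smooth_vector_field_def)
  note * = soliton_change[OF x smooth_on_subset[OF smooth_field[OF X_field c] sub]
      smooth_field[OF X_field d] field soliton_equation[OF c] eq]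
  show "scalar_curvature (g d) (transition c d x) = scalar_curvature (g c) x"
    "metric_chart.traceless_field (g d) (X d) (transition c d x)
      = J x *v metric_chart.traceless_field (g c) (X c) x"
    using * x sub by blast+
qed

lemma traceless_field: "smooth_vector_field A (\<lambda>c. metric_chart.traceless_field (g c) (X c))"
  unfolding smooth_vector_field_def
  using tensoriality(2) metric_chart.smooth_traceless_field[OF metric_chart smooth_field[OF X_field]]
  by blast

text \<open>Needed for the field S Y of the second identity: the divergence theorem applies only to
  fields with the vector transformation law.\<close>

lemma scalar_curvature_field:
  assumes "smooth_vector_field A Y"
  shows "smooth_vector_field A (\<lambda>c x. scalar_curvature (g c) x *\<^sub>R Y c x)"
  unfolding smooth_vector_field_def
proof (intro conjI ballI)
  fix c assume c: "c \<in> A"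
  show "smooth_on (chart_img c) (\<lambda>x. scalar_curvature (g c) x *\<^sub>R Y c x)"
    by (intro smooth_on_bilinear[OF _ bounded_bilinear_scaleR] metric_chart.smooth_scalar_curvature
        metric_chart smooth_field assms chart c)
  fix d x assume d: "d \<in> A" and x: "x \<in> transition_dom c d"
  have "Y d (transition c d x) = jacobian (transition c d) (at x) *v Y c x"
    using assms c d x by (simp add: smooth_vector_field_def)
  then show "scalar_curvature (g d) (transition c d x) *\<^sub>R Y d (transition c d x)
      = jacobian (transition c d) (at x) *v (scalar_curvature (g c) x *\<^sub>R Y c x)"
    by (simp add: tensoriality(1)[OF c d x] matrix_vector_mult_scaleR)
qed

abbreviation grad_S_inner :: "('m, 'n, real ^ 'n) components \<Rightarrow> ('m, 'n, real) components"
  where "grad_S_inner V c x \<equiv> vector_inner (g c x) (gradient (g c) (scalar_curvature (g c)) x) (V c x)"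

lemma continuous_grad_S:
  assumes "c \<in> A" "smooth_on (chart_img c) (V c)"
  shows "continuous_on (chart_img c) (\<lambda>x. grad_S_inner V c x * volume_form g c x)"
  by (intro continuous_on_mult smooth_on_continuous smooth_volume metric_chart.smooth_inner_gradient
      metric_chart metric_chart.smooth_scalar_curvature assms)

lemma continuous_divergence:
  assumes "c \<in> A" "smooth_on (chart_img c) (Z c)"
  shows "continuous_on (chart_img c) (\<lambda>x. divergence (g c) (Z c) x * volume_form g c x)"
  by (intro continuous_on_mult smooth_on_continuous smooth_volume metric_chart.smooth_divergence
      metric_chart assms)

lemma integral_traceless_ricci:
  "partition_integral (\<lambda>c x. (tensor_norm (g c x) (traceless_ricci (g c) x))\<^sup>2 * volume_form g c x)
    = (real CARD('n) - 2) / (2 * real CARD('n)) *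
      partition_integral (\<lambda>c x. grad_S_inner X c x * volume_form g c x)"
proof -
  let ?k = "(real CARD('n) - 2) / (2 * real CARD('n))"
  define Z where "Z c = metric_chart.traceless_field (g c) (X c)" for c
  have Z: "smooth_vector_field A Z" using traceless_field by (simp add: Z_def[abs_def])
  have "partition_integral (\<lambda>c x. (tensor_norm (g c x) (traceless_ricci (g c) x))\<^sup>2 * volume_form g c x)
      = partition_integral (\<lambda>c x. ?k * (grad_S_inner X c x * volume_form g c x)
        + (- 1) * (divergence (g c) (Z c) x * volume_form g c x))"
  proof (rule partition_integral_cong)
    fix c x assume c: "c \<in> A" and x: "x \<in> chart_img c"
    show "(tensor_norm (g c x) (traceless_ricci (g c) x))\<^sup>2 * volume_form g c x
        = ?k * (grad_S_inner X c x * volume_form g c x) + (- 1) * (divergence (g c) (Z c) x * volume_form g c x)"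
      using metric_chart.soliton_identity[OF metric_chart[OF c] x smooth_field[OF X_field c] soliton_equation[OF c]]
      by (simp add: Z_def left_diff_distrib)
  qed
  also have "\<dots> = partition_integral (\<lambda>c x. ?k * (grad_S_inner X c x * volume_form g c x))
      + partition_integral (\<lambda>c x. (- 1) * (divergence (g c) (Z c) x * volume_form g c x))"
    by (rule partition_integral_add)
      (intro continuous_on_mult[OF continuous_on_const] continuous_grad_S continuous_divergence
        smooth_field X_field Z; assumption)+
  finally show ?thesis
    unfolding partition_integral_cmult divergence_theorem[OF Z] by simp
qed

lemma integral_grad_S_gradient:
  assumes "hodge_de_rham_decomposition A g X h Y"
  shows "partition_integral (\<lambda>c x. grad_S_inner X c x * volume_form g c x)
    = partition_integral (\<lambda>c x. grad_S_inner (\<lambda>c. gradient (g c) (in_coords h c)) c x * volume_form g c x)"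
proof -
  let ?H = "\<lambda>c. gradient (g c) (in_coords h c)"
  define SY where "SY c x = scalar_curvature (g c) x *\<^sub>R Y c x" for c x
  have h: "smooth_function A h" and Y: "smooth_vector_field A Y"
    and dec: "\<And>c x. c \<in> A \<Longrightarrow> x \<in> chart_img c \<Longrightarrow> X c x = ?H c x + Y c x \<and> divergence (g c) (Y c) x = 0"
    using assms by (auto simp: hodge_de_rham_decomposition_def)
  have SY: "smooth_vector_field A SY"
    using scalar_curvature_field[OF Y] by (simp add: SY_def[abs_def])
  have "partition_integral (\<lambda>c x. grad_S_inner X c x * volume_form g c x)
      = partition_integral (\<lambda>c x. grad_S_inner ?H c x * volume_form g c x + divergence (g c) (SY c) x * volume_form g c x)"
  proof (rule partition_integral_cong)
    fix c x assume c: "c \<in> A" and x: "x \<in> chart_img c"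
    interpret metric_chart "chart_img c" "g c" by (rule metric_chart[OF c])
    have "divergence (g c) (SY c) x = (\<Sum>i\<in>UNIV. Y c x $ i * pderiv_at i (scalar_curvature (g c)) x)"
      unfolding SY_def[abs_def] using dec[OF c x]
        divergence_scaleR[OF differentiable(6)[OF x] smooth_on_differentiable[OF smooth_field[OF Y c] x], of "g c"]
      by simp
    moreover have "X c x = ?H c x + Y c x" using dec[OF c x] by blast
    ultimately show "grad_S_inner X c x * volume_form g c x
        = grad_S_inner ?H c x * volume_form g c x + divergence (g c) (SY c) x * volume_form g c x"
      by (simp add: inner_gradient[OF x] sum.distrib distrib_right)
  qed
  also have "\<dots> = partition_integral (\<lambda>c x. grad_S_inner ?H c x * volume_form g c x)
      + partition_integral (\<lambda>c x. divergence (g c) (SY c) x * volume_form g c x)"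
    by (rule partition_integral_add)
      (intro continuous_grad_S continuous_divergence smooth_field[OF SY]
        metric_chart.smooth_gradient metric_chart smooth_function_in_coords h; assumption)+
  finally show ?thesis by (simp add: divergence_theorem[OF SY])
qed

end

theorem theorem1:
  fixes A :: "('m::{t2_space, second_countable_topology}, 'n::finite) chart set"
    and g :: "('m, 'n, real ^ 'n ^ 'n) components"
    and X Y :: "('m, 'n, real ^ 'n) components"
    and lam h :: "'m \<Rightarrow> real"
  assumes "compact (UNIV :: 'm set)"
    and "oriented_atlas A"
    and "almost_ricci_soliton A g X lam"
    and "hodge_de_rham_decomposition A g X h Y"
  shows "integral_volume A g (\<lambda>c x. (tensor_norm (g c x) (traceless_ricci (g c) x))\<^sup>2)
           = (real CARD('n) - 2) / (2 * real CARD('n)) *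
             integral_volume A g
               (\<lambda>c x. vector_inner (g c x) (gradient (g c) (scalar_curvature (g c)) x) (X c x))
       \<and> integral_volume A g (\<lambda>c x. (tensor_norm (g c x) (traceless_ricci (g c) x))\<^sup>2)
           = (real CARD('n) - 2) / (2 * real CARD('n)) *
             integral_volume A g
               (\<lambda>c x. vector_inner (g c x) (gradient (g c) (scalar_curvature (g c)) x)
                         (gradient (g c) (in_coords h c) x))"
proof -
  interpret smooth_manifold A
    using assms(2) by unfold_locales (simp add: oriented_atlas_def)
  \<comment> \<open>This is literally the pair selected inside \<open>integral_form\<close>;
    existence of a partition guarantees that it is one.\<close>
  define P where "P = (SOME P. case P of (F, \<rho>) \<Rightarrow> partition_of_unity A F \<rho>)"
  obtain F \<rho> where P: "P = (F, \<rho>)" by (cases P)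
  have "\<exists>P. case P of (F, \<rho>) \<Rightarrow> partition_of_unity A F \<rho>"
    using partition_of_unity_exists[OF assms(1)] by (metis case_prod_conv)
  then have "case P of (F, \<rho>) \<Rightarrow> partition_of_unity A F \<rho>"
    unfolding P_def by (rule someI_ex)
  then have part: "partition_of_unity A F \<rho>" by (simp add: P)
  interpret soliton_manifold A g F \<rho> X lam
    using assms(1,3) part by unfold_locales (auto simp: almost_ricci_soliton_def)
  have integral: "integral_volume A g f = partition_integral (\<lambda>c x. f c x * volume_form g c x)" for f
  proof -
    have "(LINT x:S|lborel. w x) = (LINT x|lborel. (if x \<in> S then w x else 0))"
      for S :: "(real ^ 'n) set" and w :: "real ^ 'n \<Rightarrow> real"
      unfolding set_lebesgue_integral_def by (intro Bochner_Integration.integral_cong) (auto simp: indicator_def)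
    then show ?thesis
      by (simp add: integral_volume_def integral_form_def P_def[symmetric] P partition_integral_def local_integral_def)
  qed
  show ?thesis
    unfolding integral integral_traceless_ricci integral_grad_S_gradient[OF assms(4)] by simp
qed

end
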